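(* Let $L$ be a number field of degree $d_L$ over $\mathbb{Q}$. There exists a constant $C_L$ depending only on $L$ (and one can take $C_{\mathbb{Q}}=960$) such that the following holds. Let $A\le B$ be integers, write $D=B-A$ and $M=\max\{|A|,|B|\}$. Let $F\in L(X)$ be a univariate rational fraction of degree at most $d\geq 1$. Let $S$ be a subset of $\{x\in\mathbb{Z}: A\le x\le B\}$ which contains no poles of $F$, let $\eta\geq 1$, and let $H\geq \max\{4,\log(2M)\}$. Assume that (1) $h(F(x))\leq H$ for every $x\in S$; (2) $S$ contains at least $D/\eta$ elements; (3) $D\geq \max\{\eta d^3H,\ 4\eta d d_L\}$. Then \[ h(F)\leq H + C_L\,\eta d\log(\eta d H) + d\log(2M) + \log(d+1). \]
   Context: For a number field $L$ of degree $d_L$ over $\mathbb{Q}$ and a place $v$ of $L$, $d_v=[L_v:\mathbb{Q}_v]$ denotes the local degree, and $|\cdot|_v$ denotes the absolute value on $L$ extending the usual absolute value of $\mathbb{Q}$ if $v$ is archimedean, and satisfying $|p|_v=1/p$ if $v$ is nonarchimedean lying over the prime $p$. The height of $a\in L$ is $h(a)=\sum_{v}\frac{d_v}{d_L}\log\max\{1,|a|_v\}$, the sum over all places of $L$. For $F\in L(X)$ written as $F=P/Q$ with $P,Q\in L[X]$ coprime, $h(F)=\sum_v\frac{d_v}{d_L}\log\max_c|c|_v$, where $c$ runs over all coefficients of $P$ and $Q$ (this is independent of the choice of $P,Q$). The degree of $F$ is $\max\{\deg P,\deg Q\}$. *)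

theory Defs
  imports
    "HOL-Analysis.Analysis"
    "HOL-Computational_Algebra.Computational_Algebra"
    "HOL-Algebra.Embedded_Algebras"
    "HOL-Algebra.QuotRing"
begin

section \<open>Number fields\<close>

abbreviation rat_scale :: "rat \<Rightarrow> 'a::field_char_0 \<Rightarrow> 'a"
  where "rat_scale q x \<equiv> of_rat q * x"

text \<open>A number field is a type of characteristic zero of finite dimension over the rationals.\<close>

definition number_field :: "'a::field_char_0 itself \<Rightarrow> bool"
  where "number_field _ \<longleftrightarrow>
    (\<exists>B::'a set. finite B \<and> module.span rat_scale B = UNIV)"

definition number_field_degree :: "'a::field_char_0 itself \<Rightarrow> nat"
  where "number_field_degree _ = vector_space.dim rat_scale (UNIV :: 'a set)"


section \<open>Places\<close>

definition absolute_value :: "('a::field \<Rightarrow> real) \<Rightarrow> bool"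
  where "absolute_value v \<longleftrightarrow>
    (\<forall>x. 0 \<le> v x) \<and> (\<forall>x. v x = 0 \<longleftrightarrow> x = 0) \<and>
    (\<forall>x y. v (x * y) = v x * v y) \<and> (\<forall>x y. v (x + y) \<le> v x + v y)"

definition archimedean_place :: "('a::field_char_0 \<Rightarrow> real) \<Rightarrow> bool"
  where "archimedean_place v \<longleftrightarrow> absolute_value v \<and> (\<forall>q::rat. v (of_rat q) = \<bar>of_rat q\<bar>)"

definition nonarchimedean_place_over :: "nat \<Rightarrow> ('a::field_char_0 \<Rightarrow> real) \<Rightarrow> bool"
  where "nonarchimedean_place_over p v \<longleftrightarrow>
    absolute_value v \<and> (\<forall>x y. v (x + y) \<le> max (v x) (v y)) \<and> v (of_nat p) = 1 / real p"

text \<open>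
  A place, i.e. an equivalence class of nontrivial absolute values, is represented by its unique
  member normalised so as to extend the usual absolute value of the rationals, or to take the
  value \<open>1/p\<close> at the prime \<open>p\<close> below.  So \<open>v x\<close> is \<open>|x|\<^sub>v\<close>.
\<close>

definition places :: "('a::field_char_0 \<Rightarrow> real) set"
  where "places =
    {v. archimedean_place v \<or> (\<exists>p. Factorial_Ring.prime p \<and> nonarchimedean_place_over p v)}"

text \<open>
  The completion \<open>L\<^sub>v\<close> is the ring of \<open>v\<close>-Cauchy sequences modulo the ideal of null sequences;
  \<open>\<rat>\<^sub>v\<close> is the subfield of classes of Cauchy sequences of rational numbers.
\<close>

definition cauchy_ring :: "('a::field_char_0 \<Rightarrow> real) \<Rightarrow> (nat \<Rightarrow> 'a) ring"
  where "cauchy_ring v =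
    \<lparr>carrier = {s. Metric_space.MCauchy UNIV (\<lambda>x y. v (x - y)) s},
     mult = (\<lambda>s t n. s n * t n), one = (\<lambda>_. 1), zero = (\<lambda>_. 0), add = (\<lambda>s t n. s n + t n)\<rparr>"

definition null_sequences :: "('a::field_char_0 \<Rightarrow> real) \<Rightarrow> (nat \<Rightarrow> 'a) set"
  where "null_sequences v = {s. (\<lambda>n. v (s n)) \<longlonglongrightarrow> 0}"

definition completion :: "('a::field_char_0 \<Rightarrow> real) \<Rightarrow> (nat \<Rightarrow> 'a) set ring"
  where "completion v = cauchy_ring v Quot null_sequences v"

definition rat_completion :: "('a::field_char_0 \<Rightarrow> real) \<Rightarrow> (nat \<Rightarrow> 'a) set set"
  where "rat_completion v =
    {null_sequences v +>\<^bsub>cauchy_ring v\<^esub> s | s. s \<in> carrier (cauchy_ring v) \<and> range s \<subseteq> \<rat>}"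

definition local_degree :: "('a::field_char_0 \<Rightarrow> real) \<Rightarrow> nat"
  where "local_degree v = ring.dim (completion v) (rat_completion v) (carrier (completion v))"


section \<open>Heights\<close>

text \<open>In both sums, only finitely many terms are nonzero.\<close>

definition height :: "'a::field_char_0 \<Rightarrow> real"
  where "height a =
    (\<Sum>\<^sub>\<infinity>v\<in>places. real (local_degree v) / real (number_field_degree TYPE('a)) * ln (max 1 (v a)))"

text \<open>
  By the product formula, the height of a fraction does not depend on the coprime representation
  chosen by \<open>quot_repr\<close>; neither do its degree, poles and values.
\<close>

definition quot_repr :: "'a::field_char_0 poly fract \<Rightarrow> 'a poly \<times> 'a poly"
  where "quot_repr F =
    (SOME PQ. snd PQ \<noteq> 0 \<and> coprime (fst PQ) (snd PQ) \<and> F = Fract (fst PQ) (snd PQ))"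

definition ratfun_num :: "'a::field_char_0 poly fract \<Rightarrow> 'a poly"
  where "ratfun_num F = fst (quot_repr F)"

definition ratfun_den :: "'a::field_char_0 poly fract \<Rightarrow> 'a poly"
  where "ratfun_den F = snd (quot_repr F)"

definition ratfun_degree :: "'a::field_char_0 poly fract \<Rightarrow> nat"
  where "ratfun_degree F = max (degree (ratfun_num F)) (degree (ratfun_den F))"

definition ratfun_pole :: "'a::field_char_0 poly fract \<Rightarrow> 'a \<Rightarrow> bool"
  where "ratfun_pole F x \<longleftrightarrow> poly (ratfun_den F) x = 0"

definition ratfun_eval :: "'a::field_char_0 poly fract \<Rightarrow> 'a \<Rightarrow> 'a"
  where "ratfun_eval F x = poly (ratfun_num F) x / poly (ratfun_den F) x"

definition ratfun_height :: "'a::field_char_0 poly fract \<Rightarrow> real"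
  where "ratfun_height F =
    (\<Sum>\<^sub>\<infinity>v\<in>places. real (local_degree v) / real (number_field_degree TYPE('a)) *
      ln (Max (v ` (set (coeffs (ratfun_num F)) \<union> set (coeffs (ratfun_den F))))))"

end

theory Submission
  imports
    Defs
    "HOL-Algebra.Algebraic_Closure_Type"
    "Jordan_Normal_Form.Determinant"
begin

text \<open>
  Write \<open>F = P/Q\<close> and \<open>n\<^sub>v = d\<^sub>v/d\<^sub>L\<close>. By the product formula
  \<open>h(F(x)) = \<Sum>\<^sub>v n\<^sub>v log max(|P(x)|\<^sub>v, |Q(x)|\<^sub>v)\<close>, so that \<open>h(F) - h(F(x))\<close> is a sum of local
  losses, which are averaged over the points \<open>x\<close> of \<open>S\<close> in an interval of length \<open>N = O(\<eta> d\<^sup>3 H)\<close> where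
  \<open>S\<close> is still dense. At each place, \<open>d\<close> of these points may suffer the largest loss. At the others, the
  losses add up to at most \<open>d log(1/|N!|\<^sub>v)\<close> at a finite place, and each of them is at most
  \<open>d log(2M) + log(d + 1)\<close> at an archimedean one, by Lagrange interpolation. The largest losses are
  controlled by the resultant of \<open>P\<close> and \<open>Q\<close>: together they cost \<open>2d h(F) + O(d log d + d log M)\<close>.
  Since \<open>|S| \<ge> d\<^sup>3 H\<close> on the interval, this determines \<open>h(F)\<close> up to \<open>O(\<eta> d log N)\<close>. The constant
  obtained does not depend on \<open>L\<close>.

  The product formula is derived from \<open>\<Sum>\<^sub>v d\<^sub>v log |a|\<^sub>v = log |N(a)|\<^sub>p\<close>, where \<open>v\<close> runs over the places
  above \<open>p \<le> \<infinity>\<close>. The embeddings of \<open>L\<close> into an algebraically closed field with an absolute value above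
  \<open>p\<close> induce places. The number of those inducing \<open>v\<close> is at most \<open>d\<^sub>v\<close>, and weak approximation bounds the
  sum of the \<open>d\<^sub>v\<close> by \<open>d\<^sub>L\<close>, so there is equality everywhere.
\<close>

hide_const (open) Polynomials.degree Polynomials.lead_coeff Divisibility.prime Module.smult
  UnivPoly.monom UnivPoly.coeff

section \<open>Absolute values\<close>

text \<open>The delicate point is a circularity. At the \<open>d\<close> worst points of a place
  only the resultant limits the loss, and that limit involves h(F) itself. What saves the argument
  is that there are \<open>d\<close> such points per place and not a proportion of all points:
  together they cost 2 d^2 h(F), to be divided by at least d^3 H points, so the factor is at most
  2/(d H) <= 1/2 and can be absorbed. This dictates an interval of length of order \<eta> d^3 H;
  since the finite places contribute through N!, a much longer interval would spoil the logarithm.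
  The resultant is a single nonzero element of L, hence its own absolute values cancel in the sum
  over all places and need no estimate.

  On the arithmetic side, the local degree is a dimension over a completed subfield, while the
  product formula counts embeddings. To connect the two, independence over a completion is expressed
  by an inequality between absolute values on L, and a p-adic absolute value on an algebraic closure
  is produced by Chevalley's theorem on maximal subrings, so that absolute values never have to be
  extended from a completion.\<close>

locale abs_val =
  fixes v :: "'a::field_char_0 \<Rightarrow> real"
  assumes absolute_value: "absolute_value v"
begin

lemma nonneg [simp]: "0 \<le> v x"
  and eq_0_iff [simp]: "v x = 0 \<longleftrightarrow> x = 0"
  and mult: "v (x * y) = v x * v y"
  and triangle: "v (x + y) \<le> v x + v y"
  using absolute_value unfolding absolute_value_def by auto

lemma zero [simp]: "v 0 = 0"
  by simp

lemma pos_iff [simp]: "0 < v x \<longleftrightarrow> x \<noteq> 0"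
  using nonneg[of x] eq_0_iff[of x] by linarith

lemma one [simp]: "v 1 = 1"
  using mult[of 1 1] eq_0_iff[of 1] by simp

lemma minus [simp]: "v (- x) = v x"
proof -
  have "v (-1) * v (-1) = 1" using mult[of "-1" "-1"] by simp
  hence "v (-1) = 1" using nonneg[of "-1"]
    by (metis abs_of_nonneg real_sqrt_abs2 real_sqrt_one)
  thus ?thesis using mult[of "-1" x] by simp
qed

lemma minus_commute: "v (x - y) = v (y - x)"
  using minus[of "x - y"] by simp

lemma triangle_minus: "v (x - y) \<le> v x + v y"
  using triangle[of x "-y"] by simp

lemma triangle_diff: "v x - v y \<le> v (x - y)"
  using triangle[of "x - y" y] by simp

lemma power: "v (x ^ k) = v x ^ k"
  by (induction k) (auto simp: mult)

lemma inverse: "v (inverse x) = inverse (v x)"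
proof (cases "x = 0")
  case False
  hence "v x * v (inverse x) = 1" using mult[of x "inverse x"] by simp
  thus ?thesis by (metis inverse_unique)
qed simp

lemma divide: "v (x / y) = v x / v y"
  by (simp add: divide_inverse mult inverse)

lemma sum_le: "v (sum f I) \<le> (\<Sum>i\<in>I. v (f i))"
  by (induction I rule: infinite_finite_induct) (auto intro: order_trans[OF triangle])

lemma prod: "v (prod f I) = (\<Prod>i\<in>I. v (f i))"
  by (induction I rule: infinite_finite_induct) (auto simp: mult)

lemma ball_product:
  assumes "v (x - a) \<le> e" "v (y - b) \<le> e" "v a \<le> C" "v y \<le> C"
  shows "v (x * y - a * b) \<le> 2 * C * e"
proof -
  have "x * y - a * b = (x - a) * y + a * (y - b)" by (simp add: algebra_simps)
  hence "v (x * y - a * b) \<le> v (x - a) * v y + v a * v (y - b)"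
    using triangle[of "(x - a) * y" "a * (y - b)"] by (simp add: mult)
  also have "v (x - a) * v y \<le> e * C" by (rule mult_mono) (use assms order_trans[OF nonneg] in auto)
  also have "v a * v (y - b) \<le> C * e" by (rule mult_mono) (use assms order_trans[OF nonneg] in auto)
  finally show ?thesis by (simp add: algebra_simps)
qed

end

section \<open>Finite-dimensional fields over the rationals\<close>

interpretation rat_vs: vector_space "rat_scale :: rat \<Rightarrow> 'a \<Rightarrow> 'a::field_char_0"
  by unfold_locales (auto simp: algebra_simps of_rat_add of_rat_mult)

text \<open>Indexed families rather than sets: a repeated value makes the family dependent, so
  \<open>card I\<close> itself is bounded by the degree.\<close>

definition rat_independent :: "'i set \<Rightarrow> ('i \<Rightarrow> 'a::field_char_0) \<Rightarrow> bool"
  where "rat_independent I y \<longleftrightarrow>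
    (\<forall>q. (\<Sum>i\<in>I. of_rat (q i) * y i) = 0 \<longrightarrow> (\<forall>i\<in>I. q i = 0))"

lemma rat_independent_iff:
  assumes "finite I"
  shows "rat_independent I (y :: 'i \<Rightarrow> 'a::field_char_0) \<longleftrightarrow>
    inj_on y I \<and> \<not> rat_vs.dependent (y ` I)"
proof (intro iffI conjI)
  assume *: "rat_independent I y"
  show inj: "inj_on y I"
  proof (rule inj_onI, rule ccontr)
    fix i j assume ij: "i \<in> I" "j \<in> I" "y i = y j" "i \<noteq> j"
    define q where "q = (\<lambda>k. if k = i then 1 else if k = j then - 1 else (0::rat))"
    have "(\<Sum>k\<in>I. of_rat (q k) * y k) = (\<Sum>k\<in>{i, j}. of_rat (q k) * y k)"
      using ij assms by (intro sum.mono_neutral_right) (auto simp: q_def)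
    also have "\<dots> = 0" using ij by (auto simp: q_def)
    finally have "q i = 0" using * ij unfolding rat_independent_def by blast
    thus False by (simp add: q_def)
  qed
  show "\<not> rat_vs.dependent (y ` I)"
    unfolding rat_vs.dependent_finite[OF finite_imageI[OF assms]]
  proof
    assume "\<exists>u. (\<exists>x\<in>y ` I. u x \<noteq> 0) \<and> (\<Sum>x\<in>y ` I. rat_scale (u x) x) = 0"
    then obtain u where u: "\<exists>x\<in>y ` I. u x \<noteq> 0" "(\<Sum>x\<in>y ` I. rat_scale (u x) x) = 0" by blast
    have "(\<Sum>i\<in>I. of_rat (u (y i)) * y i) = 0"
      using u(2) by (simp add: sum.reindex[OF inj])
    hence "\<forall>i\<in>I. u (y i) = 0"
      using *[unfolded rat_independent_def, rule_format, of "\<lambda>i. u (y i)"] by blast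
    thus False using u(1) by auto
  qed
next
  assume *: "inj_on y I \<and> \<not> rat_vs.dependent (y ` I)"
  show "rat_independent I y" unfolding rat_independent_def
  proof (intro allI impI ballI, rule ccontr)
    fix q i assume q: "(\<Sum>i\<in>I. of_rat (q i) * y i) = 0" "i \<in> I" "q i \<noteq> 0"
    define u where "u = (\<lambda>x. q (inv_into I y x))"
    have "(\<Sum>x\<in>y ` I. rat_scale (u x) x) = 0"
      using q(1) * by (simp add: sum.reindex u_def)
    moreover have "u (y i) \<noteq> 0" using q * by (simp add: u_def)
    ultimately show False using * q(2)
      unfolding rat_vs.dependent_finite[OF finite_imageI[OF assms]] by blast
  qed
qed

lemma number_field_finite_basis:
  assumes "number_field TYPE('a::field_char_0)"
  obtains B :: "'a::field_char_0 set" where "finite B" "\<not> rat_vs.dependent B" "rat_vs.span B = UNIV"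
    "card B = number_field_degree TYPE('a)"
proof -
  obtain A :: "'a set" where A: "finite A" "rat_vs.span A = UNIV"
    using assms unfolding number_field_def by blast
  obtain B where B: "B \<subseteq> A" "\<not> rat_vs.dependent B" "A \<subseteq> rat_vs.span B"
    using rat_vs.maximal_independent_subset[of A] by blast
  have "rat_vs.span B = UNIV"
    using A(2) B(3) by (metis rat_vs.span_mono rat_vs.span_span top.extremum_uniqueI)
  moreover from this have "card B = number_field_degree TYPE('a)"
    unfolding number_field_degree_def using B(2)
    by (metis rat_vs.dim_span rat_vs.dim_eq_card_independent)
  ultimately show ?thesis using that B A(1) finite_subset by blast
qed

lemma rat_independent_card_le:
  fixes y :: "'i \<Rightarrow> 'a::field_char_0"
  assumes "number_field TYPE('a)" "finite I" "rat_independent I y"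
  shows "card I \<le> number_field_degree TYPE('a)"
proof -
  obtain B :: "'a set" where B: "finite B" "rat_vs.span B = UNIV"
    "card B = number_field_degree TYPE('a)"
    using number_field_finite_basis[OF assms(1)] by metis
  have "inj_on y I" "\<not> rat_vs.dependent (y ` I)" using rat_independent_iff assms by blast+
  moreover have "card (y ` I) \<le> card B"
    using rat_vs.independent_span_bound[OF B(1)] \<open>\<not> rat_vs.dependent (y ` I)\<close> B(2) by auto
  ultimately show ?thesis by (simp add: card_image B(3))
qed

lemma rat_independent_spans:
  fixes y :: "'i \<Rightarrow> 'a::field_char_0"
  assumes "number_field TYPE('a)" "finite I" "rat_independent I y"
    "card I = number_field_degree TYPE('a)"
  obtains q where "x = (\<Sum>i\<in>I. of_rat (q i) * y i)"
proof -
  have I: "inj_on y I" "\<not> rat_vs.dependent (y ` I)" using rat_independent_iff assms by blast+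
  have "x \<in> rat_vs.span (y ` I)"
  proof (rule ccontr)
    assume x: "x \<notin> rat_vs.span (y ` I)"
    hence ind: "\<not> rat_vs.dependent (insert x (y ` I))"
      by (rule rat_vs.independent_insertI[OF _ I(2)])
    have xn: "x \<notin> y ` I" using x rat_vs.span_base[of x "y ` I"] by metis
    have "rat_independent (insert x (y ` I)) (\<lambda>z. z)"
      using ind assms(2) by (subst rat_independent_iff) auto
    from rat_independent_card_le[OF assms(1) _ this] show False
      using xn assms(2,4) card_image[OF I(1)] by simp
  qed
  then obtain u where "x = (\<Sum>a\<in>y ` I. rat_scale (u a) a)"
    unfolding rat_vs.span_finite[OF finite_imageI[OF assms(2)]] by blast
  thus ?thesis using that[of "\<lambda>i. u (y i)"] I(1) by (simp add: sum.reindex)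
qed

section \<open>Independence in a completion\<close>

text \<open>
  Linear independence over the completion of the rationals, phrased without the completion.
\<close>

definition completely_independent :: "('a::field_char_0 \<Rightarrow> real) \<Rightarrow> nat \<Rightarrow> (nat \<Rightarrow> 'a) \<Rightarrow> bool"
  where "completely_independent v m b \<longleftrightarrow> (\<exists>c>0. \<forall>q::nat \<Rightarrow> rat. \<forall>i<m.
    c * v (of_rat (q i)) \<le> v (\<Sum>j<m. of_rat (q j) * b j))"

context abs_val
begin

lemma completely_independent_imp_rat_independent:
  assumes "completely_independent v m b"
  shows "rat_independent {..<m} b"
proof -
  obtain c where c: "c > 0" "\<And>q i. i < m \<Longrightarrow> c * v (of_rat (q i)) \<le> v (\<Sum>j<m. of_rat (q j) * b j)"
    using assms unfolding completely_independent_def by blast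
  show ?thesis unfolding rat_independent_def
  proof (intro allI impI ballI)
    fix q i assume "(\<Sum>j<m. of_rat (q j) * b j) = 0" "i \<in> {..<m}"
    hence "c * v (of_rat (q i)) \<le> 0" using c(2)[of i q] by auto
    hence "v (of_rat (q i)) \<le> 0" using c(1) by (simp add: mult_le_0_iff)
    thus "q i = 0" using nonneg by (metis antisym eq_0_iff of_rat_eq_0_iff)
  qed
qed

text \<open>Appending \<open>x\<close> destroys complete independence, so some combination is tiny
  compared with its largest coefficient. Independence of \<open>b\<close> prevents that coefficient
  from being much larger than the one of \<open>x\<close>; division by the latter yields the
  approximation.\<close>

lemma maximal_completely_independent_dense:
  assumes "completely_independent v m b"
    and max: "\<And>b'. \<not> completely_independent v (Suc m) b'"
    and "e > 0"
  obtains q :: "nat \<Rightarrow> rat" where "v ((\<Sum>j<m. of_rat (q j) * b j) - x) < e"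
proof -
  obtain c where c: "c > 0" "\<And>q i. i < m \<Longrightarrow> c * v (of_rat (q i)) \<le> v (\<Sum>j<m. of_rat (q j) * b j)"
    using assms(1) unfolding completely_independent_def by blast
  \<comment> \<open>\<open>K\<close> will bound the ratio of the largest coefficient to that of
    \<open>x\<close>. In \<open>c'\<close>, the part \<open>c / 2\<close> lets the error be absorbed
    in the proof of that bound, and \<open>e / K\<close> gives the accuracy.\<close>
  define K where "K = max 1 (2 * v x / c)"
  define c' where "c' = min (c / 2) (e / K)"
  have K: "K > 0" unfolding K_def by simp
  have c': "c' > 0" "c' \<le> c / 2" "c' * K \<le> e"
    using K c \<open>e > 0\<close> by (auto simp: c'_def field_simps min_def)
  define b' where "b' = b(m := x)"
  obtain q :: "nat \<Rightarrow> rat" and i where i: "i < Suc m"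
    "v (\<Sum>j<Suc m. of_rat (q j) * b' j) < c' * v (of_rat (q i))"
    using max[of b'] c'(1) unfolding completely_independent_def by (meson not_le)
  define Q where "Q = Max ((\<lambda>i. v (of_rat (q i))) ` {..<Suc m})"
  have Qge: "v (of_rat (q j)) \<le> Q" if "j < Suc m" for j
    unfolding Q_def by (rule Max_ge) (use that in auto)
  define S where "S = (\<Sum>j<m. of_rat (q j) * b j)"
  have S: "(\<Sum>j<Suc m. of_rat (q j) * b' j) = S + of_rat (q m) * x"
    by (simp add: b'_def S_def)
  have lt: "v (S + of_rat (q m) * x) < c' * Q"
    using i Qge[OF i(1)] c'(1) unfolding S by (meson less_le_trans mult_left_mono less_imp_le)
  have Qpos: "Q > 0" using le_less_trans[OF nonneg lt] c'(1) by (simp add: zero_less_mult_iff)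
  have "Q \<in> (\<lambda>i. v (of_rat (q i))) ` {..<Suc m}"
    unfolding Q_def by (rule Max_in) auto
  then obtain k where k: "k < Suc m" "Q = v (of_rat (q k))" by auto
  have QK: "Q \<le> K * v (of_rat (q m))"
  proof (cases "k = m")
    case True
    thus ?thesis using k(2) nonneg[of "of_rat (q m)"] mult_right_mono[of 1 K "v (of_rat (q m))"]
      by (simp add: K_def)
  next
    case False
    hence "c * Q \<le> v S" using c(2)[of k q] k by (simp add: S_def)
    also have "v S \<le> v (S + of_rat (q m) * x) + v (of_rat (q m) * x)"
      using triangle_minus[of "S + of_rat (q m) * x" "of_rat (q m) * x"] by simp
    also have "\<dots> \<le> c' * Q + v (of_rat (q m)) * v x" using lt by (simp add: mult)
    also have "c' * Q \<le> c / 2 * Q" using c' Qpos by (intro mult_right_mono) auto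
    finally have "c * Q \<le> 2 * v x * v (of_rat (q m))" by (simp add: algebra_simps)
    hence "Q \<le> 2 * v x / c * v (of_rat (q m))" using c(1) by (simp add: field_simps)
    also have "\<dots> \<le> K * v (of_rat (q m))" by (intro mult_right_mono) (auto simp: K_def)
    finally show ?thesis .
  qed
  have qm: "v (of_rat (q m)) > 0" using QK Qpos K by (metis mult_zero_right nonneg not_le order_less_le)
  hence qm0: "of_rat (q m) \<noteq> (0::'a)" by simp
  have "v (S + of_rat (q m) * x) < c' * K * v (of_rat (q m))"
    using lt QK c'(1) by (smt (verit, best) mult.assoc mult_left_mono)
  also have "\<dots> \<le> e * v (of_rat (q m))" using c'(3) by (intro mult_right_mono) auto
  finally have "v ((S + of_rat (q m) * x) / (- of_rat (q m))) < e"
    using qm by (simp add: divide divide_less_eq)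
  moreover have "(S + of_rat (q m) * x) / (- of_rat (q m))
      = (\<Sum>j<m. of_rat (- (q j / q m)) * b j) - x"
    using qm0 by (simp add: S_def of_rat_divide of_rat_minus sum_negf sum_divide_distrib
        add_divide_distrib)
  ultimately show ?thesis using that by metis
qed

end

section \<open>The completion as a ring\<close>

context abs_val
begin

definition Cauchy_seq :: "(nat \<Rightarrow> 'a) \<Rightarrow> bool"
  where "Cauchy_seq s \<longleftrightarrow> (\<forall>e>0. \<exists>N. \<forall>m\<ge>N. \<forall>n\<ge>N. v (s m - s n) < e)"

lemma Cauchy_seqD:
  assumes "Cauchy_seq s" "e > 0"
  obtains N where "\<And>m n. m \<ge> N \<Longrightarrow> n \<ge> N \<Longrightarrow> v (s m - s n) < e"
  using assms unfolding Cauchy_seq_def by blast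

lemma carrier_cauchy_ring: "carrier (cauchy_ring v) = {s. Cauchy_seq s}"
proof -
  have "Metric_space UNIV (\<lambda>x y. v (x - y))"
  proof
    fix x y z
    show "v (x - z) \<le> v (x - y) + v (y - z)" using triangle[of "x - y" "y - z"] by simp
  qed (auto simp: minus_commute)
  thus ?thesis unfolding cauchy_ring_def Cauchy_seq_def
    by (auto simp: Metric_space.MCauchy_def)
qed

lemma Cauchy_seq_const: "Cauchy_seq (\<lambda>_. x)"
  unfolding Cauchy_seq_def by auto

lemma Cauchy_seq_add:
  assumes "Cauchy_seq s" "Cauchy_seq t"
  shows "Cauchy_seq (\<lambda>n. s n + t n)"
  unfolding Cauchy_seq_def
proof (intro allI impI)
  fix e :: real assume e: "e > 0"
  obtain N where N: "\<And>m n. m \<ge> N \<Longrightarrow> n \<ge> N \<Longrightarrow> v (s m - s n) < e/2"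
    using Cauchy_seqD[OF assms(1)] e half_gt_zero by metis
  obtain N' where N': "\<And>m n. m \<ge> N' \<Longrightarrow> n \<ge> N' \<Longrightarrow> v (t m - t n) < e/2"
    using Cauchy_seqD[OF assms(2)] e half_gt_zero by metis
  show "\<exists>N. \<forall>m\<ge>N. \<forall>n\<ge>N. v (s m + t m - (s n + t n)) < e"
  proof (intro exI[of _ "max N N'"] allI impI)
    fix m n assume "max N N' \<le> m" "max N N' \<le> n"
    hence "v (s m - s n) < e/2" "v (t m - t n) < e/2" using N N' by auto
    moreover have "v (s m + t m - (s n + t n)) = v ((s m - s n) + (t m - t n))"
      by (rule arg_cong[of _ _ v]) simp
    ultimately show "v (s m + t m - (s n + t n)) < e"
      using triangle[of "s m - s n" "t m - t n"] by linarith
  qed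
qed

lemma Cauchy_seq_minus: "Cauchy_seq s \<Longrightarrow> Cauchy_seq (\<lambda>n. - s n)"
  unfolding Cauchy_seq_def by (simp add: minus_commute)

lemma Cauchy_seq_bounded:
  assumes "Cauchy_seq s"
  obtains C where "C > 0" "\<And>n. v (s n) \<le> C"
proof -
  obtain N where N: "\<And>m n. m \<ge> N \<Longrightarrow> n \<ge> N \<Longrightarrow> v (s m - s n) < 1"
    using Cauchy_seqD[OF assms, of 1] by auto
  define C where "C = (\<Sum>n\<le>N. v (s n)) + 1"
  have *: "v (s n) \<le> (\<Sum>n\<le>N. v (s n))" if "n \<le> N" for n
    by (rule member_le_sum) (use that in auto)
  have "v (s n) \<le> C" for n
  proof (cases "n \<le> N")
    case True
    thus ?thesis using *[OF True] by (simp add: C_def)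
  next
    case False
    hence "v (s n - s N) < 1" using N[of n N] by simp
    thus ?thesis using triangle_diff[of "s n" "s N"] *[of N] by (simp add: C_def)
  qed
  moreover have "C > 0" unfolding C_def by (smt (verit, best) sum_nonneg nonneg)
  ultimately show ?thesis using that by blast
qed

lemma Cauchy_seq_mult:
  assumes "Cauchy_seq s" "Cauchy_seq t"
  shows "Cauchy_seq (\<lambda>n. s n * t n)"
  unfolding Cauchy_seq_def
proof (intro allI impI)
  fix e :: real assume e: "e > 0"
  obtain C1 where C1: "C1 > 0" "\<And>n. v (s n) \<le> C1" using Cauchy_seq_bounded[OF assms(1)] by blast
  obtain C2 where C2: "C2 > 0" "\<And>n. v (t n) \<le> C2" using Cauchy_seq_bounded[OF assms(2)] by blast
  define C where "C = max C1 C2"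
  have C: "C > 0" "\<And>n. v (s n) \<le> C" "\<And>n. v (t n) \<le> C"
    using C1 C2 by (auto simp: C_def le_max_iff_disj)
  define d where "d = e / (4 * C)"
  have d: "d > 0" using e C by (simp add: d_def)
  obtain N where N: "\<And>m n. m \<ge> N \<Longrightarrow> n \<ge> N \<Longrightarrow> v (s m - s n) < d"
    using Cauchy_seqD[OF assms(1) d] by metis
  obtain N' where N': "\<And>m n. m \<ge> N' \<Longrightarrow> n \<ge> N' \<Longrightarrow> v (t m - t n) < d"
    using Cauchy_seqD[OF assms(2) d] by metis
  show "\<exists>N. \<forall>m\<ge>N. \<forall>n\<ge>N. v (s m * t m - s n * t n) < e"
  proof (intro exI[of _ "max N N'"] allI impI)
    fix m n assume "max N N' \<le> m" "max N N' \<le> n"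
    hence "v (s m - s n) < d" "v (t m - t n) < d" using N N' by auto
    hence "v (s m * t m - s n * t n) \<le> 2 * C * d"
      using C by (intro ball_product) auto
    also have "\<dots> < e" using e C by (simp add: d_def field_simps)
    finally show "v (s m * t m - s n * t n) < e" .
  qed
qed

lemma null_imp_Cauchy_seq:
  assumes "s \<in> null_sequences v"
  shows "Cauchy_seq s"
  unfolding Cauchy_seq_def
proof (intro allI impI)
  fix e :: real assume e: "e > 0"
  then obtain N where N: "\<And>n. n \<ge> N \<Longrightarrow> v (s n) < e/2"
    using assms LIMSEQ_D[of "\<lambda>n. v (s n)" 0 "e/2"] unfolding null_sequences_def by auto
  show "\<exists>N. \<forall>m\<ge>N. \<forall>n\<ge>N. v (s m - s n) < e"
  proof (intro exI[of _ N] allI impI)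
    fix m n assume "N \<le> m" "N \<le> n"
    hence "v (s m) < e/2" "v (s n) < e/2" using N by auto
    thus "v (s m - s n) < e" using triangle_minus[of "s m" "s n"] by simp
  qed
qed

lemma cauchy_ring_simps [simp]:
  "mult (cauchy_ring v) = (\<lambda>s t n. s n * t n)" "one (cauchy_ring v) = (\<lambda>_. 1)"
  "zero (cauchy_ring v) = (\<lambda>_. 0)" "add (cauchy_ring v) = (\<lambda>s t n. s n + t n)"
  by (auto simp: cauchy_ring_def)

lemma cauchy_ring: "cring (cauchy_ring v)"
proof (intro cringI abelian_groupI comm_monoidI)
  fix s assume "s \<in> carrier (cauchy_ring v)"
  thus "\<exists>t\<in>carrier (cauchy_ring v). t \<oplus>\<^bsub>cauchy_ring v\<^esub> s = \<zero>\<^bsub>cauchy_ring v\<^esub>"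
    by (intro bexI[of _ "\<lambda>n. - s n"]) (auto simp: carrier_cauchy_ring Cauchy_seq_minus)
qed (auto simp: carrier_cauchy_ring Cauchy_seq_add Cauchy_seq_mult Cauchy_seq_const algebra_simps)

lemma cauchy_ring_minus:
  assumes "Cauchy_seq s" "Cauchy_seq t"
  shows "a_minus (cauchy_ring v) s t = (\<lambda>n. s n - t n)"
proof -
  interpret R: cring "cauchy_ring v" by (rule cauchy_ring)
  have "a_inv (cauchy_ring v) t = (\<lambda>n. - t n)"
    by (rule R.minus_equality) (auto simp: carrier_cauchy_ring Cauchy_seq_minus assms)
  thus ?thesis unfolding a_minus_def by simp
qed

lemma null_ideal: "ideal (null_sequences v) (cauchy_ring v)"
proof -
  interpret R: cring "cauchy_ring v" by (rule cauchy_ring)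
  have mult0: "(\<lambda>n. s n * x n) \<in> null_sequences v"
    if s: "s \<in> null_sequences v" and x: "Cauchy_seq x" for s x
  proof -
    obtain C where C: "C > 0" "\<And>n. v (x n) \<le> C" using Cauchy_seq_bounded[OF x] by blast
    have s0: "(\<lambda>n. v (s n)) \<longlonglongrightarrow> 0" using s by (simp add: null_sequences_def)
    have "(\<lambda>n. v (s n * x n)) \<longlonglongrightarrow> 0"
    proof (rule Lim_null_comparison)
      show "\<forall>\<^sub>F n in sequentially. norm (v (s n * x n)) \<le> v (s n) * C"
        using C(2) by (intro always_eventually allI) (simp add: mult mult_left_mono)
      show "(\<lambda>n. v (s n) * C) \<longlonglongrightarrow> 0" using tendsto_mult_right[OF s0, of C] by simp
    qed
    thus ?thesis by (simp add: null_sequences_def)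
  qed
  show ?thesis
  proof (rule idealI)
    show "subgroup (null_sequences v) (add_monoid (cauchy_ring v))"
    proof (rule subgroup.intro, goal_cases)
      case 1
      thus ?case using null_imp_Cauchy_seq by (auto simp: carrier_cauchy_ring)
    next
      case (2 s t)
      hence "(\<lambda>n. v (s n) + v (t n)) \<longlonglongrightarrow> 0 + 0"
        unfolding null_sequences_def by (intro tendsto_add) auto
      hence "(\<lambda>n. v (s n + t n)) \<longlonglongrightarrow> 0"
        using Lim_null_comparison[of "\<lambda>n. v (s n + t n)" "\<lambda>n. v (s n) + v (t n)"]
        by (simp add: triangle)
      thus ?case by (simp add: null_sequences_def)
    next
      case 3
      show ?case by (simp add: null_sequences_def)
    next
      case (4 s)
      have "m_inv (add_monoid (cauchy_ring v)) s = (\<lambda>n. - s n)"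
        using R.minus_equality[of "\<lambda>n. - s n" s] null_imp_Cauchy_seq[OF 4]
        by (simp add: a_inv_def carrier_cauchy_ring Cauchy_seq_minus)
      thus ?case using 4 by (simp add: null_sequences_def)
    qed
  qed (auto simp: carrier_cauchy_ring R.ring_axioms mult0 mult.commute[of _ "_ :: 'a"])
qed

abbreviation cls :: "(nat \<Rightarrow> 'a) \<Rightarrow> (nat \<Rightarrow> 'a) set"
  where "cls s \<equiv> null_sequences v +>\<^bsub>cauchy_ring v\<^esub> s"

lemma completion_cring: "cring (completion v)"
  unfolding completion_def by (rule ideal.quotient_is_cring[OF null_ideal cauchy_ring])

lemma cls_hom: "cls \<in> Ring.ring_hom (cauchy_ring v) (completion v)"
  unfolding completion_def by (rule ideal.rcos_ring_hom[OF null_ideal])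

lemma carrier_completion: "carrier (completion v) = cls ` {s. Cauchy_seq s}"
  unfolding completion_def FactRing_def A_RCOSETS_def' a_r_coset_def' carrier_cauchy_ring[symmetric]
  by (auto simp: carrier_cauchy_ring[symmetric])

lemma cls_mult:
  "Cauchy_seq s \<Longrightarrow> Cauchy_seq t \<Longrightarrow> cls s \<otimes>\<^bsub>completion v\<^esub> cls t = cls (\<lambda>n. s n * t n)"
  using ring_hom_mult[OF cls_hom] by (simp add: carrier_cauchy_ring)

lemma cls_add:
  "Cauchy_seq s \<Longrightarrow> Cauchy_seq t \<Longrightarrow> cls s \<oplus>\<^bsub>completion v\<^esub> cls t = cls (\<lambda>n. s n + t n)"
  using ring_hom_add[OF cls_hom] by (simp add: carrier_cauchy_ring)

lemma cls_one: "\<one>\<^bsub>completion v\<^esub> = cls (\<lambda>_. 1)"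
  using ring_hom_one[OF cls_hom] by simp

lemma cls_eq_iff:
  assumes "Cauchy_seq s" "Cauchy_seq t"
  shows "cls s = cls t \<longleftrightarrow> (\<lambda>n. v (s n - t n)) \<longlonglongrightarrow> 0"
proof -
  interpret R: cring "cauchy_ring v" by (rule cauchy_ring)
  show ?thesis
    using R.quotient_eq_iff_same_a_r_cos[OF null_ideal, of s t] assms
    by (simp add: carrier_cauchy_ring cauchy_ring_minus null_sequences_def)
qed

lemma cls_zero: "\<zero>\<^bsub>completion v\<^esub> = cls (\<lambda>_. 0)"
  using ring_hom_zero[OF cls_hom] cring.axioms(1)[OF cauchy_ring] cring.axioms(1)[OF completion_cring]
  by simp

lemma cls_minus:
  assumes "Cauchy_seq s"
  shows "\<ominus>\<^bsub>completion v\<^esub> cls s = cls (\<lambda>n. - s n)"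
proof -
  interpret C: cring "completion v" by (rule completion_cring)
  show ?thesis
    by (rule C.minus_equality)
      (auto simp: cls_add cls_zero Cauchy_seq_minus assms carrier_completion)
qed

lemma rat_completion_eq: "rat_completion v = {cls s | s. Cauchy_seq s \<and> range s \<subseteq> \<rat>}"
  unfolding rat_completion_def by (simp add: carrier_cauchy_ring)

text \<open>A Cauchy sequence that is not null is eventually bounded away from 0, so its termwise
  inverses form a Cauchy sequence. Finitely many zero terms are harmless:
  \<open>inverse 0 = 0\<close> keeps them rational, and classes ignore initial terms.\<close>

lemma rat_completion_inverse:
  assumes s: "Cauchy_seq s" "range s \<subseteq> \<rat>" and nz: "cls s \<noteq> cls (\<lambda>_. 0)"
  obtains t where "Cauchy_seq t" "range t \<subseteq> \<rat>" "cls (\<lambda>n. t n * s n) = cls (\<lambda>_. 1)"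
proof -
  have "\<not> (\<lambda>n. v (s n)) \<longlonglongrightarrow> 0" using nz cls_eq_iff[OF s(1) Cauchy_seq_const[of 0]] by simp
  then obtain e where e: "e > 0" "\<And>N. \<exists>n\<ge>N. \<not> v (s n) < e"
    unfolding LIMSEQ_def by (auto simp: dist_real_def)
  obtain N where N: "\<And>m n. m \<ge> N \<Longrightarrow> n \<ge> N \<Longrightarrow> v (s m - s n) < e/2"
    using Cauchy_seqD[OF s(1)] e(1) half_gt_zero by metis
  obtain n0 where n0: "n0 \<ge> N" "v (s n0) \<ge> e" using e(2)[of N] by auto
  have big: "v (s n) \<ge> e/2" if "n \<ge> N" for n
    using N[OF n0(1) that] triangle_diff[of "s n0" "s n"] n0(2) by simp
  define t where "t = (\<lambda>n. inverse (s n))"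
  have "Cauchy_seq t" unfolding Cauchy_seq_def
  proof (intro allI impI)
    fix d :: real assume d: "d > 0"
    obtain N' where N': "\<And>m n. m \<ge> N' \<Longrightarrow> n \<ge> N' \<Longrightarrow> v (s m - s n) < d * (e/2) * (e/2)"
      using Cauchy_seqD[OF s(1), of "d * (e/2) * (e/2)"] d e(1) by auto
    show "\<exists>N. \<forall>m\<ge>N. \<forall>n\<ge>N. v (t m - t n) < d"
    proof (intro exI[of _ "max N N'"] allI impI)
      fix m n assume mn: "max N N' \<le> m" "max N N' \<le> n"
      have b: "v (s m) \<ge> e/2" "v (s n) \<ge> e/2" using big mn by auto
      hence nz: "s m \<noteq> 0" "s n \<noteq> 0" using e(1) zero by auto
      have "t m - t n = (s n - s m) / (s m * s n)" using nz by (simp add: t_def field_simps)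
      hence "v (t m - t n) = v (s m - s n) / (v (s m) * v (s n))"
        by (simp add: divide mult minus_commute)
      also have "\<dots> < d"
      proof -
        have "v (s m - s n) < d * (e/2) * (e/2)" using N' mn by auto
        also have "\<dots> \<le> d * v (s m) * v (s n)" using b d e(1) by (intro mult_mono) auto
        finally show ?thesis using nz by (simp add: divide_less_eq mult.assoc)
      qed
      finally show "v (t m - t n) < d" .
    qed
  qed
  moreover have "range t \<subseteq> \<rat>" using s(2) by (auto simp: t_def image_subset_iff)
  moreover have "cls (\<lambda>n. t n * s n) = cls (\<lambda>_. 1)"
  proof (subst cls_eq_iff)
    show "(\<lambda>n. v (t n * s n - 1)) \<longlonglongrightarrow> 0"
    proof (rule tendsto_eventually, rule eventually_sequentiallyI[of N])
      fix n assume "N \<le> n"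
      hence "s n \<noteq> 0" using big[of n] e(1) zero by auto
      thus "v (t n * s n - 1) = 0" by (simp add: t_def)
    qed
  qed (auto intro: Cauchy_seq_mult Cauchy_seq_const s \<open>Cauchy_seq t\<close>)
  ultimately show ?thesis using that by blast
qed

lemma cls_1_neq_0: "cls (\<lambda>_. 1) \<noteq> cls (\<lambda>_. 0)"
  by (simp add: cls_eq_iff Cauchy_seq_const LIMSEQ_const_iff)

lemma rat_completion_subfield: "subfield (rat_completion v) (completion v)"
proof -
  interpret C: cring "completion v" by (rule completion_cring)
  let ?K = "rat_completion v"
  have sub: "?K \<subseteq> carrier (completion v)"
    by (auto simp: rat_completion_eq carrier_completion)
  have subring: "subring ?K (completion v)"
  proof (rule C.subringI[OF sub])
    show "\<one>\<^bsub>completion v\<^esub> \<in> ?K" unfolding rat_completion_eq cls_one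
      by (auto intro!: exI[of _ "\<lambda>_. 1"] Cauchy_seq_const)
  next
    fix h assume "h \<in> ?K"
    then obtain s where s: "h = cls s" "Cauchy_seq s" "range s \<subseteq> \<rat>" by (auto simp: rat_completion_eq)
    thus "\<ominus>\<^bsub>completion v\<^esub> h \<in> ?K" unfolding rat_completion_eq
      by (auto simp: cls_minus image_subset_iff intro!: exI[of _ "\<lambda>n. - s n"] Cauchy_seq_minus)
  next
    fix h k assume "h \<in> ?K" "k \<in> ?K"
    then obtain s t where s: "h = cls s" "Cauchy_seq s" "range s \<subseteq> \<rat>"
      "k = cls t" "Cauchy_seq t" "range t \<subseteq> \<rat>" by (auto simp: rat_completion_eq)
    show "h \<otimes>\<^bsub>completion v\<^esub> k \<in> ?K" unfolding rat_completion_eq using s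
      by (auto simp: cls_mult image_subset_iff intro!: exI[of _ "\<lambda>n. s n * t n"] Cauchy_seq_mult)
    show "h \<oplus>\<^bsub>completion v\<^esub> k \<in> ?K" unfolding rat_completion_eq using s
      by (auto simp: cls_add image_subset_iff intro!: exI[of _ "\<lambda>n. s n + t n"] Cauchy_seq_add)
  qed
  show ?thesis
  proof (rule C.subfieldI[OF C.subcringI'[OF subring]])
    show "Units (completion v\<lparr>carrier := ?K\<rparr>) = ?K - {\<zero>\<^bsub>completion v\<^esub>}"
    proof (intro equalityI subsetI)
      fix x assume x: "x \<in> Units (completion v\<lparr>carrier := ?K\<rparr>)"
      hence xK: "x \<in> ?K" unfolding Units_def by auto
      have "x \<noteq> \<zero>\<^bsub>completion v\<^esub>"
      proof
        assume x0: "x = \<zero>\<^bsub>completion v\<^esub>"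
        obtain y where "y \<in> ?K" "y \<otimes>\<^bsub>completion v\<^esub> x = \<one>\<^bsub>completion v\<^esub>"
          using x unfolding Units_def by auto
        hence "\<zero>\<^bsub>completion v\<^esub> = \<one>\<^bsub>completion v\<^esub>" using sub x0 by auto
        thus False using cls_1_neq_0 cls_one cls_zero by metis
      qed
      thus "x \<in> ?K - {\<zero>\<^bsub>completion v\<^esub>}" using xK by blast
    next
      fix x assume x: "x \<in> ?K - {\<zero>\<^bsub>completion v\<^esub>}"
      then obtain s where s: "x = cls s" "Cauchy_seq s" "range s \<subseteq> \<rat>" by (auto simp: rat_completion_eq)
      obtain t where t: "Cauchy_seq t" "range t \<subseteq> \<rat>" "cls (\<lambda>n. t n * s n) = cls (\<lambda>_. 1)"
        using rat_completion_inverse[OF s(2,3)] x s(1) cls_zero by auto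
      have "cls t \<in> ?K" using t by (auto simp: rat_completion_eq)
      moreover have 1: "cls t \<otimes>\<^bsub>completion v\<^esub> x = \<one>\<^bsub>completion v\<^esub>"
        using t s by (simp add: cls_mult cls_one)
      moreover have "x \<otimes>\<^bsub>completion v\<^esub> cls t = \<one>\<^bsub>completion v\<^esub>"
        using 1 C.m_comm[of x "cls t"] x sub \<open>cls t \<in> ?K\<close> by auto
      ultimately show "x \<in> Units (completion v\<lparr>carrier := ?K\<rparr>)"
        using x unfolding Units_def by auto
    qed
  qed
qed

section \<open>Bases of the completion over the completed rationals\<close>

lemma combine_cls:
  assumes "\<And>i. i \<in> set xs \<Longrightarrow> Cauchy_seq (s i)"
  shows "ring.combine (completion v) (map (\<lambda>i. cls (s i)) xs) (map (\<lambda>i. cls (\<lambda>_. b i)) xs)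
      = cls (\<lambda>t. \<Sum>i\<leftarrow>xs. s i t * b i) \<and> Cauchy_seq (\<lambda>t. \<Sum>i\<leftarrow>xs. s i t * b i)"
  using assms
proof (induction xs)
  case Nil
  interpret C: cring "completion v" by (rule completion_cring)
  show ?case by (simp add: cls_zero Cauchy_seq_const)
next
  case (Cons i xs)
  interpret C: cring "completion v" by (rule completion_cring)
  show ?case using Cons
    by (simp add: cls_mult cls_add Cauchy_seq_const Cauchy_seq_add Cauchy_seq_mult)
qed

text \<open>A relation over the completed rationals says that certain rational combinations of the
  \<open>b i\<close> tend to 0; the uniform constant \<open>c\<close> then forces each coefficient
  sequence to be null.\<close>

lemma completely_independent_imp_independent:
  assumes "completely_independent v m b"
  shows "ring.independent (completion v) (rat_completion v) (map (\<lambda>i. cls (\<lambda>_. b i)) [0..<m])"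
proof -
  interpret C: cring "completion v" by (rule completion_cring)
  let ?Us = "map (\<lambda>i. cls (\<lambda>_. b i)) [0..<m]"
  have sub: "rat_completion v \<subseteq> carrier (completion v)"
    by (auto simp: rat_completion_eq carrier_completion)
  obtain c where c: "c > 0" "\<And>q i. i < m \<Longrightarrow> c * v (of_rat (q i)) \<le> v (\<Sum>j<m. of_rat (q j) * b j)"
    using assms unfolding completely_independent_def by blast
  have Us: "set ?Us \<subseteq> carrier (completion v)"
    by (auto simp: carrier_completion Cauchy_seq_const)
  show ?thesis
  proof (rule C.trivial_combine_imp_independent[OF rat_completion_subfield Us])
    fix Ks assume Ks: "set Ks \<subseteq> rat_completion v" "C.combine Ks ?Us = \<zero>\<^bsub>completion v\<^esub>"
    \<comment> \<open>\<open>combine\<close> accepts coefficient lists of any length; the list is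
      cut or padded with zeros to length \<open>m\<close>.\<close>
    obtain Ks' where Ks': "set (take (length ?Us) Ks) \<subseteq> set Ks'"
        "set Ks' \<subseteq> set (take (length ?Us) Ks) \<union> {\<zero>\<^bsub>completion v\<^esub>}"
        "length Ks' = length ?Us" "\<zero>\<^bsub>completion v\<^esub> = C.combine Ks' ?Us"
      using C.combine_normalize[of Ks ?Us "\<zero>\<^bsub>completion v\<^esub>"] Ks sub Us by (smt (verit) order_trans)
    have "\<zero>\<^bsub>completion v\<^esub> \<in> rat_completion v"
      unfolding cls_zero rat_completion_eq
      by (auto intro!: exI[of _ "\<lambda>_. 0"] Cauchy_seq_const)
    hence Ks'K: "set Ks' \<subseteq> rat_completion v" using Ks'(2) Ks(1) set_take_subset[of _ Ks] by fastforce
    have "\<exists>s. Ks' ! i = cls s \<and> Cauchy_seq s \<and> range s \<subseteq> \<rat>" if "i < m" for i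
    proof -
      have "Ks' ! i \<in> rat_completion v" using Ks'K Ks'(3) that by (auto simp: subset_iff)
      thus ?thesis by (auto simp: rat_completion_eq)
    qed
    then obtain s where s: "\<And>i. i < m \<Longrightarrow> Ks' ! i = cls (s i)" "\<And>i. i < m \<Longrightarrow> Cauchy_seq (s i)"
      "\<And>i. i < m \<Longrightarrow> range (s i) \<subseteq> \<rat>" by metis
    have Ks'_eq: "Ks' = map (\<lambda>i. cls (s i)) [0..<m]"
      by (rule nth_equalityI) (use Ks'(3) s(1) in auto)
    have comb: "C.combine Ks' ?Us = cls (\<lambda>t. \<Sum>i\<leftarrow>[0..<m]. s i t * b i)"
      "Cauchy_seq (\<lambda>t. \<Sum>i\<leftarrow>[0..<m]. s i t * b i)"
      using combine_cls[of "[0..<m]" s b] s(2) unfolding Ks'_eq by auto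
    hence "cls (\<lambda>t. \<Sum>i\<leftarrow>[0..<m]. s i t * b i) = cls (\<lambda>_. 0)"
      using Ks'(4) cls_zero by metis
    hence lim: "(\<lambda>t. v (\<Sum>i<m. s i t * b i)) \<longlonglongrightarrow> 0"
      using comb(2) by (simp add: cls_eq_iff Cauchy_seq_const interv_sum_list_conv_sum_set_nat
          atLeast0LessThan)
    have "cls (s i) = cls (\<lambda>_. 0)" if i: "i < m" for i
    proof -
      have bound: "v (s i t) \<le> v (\<Sum>i<m. s i t * b i) / c" for t
      proof -
        have "\<exists>q. s j t = of_rat q" if "j < m" for j
          using s(3)[OF that] by (auto simp: Rats_def)
        then obtain q where q: "\<And>j. j < m \<Longrightarrow> s j t = of_rat (q j)" by metis
        thus ?thesis using c(2)[OF i, of q] c(1) i by (simp add: field_simps)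
      qed
      have "(\<lambda>t. v (s i t)) \<longlonglongrightarrow> 0"
        using Lim_null_comparison[of "\<lambda>t. v (s i t)" "\<lambda>t. v (\<Sum>i<m. s i t * b i) / c"] bound
          tendsto_divide[OF lim tendsto_const, of c] c(1) by simp
      thus ?thesis using s(2)[OF i] by (simp add: cls_eq_iff Cauchy_seq_const)
    qed
    hence "set Ks' \<subseteq> {\<zero>\<^bsub>completion v\<^esub>}" unfolding Ks'_eq cls_zero by auto
    thus "set (take (length ?Us) Ks) \<subseteq> {\<zero>\<^bsub>completion v\<^esub>}" using Ks'(1) by blast
  qed
qed

text \<open>Approximate the terms of a Cauchy sequence by rational combinations of \<open>b\<close>.
  The lower bound \<open>c\<close>, applied to differences, makes the coefficients Cauchy as well,
  and their classes are the coordinates.\<close>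

lemma maximal_completely_independent_Span:
  assumes ci: "completely_independent v m b"
    and max: "\<And>b'. \<not> completely_independent v (Suc m) b'"
  shows "ring.Span (completion v) (rat_completion v) (map (\<lambda>i. cls (\<lambda>_. b i)) [0..<m])
    = carrier (completion v)"
proof -
  interpret C: cring "completion v" by (rule completion_cring)
  let ?Us = "map (\<lambda>i. cls (\<lambda>_. b i)) [0..<m]"
  have Us: "set ?Us \<subseteq> carrier (completion v)"
    by (auto simp: carrier_completion Cauchy_seq_const)
  obtain c where c: "c > 0" "\<And>q i. i < m \<Longrightarrow> c * v (of_rat (q i)) \<le> v (\<Sum>j<m. of_rat (q j) * b j)"
    using ci unfolding completely_independent_def by blast
  show ?thesis
  proof
    show "C.Span (rat_completion v) ?Us \<subseteq> carrier (completion v)"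
      by (rule C.Span_in_carrier) (use Us rat_completion_subfield in
          \<open>auto simp: rat_completion_eq carrier_completion\<close>)
  next
    show "carrier (completion v) \<subseteq> C.Span (rat_completion v) ?Us"
    proof
      fix z assume "z \<in> carrier (completion v)"
      then obtain s where s: "z = cls s" "Cauchy_seq s" by (auto simp: carrier_completion)
      have "\<exists>q::nat \<Rightarrow> rat. v ((\<Sum>j<m. of_rat (q j) * b j) - s t) < 1 / real (Suc t)" for t
      proof -
        have "0 < 1 / real (Suc t)" by simp
        from maximal_completely_independent_dense[OF ci max this, of "s t"] show ?thesis by metis
      qed
      then obtain q :: "nat \<Rightarrow> nat \<Rightarrow> rat" where
        q: "\<And>t. v ((\<Sum>j<m. of_rat (q t j) * b j) - s t) < 1 / real (Suc t)" by metis
      define y where "y = (\<lambda>t. \<Sum>j<m. of_rat (q t j) * b j)"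
      have lim: "(\<lambda>t. v (y t - s t)) \<longlonglongrightarrow> 0"
        using Lim_null_comparison[of "\<lambda>t. v (y t - s t)" "\<lambda>t. 1 / real (Suc t)"] q
          LIMSEQ_inverse_real_of_nat by (auto simp: y_def less_imp_le inverse_eq_divide)
      have "Cauchy_seq (\<lambda>t. y t - s t)"
        using null_imp_Cauchy_seq lim by (simp add: null_sequences_def)
      hence yC: "Cauchy_seq y" using Cauchy_seq_add[OF _ s(2)] by fastforce
      have qC: "Cauchy_seq (\<lambda>t. of_rat (q t i))" if i: "i < m" for i
        unfolding Cauchy_seq_def
      proof (intro allI impI)
        fix e :: real assume e: "e > 0"
        obtain N where N: "\<And>t u. t \<ge> N \<Longrightarrow> u \<ge> N \<Longrightarrow> v (y t - y u) < c * e"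
          using Cauchy_seqD[OF yC] e c(1) by (metis mult_pos_pos)
        show "\<exists>N. \<forall>t\<ge>N. \<forall>u\<ge>N. v (of_rat (q t i) - of_rat (q u i)) < e"
        proof (intro exI[of _ N] allI impI)
          fix t u assume "N \<le> t" "N \<le> u"
          hence "v (y t - y u) < c * e" using N by blast
          moreover have "c * v (of_rat (q t i - q u i)) \<le> v (y t - y u)"
            using c(2)[OF i, of "\<lambda>j. q t j - q u j"]
            by (simp add: y_def of_rat_diff left_diff_distrib sum_subtractf)
          ultimately have "c * v (of_rat (q t i - q u i)) < c * e" by linarith
          thus "v (of_rat (q t i) - of_rat (q u i)) < e" using c(1) by (simp add: of_rat_diff)
        qed
      qed
      let ?Ks = "map (\<lambda>i. cls (\<lambda>t. of_rat (q t i))) [0..<m]"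
      have comb: "C.combine ?Ks ?Us = cls (\<lambda>t. \<Sum>i\<leftarrow>[0..<m]. of_rat (q t i) * b i)"
        using combine_cls[of "[0..<m]" "\<lambda>i t. of_rat (q t i)" b] qC by auto
      also have "\<dots> = cls y"
        by (simp add: y_def interv_sum_list_conv_sum_set_nat atLeast0LessThan)
      also have "\<dots> = z" unfolding s(1) using lim by (simp add: cls_eq_iff yC s(2))
      finally have "z = C.combine ?Ks ?Us" by simp
      moreover have "set ?Ks \<subseteq> rat_completion v"
        using qC by (auto simp: rat_completion_eq image_subset_iff)
      ultimately show "z \<in> C.Span (rat_completion v) ?Us"
        using C.Span_mem_iff_length_version[OF rat_completion_subfield Us, of z]
        by (metis length_map)
    qed
  qed
qed

text \<open>The only place where \<open>local_degree\<close> is unfolded: from here on it is the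
  largest size of a completely independent family. A largest size exists because complete
  independence implies independence over the rationals.\<close>

theorem
  assumes "number_field TYPE('a)"
  shows completely_independent_local_degree: "\<exists>b. completely_independent v (local_degree v) b"
    and completely_independent_le_local_degree: "completely_independent v m b \<Longrightarrow> m \<le> local_degree v"
proof -
  interpret C: cring "completion v" by (rule completion_cring)
  let ?P = "\<lambda>m. \<exists>b. completely_independent v m b"
  have bound: "\<forall>m. ?P m \<longrightarrow> m \<le> number_field_degree TYPE('a)"
  proof (intro allI impI)
    fix m assume "?P m"
    then obtain b where "completely_independent v m b" by blast
    from rat_independent_card_le[OF assms finite_lessThan completely_independent_imp_rat_independent[OF this]]
    show "m \<le> number_field_degree TYPE('a)" by simp
  qed
  have P0: "?P 0" by (auto simp: completely_independent_def intro!: exI[of _ 1])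
  define M where "M = Greatest ?P"
  have M: "?P M" unfolding M_def using GreatestI_nat[of ?P, OF P0] bound by blast
  have le_M: "m \<le> M" if "?P m" for m unfolding M_def using Greatest_le_nat[of ?P, OF that] bound by blast
  obtain b0 where b: "completely_independent v M b0" using M by blast
  have max: "\<not> completely_independent v (Suc M) b'" for b' using le_M[of "Suc M"] by auto
  have "C.dimension M (rat_completion v) (carrier (completion v))"
    using C.dimension_independent[OF completely_independent_imp_independent[OF b]]
    by (simp add: maximal_completely_independent_Span[OF b max] del: C.Span.simps)
  hence "local_degree v = M"
    using C.dimI[OF rat_completion_subfield] unfolding local_degree_def over_def by blast
  thus "\<exists>b. completely_independent v (local_degree v) b"
    and "completely_independent v m b \<Longrightarrow> m \<le> local_degree v" using b le_M by blast+
qed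

lemma local_degree_pos:
  assumes "number_field TYPE('a)"
  shows "local_degree v \<ge> 1"
proof -
  have "completely_independent v 1 (\<lambda>_. 1)"
    unfolding completely_independent_def by (auto intro!: exI[of _ 1])
  thus ?thesis using completely_independent_le_local_degree[OF assms] by blast
qed

end

section \<open>Weak approximation\<close>

text \<open>Only the values on the rationals are prescribed, so one argument treats the archimedean
  place and all primes.\<close>

definition extending :: "(rat \<Rightarrow> real) \<Rightarrow> ('a::field_char_0 \<Rightarrow> real) set"
  where "extending \<alpha> = {v. absolute_value v \<and> (\<forall>q. v (of_rat q) = \<alpha> q)}"

lemma extendingD:
  assumes "v \<in> extending \<alpha>"
  shows "abs_val v" "v (of_rat q) = \<alpha> q"
  using assms by (auto simp: extending_def abs_val_def)

lemma scale_by_power: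
  fixes c w :: real
  assumes "0 < c" "c < 1" "0 < w"
  obtains j :: int where "c powi j * w < 1" "c \<le> c powi j * w"
proof -
  define j where "j = \<lfloor>ln w / ln (1 / c)\<rfloor> + 1"
  have l: "ln (1 / c) > 0" using assms by simp
  have lc: "ln (1 / c) = - ln c" using assms by (simp add: ln_div)
  have powi: "ln (c powi j * w) = real_of_int j * ln c + ln w"
  proof -
    have "c powi j = c powr (real_of_int j)" using assms(1) by (simp add: powr_real_of_int')
    thus ?thesis using assms by (simp add: ln_mult ln_powr)
  qed
  have "real_of_int j > ln w / ln (1 / c)" "real_of_int j - 1 \<le> ln w / ln (1 / c)"
    unfolding j_def by linarith+
  hence "real_of_int j * ln (1 / c) > ln w" "(real_of_int j - 1) * ln (1 / c) \<le> ln w"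
    using l by (simp_all add: field_simps)
  hence 1: "ln (c powi j * w) < 0" "ln c \<le> ln (c powi j * w)"
    unfolding powi lc by (simp_all add: algebra_simps)
  have pos: "c powi j * w > 0" using assms by simp
  show ?thesis
  proof
    show "c powi j * w < 1" using 1(1) pos by simp
    show "c \<le> c powi j * w" using 1(2) pos assms(1) by simp
  qed
qed

lemma (in abs_val) power_int: "v (x powi j) = v x powi j"
  by (cases j rule: int_cases2) (auto simp: power_int_minus inverse power)

text \<open>From \<open>w x < v x\<close>, a high power of \<open>x\<close> moves the two values far
  apart; since \<open>v\<close> and \<open>w\<close> agree on the rationals, a power of
  \<open>r\<close> shifts both by the same factor until 1 lies between them.\<close>

lemma separate_absolute_values:
  assumes v: "v \<in> extending \<alpha>" and w: "w \<in> extending \<alpha>" and "v \<noteq> w"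
    and r: "0 < \<alpha> r" "\<alpha> r < 1"
  obtains a where "v a > 1" "w a < 1"
proof -
  interpret v: abs_val v using v by (rule extendingD)
  interpret w: abs_val w using w by (rule extendingD)
  obtain x where x: "w x < v x"
  proof -
    obtain y where y: "v y \<noteq> w y" using \<open>v \<noteq> w\<close> by blast
    hence "y \<noteq> 0" by auto
    show ?thesis
    proof (cases "w y < v y")
      case False
      hence "w (inverse y) < v (inverse y)"
        using y \<open>y \<noteq> 0\<close> by (simp add: v.inverse w.inverse)
      thus ?thesis using that by blast
    qed (use that in blast)
  qed
  hence x0: "x \<noteq> 0" using w.nonneg[of x] v.pos_iff[of x] by (metis le_less_trans)
  define c where "c = \<alpha> r"
  have "1 < v x / w x" using x x0 by simp
  \<comment> \<open>The square leaves room: after scaling, the value of \<open>w\<close> is only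
    known to be at least \<open>c\<close>, and a factor \<open>1 / c\<close> must survive.\<close>
  then obtain k where k: "1 / c\<^sup>2 < (v x / w x) ^ k" using real_arch_pow by blast
  have "w x ^ k > 0" using x0 by simp
  then obtain j where j: "c powi j * w x ^ k < 1" "c \<le> c powi j * w x ^ k"
    using scale_by_power[of c "w x ^ k"] r unfolding c_def by metis
  define a where "a = of_rat r powi j * x ^ k"
  have va: "v a = c powi j * v x ^ k" and wa: "w a = c powi j * w x ^ k"
    using extendingD(2)[OF v] extendingD(2)[OF w]
    by (simp_all add: a_def v.mult w.mult v.power w.power v.power_int w.power_int c_def)
  have "1 < 1 / c" using r by (simp add: c_def)
  also have "1 / c = (1 / c\<^sup>2) * c" using r by (simp add: c_def power2_eq_square)
  also have "\<dots> \<le> (v x / w x) ^ k * (c powi j * w x ^ k)"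
    using k j r by (intro mult_mono) (auto simp: c_def)
  also have "\<dots> = v a" using x0 by (simp add: va power_divide)
  finally show ?thesis using that wa j(1) by metis
qed

text \<open>The elements \<open>a ^ N / (1 + a ^ N)\<close> tend to 1 where \<open>a\<close> is
  large and, by the next lemma, to 0 where it is small: approximate idempotents.\<close>

lemma (in abs_val) power_ratio_limit_1:
  assumes "v a > 1"
  shows "(\<lambda>N. v (a ^ N / (1 + a ^ N) - 1)) \<longlonglongrightarrow> 0"
proof (rule Lim_null_comparison)
  show "\<forall>\<^sub>F N in sequentially. norm (v (a ^ N / (1 + a ^ N) - 1)) \<le> 1 / (v a ^ N - 1)"
  proof (rule eventually_sequentiallyI[of 1])
    fix N :: nat assume "1 \<le> N"
    hence "1 < v a ^ N" using assms by (simp add: one_less_power)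
    moreover have "v a ^ N - 1 \<le> v (1 + a ^ N)"
      using triangle_diff[of "a ^ N" "-1"] by (simp add: power add.commute)
    moreover from calculation have "1 + a ^ N \<noteq> 0" by (metis diff_gt_0_iff_gt not_le zero)
    hence "a ^ N / (1 + a ^ N) - 1 = - (1 / (1 + a ^ N))" by (simp add: field_simps)
    hence "v (a ^ N / (1 + a ^ N) - 1) = 1 / v (1 + a ^ N)" by (simp add: divide)
    ultimately show "norm (v (a ^ N / (1 + a ^ N) - 1)) \<le> 1 / (v a ^ N - 1)"
      by (simp add: frac_le)
  qed
  have inv: "(\<lambda>N. inverse (v a ^ N)) \<longlonglongrightarrow> 0" using assms by (rule LIMSEQ_inverse_realpow_zero)
  have "(\<lambda>N. inverse (v a ^ N) / (1 - inverse (v a ^ N))) \<longlonglongrightarrow> 0"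
    using tendsto_divide[OF inv tendsto_diff[OF tendsto_const inv], of 1] by simp
  moreover have "inverse (v a ^ N) / (1 - inverse (v a ^ N)) = 1 / (v a ^ N - 1)" for N
    using assms by (cases "v a ^ N = 1") (auto simp: field_simps)
  ultimately show "(\<lambda>N. 1 / (v a ^ N - 1)) \<longlonglongrightarrow> 0" by simp
qed

lemma (in abs_val) power_ratio_limit_0:
  assumes "v a < 1"
  shows "(\<lambda>N. v (a ^ N / (1 + a ^ N))) \<longlonglongrightarrow> 0"
proof (rule Lim_null_comparison)
  have lim: "(\<lambda>N. v a ^ N) \<longlonglongrightarrow> 0" using assms by (intro LIMSEQ_realpow_zero) auto
  show "\<forall>\<^sub>F N in sequentially. norm (v (a ^ N / (1 + a ^ N))) \<le> v a ^ N / (1 - v a ^ N)"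
  proof (rule eventually_sequentiallyI[of 1])
    fix N :: nat assume "1 \<le> N"
    hence "v a ^ N < 1" using assms by (simp add: power_less_one_iff)
    moreover have "1 - v a ^ N \<le> v (1 + a ^ N)"
      using triangle_diff[of 1 "- (a ^ N)"] by (simp add: power)
    ultimately show "norm (v (a ^ N / (1 + a ^ N))) \<le> v a ^ N / (1 - v a ^ N)"
      by (simp add: divide power frac_le)
  qed
  show "(\<lambda>N. v a ^ N / (1 - v a ^ N)) \<longlonglongrightarrow> 0"
    using tendsto_divide[OF lim tendsto_diff[OF tendsto_const lim], of 1] by simp
qed

text \<open>Here \<open>a\<close> works for \<open>W\<close>, and \<open>b\<close> separates
  \<open>v\<close> from the new \<open>w\<close>. If \<open>a\<close> is at most 1 at
  \<open>w\<close>, a high power of \<open>a\<close> times \<open>b\<close> works. Otherwise the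
  power is replaced by the approximate idempotent of \<open>a\<close>, which tends to 1 at both
  \<open>v\<close> and \<open>w\<close> and leaves the decision to \<open>b\<close>.\<close>

lemma exists_dominating_element:
  assumes "finite W" "W \<subseteq> extending \<alpha>" "v \<in> extending \<alpha>" "v \<notin> W"
    and r: "0 < \<alpha> r" "\<alpha> r < 1"
  shows "\<exists>a. v a > 1 \<and> (\<forall>w\<in>W. w a < 1)"
  using assms(1,2,4)
proof (induction W)
  case empty
  interpret v: abs_val v using assms(3) by (rule extendingD)
  have "v (of_rat (inverse r)) > 1"
    using r extendingD(2)[OF assms(3), of r] by (simp add: of_rat_inverse v.inverse one_less_inverse)
  thus ?case by auto
next
  case (insert w W)
  interpret v: abs_val v using assms(3) by (rule extendingD)
  interpret w: abs_val w using insert.prems by (auto intro: extendingD)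
  obtain a where a: "v a > 1" "\<And>w. w \<in> W \<Longrightarrow> w a < 1" using insert by auto
  obtain b where b: "v b > 1" "w b < 1"
    using separate_absolute_values[OF assms(3) _ _ r, of w] insert.prems by auto
  show ?case
  proof (cases "w a \<le> 1")
    case True
    have "\<forall>w\<in>W. \<forall>\<^sub>F N in sequentially. w (a ^ N * b) < 1"
    proof
      fix w' assume w': "w' \<in> W"
      then interpret w': abs_val w' using insert.prems by (auto intro: extendingD)
      have "(\<lambda>N. w' a ^ N * w' b) \<longlonglongrightarrow> 0 * w' b"
        using a(2)[OF w'] by (intro tendsto_intros LIMSEQ_realpow_zero) auto
      thus "\<forall>\<^sub>F N in sequentially. w' (a ^ N * b) < 1"
        unfolding w'.mult w'.power by (intro order_tendstoD) auto
    qed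
    hence "\<forall>\<^sub>F N in sequentially. \<forall>w\<in>W. w (a ^ N * b) < 1"
      by (rule eventually_ball_finite[OF insert.hyps(1)])
    then obtain N where N: "\<forall>w\<in>W. w (a ^ N * b) < 1"
      using eventually_happens'[OF trivial_limit_sequentially] by blast
    have "w (a ^ N * b) \<le> 1 * w b" unfolding w.mult w.power
      using True by (intro mult_right_mono power_le_one) auto
    moreover have "1 * 1 < v a ^ N * v b" using a b
      by (intro mult_le_less_imp_less one_le_power) auto
    ultimately show ?thesis using N b by (intro exI[of _ "a ^ N * b"]) (auto simp: v.mult v.power)
  next
    case False
    define z where "z = (\<lambda>N. a ^ N / (1 + a ^ N))"
    have lim1: "(\<lambda>N. u (z N * b)) \<longlonglongrightarrow> u b" if "u a > 1" "abs_val u" for u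
    proof -
      interpret u: abs_val u by fact
      have "(\<lambda>N. u (z N)) \<longlonglongrightarrow> 1"
      proof (rule Lim_transform)
        show "(\<lambda>N. u (z N) - 1) \<longlonglongrightarrow> 0"
        proof (rule Lim_null_comparison[OF _ u.power_ratio_limit_1[OF that(1)]])
          have "\<bar>u (z N) - 1\<bar> \<le> u (z N - 1)" for N
            using u.triangle_diff[of "z N" 1] u.triangle_diff[of 1 "z N"] u.minus_commute[of 1 "z N"]
            by auto
          thus "\<forall>\<^sub>F N in sequentially. norm (u (z N) - 1) \<le> u (a ^ N / (1 + a ^ N) - 1)"
            by (auto simp: z_def)
        qed
      qed auto
      thus ?thesis using tendsto_mult_right[of "\<lambda>N. u (z N)" 1 sequentially "u b"] by (simp add: u.mult)
    qed
    have "\<forall>\<^sub>F N in sequentially. v (z N * b) > 1"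
      using order_tendstoD(1)[OF lim1[OF a(1) v.abs_val_axioms]] b by blast
    moreover have "\<forall>\<^sub>F N in sequentially. w (z N * b) < 1"
      using order_tendstoD(2)[OF lim1[OF _ w.abs_val_axioms]] False b by (auto simp: not_le)
    moreover have "\<forall>w\<in>W. \<forall>\<^sub>F N in sequentially. w (z N * b) < 1"
    proof
      fix w' assume w': "w' \<in> W"
      then interpret w': abs_val w' using insert.prems by (auto intro: extendingD)
      have "(\<lambda>N. w' (z N) * w' b) \<longlonglongrightarrow> 0 * w' b" unfolding z_def
        by (intro tendsto_intros w'.power_ratio_limit_0 a(2)[OF w'])
      thus "\<forall>\<^sub>F N in sequentially. w' (z N * b) < 1"
        unfolding w'.mult by (intro order_tendstoD) auto
    qed
    hence "\<forall>\<^sub>F N in sequentially. \<forall>w\<in>W. w (z N * b) < 1"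
      by (rule eventually_ball_finite[OF insert.hyps(1)])
    ultimately have "\<forall>\<^sub>F N in sequentially. v (z N * b) > 1 \<and> w (z N * b) < 1 \<and> (\<forall>w\<in>W. w (z N * b) < 1)"
      by eventually_elim auto
    then obtain N where "v (z N * b) > 1" "w (z N * b) < 1" "\<forall>w\<in>W. w (z N * b) < 1"
      using eventually_happens'[OF trivial_limit_sequentially] by blast
    thus ?thesis by auto
  qed
qed

lemma weak_approximation:
  assumes "finite W" "W \<subseteq> extending \<alpha>" "v \<in> extending \<alpha>" "v \<notin> W"
    and r: "0 < \<alpha> r" "\<alpha> r < 1" and "e > 0"
  obtains u where "v (u - 1) < e" "\<And>w. w \<in> W \<Longrightarrow> w u < e"
proof -
  interpret v: abs_val v using assms(3) by (rule extendingD)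
  obtain a where a: "v a > 1" "\<And>w. w \<in> W \<Longrightarrow> w a < 1"
    using exists_dominating_element[OF assms(1-4) r] by blast
  define z where "z = (\<lambda>N. a ^ N / (1 + a ^ N))"
  have "\<forall>\<^sub>F N in sequentially. v (z N - 1) < e"
    using order_tendstoD(2)[OF v.power_ratio_limit_1[OF a(1)] \<open>e > 0\<close>] by (simp add: z_def)
  moreover have "\<forall>w\<in>W. \<forall>\<^sub>F N in sequentially. w (z N) < e"
  proof
    fix w assume w: "w \<in> W"
    then interpret w: abs_val w using assms(2) by (auto intro: extendingD)
    show "\<forall>\<^sub>F N in sequentially. w (z N) < e"
      using order_tendstoD(2)[OF w.power_ratio_limit_0[OF a(2)[OF w]] \<open>e > 0\<close>] by (simp add: z_def)
  qed
  hence "\<forall>\<^sub>F N in sequentially. \<forall>w\<in>W. w (z N) < e"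
    by (rule eventually_ball_finite[OF assms(1)])
  ultimately have "\<forall>\<^sub>F N in sequentially. v (z N - 1) < e \<and> (\<forall>w\<in>W. w (z N) < e)"
    by eventually_elim auto
  then obtain N where "v (z N - 1) < e" "\<forall>w\<in>W. w (z N) < e"
    using eventually_happens'[OF trivial_limit_sequentially] by blast
  thus ?thesis using that by blast
qed

text \<open>Multiply each completely independent family \<open>b v\<close> by an element close to 1
  at \<open>v\<close> and close to 0 at the other places. The union stays independent over the
  rationals: at a suitable place \<open>w\<close>, a relation is a small perturbation of a
  combination of \<open>b w\<close>.\<close>

lemma sum_local_degree_le:
  assumes nf: "number_field TYPE('a::field_char_0)"
    and V: "finite V" "V \<subseteq> (extending \<alpha> :: ('a \<Rightarrow> real) set)"
    and r: "0 < \<alpha> r" "\<alpha> r < 1"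
  shows "(\<Sum>v\<in>V. local_degree v) \<le> number_field_degree TYPE('a)"
proof (cases "V = {}")
  case False
  note av = extendingD(1)[OF subsetD[OF V(2)]]
  have "\<forall>v\<in>V. \<exists>b. completely_independent v (local_degree v) b"
    using abs_val.completely_independent_local_degree[OF av nf] by blast
  then obtain b where "\<forall>v\<in>V. completely_independent v (local_degree v) (b v)" by metis
  hence "\<forall>v\<in>V. \<exists>c>0. \<forall>q::nat \<Rightarrow> rat. \<forall>i<local_degree v.
      c * v (of_rat (q i)) \<le> v (\<Sum>j<local_degree v. of_rat (q j) * b v j)"
    unfolding completely_independent_def by blast
  then obtain c where c: "\<And>v. v \<in> V \<Longrightarrow> c v > 0" "\<And>v q i. v \<in> V \<Longrightarrow> i < local_degree v \<Longrightarrow>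
      c v * v (of_rat (q i)) \<le> v (\<Sum>j<local_degree v. of_rat (q j) * b v j)"
    by metis
  define I where "I = (SIGMA v:V. {..<local_degree v})"
  have I: "finite I" using V(1) by (auto simp: I_def)
  have cardI: "card I = (\<Sum>v\<in>V. local_degree v)"
    unfolding I_def using V(1) by (simp add: card_SigmaI)
  define C where "C = (\<Sum>(v, i)\<in>I. \<Sum>w\<in>V. w (b v i)) + 1"
  have nn: "w x \<ge> 0" if "w \<in> V" for w x using abs_val.nonneg[OF av[OF that]] .
  have C1: "C \<ge> 1" unfolding C_def using nn by (auto intro!: sum_nonneg)
  have C: "w (b v i) \<le> C" if "w \<in> V" "(v, i) \<in> I" for w v i
  proof -
    have "w (b v i) \<le> (\<Sum>w\<in>V. w (b v i))"
      by (rule member_le_sum) (use that V nn in auto)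
    also have "\<dots> \<le> (\<Sum>(v, i)\<in>I. \<Sum>w\<in>V. w (b v i))"
      using member_le_sum[OF that(2) _ I, of "\<lambda>(v, i). \<Sum>w\<in>V. w (b v i)"] nn
      by (auto intro!: sum_nonneg)
    finally show ?thesis by (simp add: C_def)
  qed
  define c0 where "c0 = Min (c ` V)"
  have c0: "c0 > 0" "\<And>v. v \<in> V \<Longrightarrow> c0 \<le> c v"
    using V(1) False c(1) by (auto simp: c0_def)
  \<comment> \<open>Chosen so that the \<open>card I\<close> error terms, each at most
    \<open>Q * (e * C)\<close>, add up to at most half of \<open>c0 * Q\<close>.\<close>
  define e where "e = c0 / (2 * C * (real (card I) + 1))"
  have e: "e > 0" using c0 C1 by (simp add: e_def)
  have "\<forall>v\<in>V. \<exists>u. v (u - 1) < e \<and> (\<forall>w\<in>V - {v}. w u < e)"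
  proof
    fix v assume v: "v \<in> V"
    obtain u where "v (u - 1) < e" "\<And>w. w \<in> V - {v} \<Longrightarrow> w u < e"
      using weak_approximation[of "V - {v}" \<alpha> v r e] V v r e by blast
    thus "\<exists>u. v (u - 1) < e \<and> (\<forall>w\<in>V - {v}. w u < e)" by blast
  qed
  then obtain u where u: "\<And>v. v \<in> V \<Longrightarrow> v (u v - 1) < e"
    "\<And>v w. v \<in> V \<Longrightarrow> w \<in> V \<Longrightarrow> w \<noteq> v \<Longrightarrow> w (u v) < e" by (metis DiffI singletonD)
  have "rat_independent I (\<lambda>(v, i). u v * b v i)"
    unfolding rat_independent_def
  proof (intro allI impI)
    fix q :: "('a \<Rightarrow> real) \<times> nat \<Rightarrow> rat"
    assume eq: "(\<Sum>x\<in>I. of_rat (q x) * (case x of (v, i) \<Rightarrow> u v * b v i)) = 0"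
    show "\<forall>x\<in>I. q x = 0"
    proof (cases "I = {}")
      case False
      \<comment> \<open>All places of \<open>V\<close> give the coefficient \<open>q x\<close> the
        same size \<open>\<alpha> (q x)\<close>, so a largest coefficient can be chosen first;
        \<open>w\<close> is then the place to whose family it belongs.\<close>
      define Q where "Q = Max ((\<lambda>x. \<alpha> (q x)) ` I)"
      have Qge: "\<alpha> (q x) \<le> Q" if "x \<in> I" for x using that I by (auto simp: Q_def)
      have "Q \<in> (\<lambda>x. \<alpha> (q x)) ` I" unfolding Q_def using False I by (intro Max_in) auto
      then obtain w i where wi: "(w, i) \<in> I" "Q = \<alpha> (q (w, i))" by auto
      hence w: "w \<in> V" "i < local_degree w" by (auto simp: I_def)
      interpret w: abs_val w using av[OF w(1)] .
      have wq: "w (of_rat t) = \<alpha> t" for t using extendingD(2) V(2) w(1) by blast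
      have Q0: "Q \<ge> 0" unfolding wi(2) using wq w.nonneg by metis
      define y where "y = (\<lambda>(v, i). (if v = w then u v - 1 else u v) * b v i)"
      have "(\<Sum>j<local_degree w. of_rat (q (w, j)) * b w j)
          = (\<Sum>x\<in>I. if fst x = w then of_rat (q x) * b w (snd x) else 0)"
      proof -
        have "(\<Sum>x\<in>I. if fst x = w then of_rat (q x) * b w (snd x) else 0)
            = (\<Sum>x\<in>{w} \<times> {..<local_degree w}. of_rat (q x) * b w (snd x))"
          using I w(1) by (intro sum.mono_neutral_cong_right) (auto simp: I_def)
        also have "\<dots> = (\<Sum>j<local_degree w. of_rat (q (w, j)) * b w j)"
          by (rule sum.reindex_bij_witness[of _ "\<lambda>j. (w, j)" snd]) auto
        finally show ?thesis by simp
      qed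
      also have "\<dots> = - (\<Sum>x\<in>I. of_rat (q x) * y x)"
        using eq unfolding eq_neg_iff_add_eq_0 sum.distrib[symmetric]
        by (auto simp: y_def algebra_simps split: prod.splits intro!: trans[OF sum.cong[OF refl] eq])
      finally have "c w * w (of_rat (q (w, i))) \<le> w (\<Sum>x\<in>I. of_rat (q x) * y x)"
        using c(2)[OF w, of "\<lambda>j. q (w, j)"] by simp
      also have "\<dots> \<le> (\<Sum>x\<in>I. w (of_rat (q x) * y x))" by (rule w.sum_le)
      also have "\<dots> \<le> (\<Sum>x\<in>I. Q * (e * C))"
      proof (rule sum_mono)
        fix x assume x: "x \<in> I"
        obtain v k where vk: "x = (v, k)" by force
        hence v: "v \<in> V" using x by (auto simp: I_def)
        have "w (y x) \<le> e * C" unfolding y_def vk prod.case w.mult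
          by (intro mult_mono) (use u v w(1) C[OF w(1)] x vk e in \<open>auto intro: less_imp_le\<close>)
        thus "w (of_rat (q x) * y x) \<le> Q * (e * C)"
          unfolding w.mult wq using Qge[OF x] Q0 by (intro mult_mono) auto
      qed
      also have "\<dots> = Q * (real (card I) * (e * C))" by simp
      also have "\<dots> \<le> Q * (c0 / 2)"
      proof (rule mult_left_mono[OF _ Q0])
        have "real (card I) * (e * C) = c0 / 2 * (real (card I) / (real (card I) + 1))"
          using C1 by (simp add: e_def)
        also have "\<dots> \<le> c0 / 2 * 1" using c0(1) by (intro mult_left_mono) auto
        finally show "real (card I) * (e * C) \<le> c0 / 2" by simp
      qed
      finally have "c w * Q \<le> Q * (c0 / 2)" unfolding wq wi(2)[symmetric] .
      moreover have "c0 * Q \<le> c w * Q" using c0(2)[OF w(1)] Q0 by (intro mult_right_mono)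
      ultimately have "c0 * Q \<le> 0" by (simp add: algebra_simps)
      hence "Q \<le> 0" using c0(1) by (simp add: mult_le_0_iff)
      show ?thesis
      proof
        fix x assume "x \<in> I"
        hence "w (of_rat (q x)) \<le> 0" using Qge \<open>Q \<le> 0\<close> wq by (metis order_trans)
        thus "q x = 0" by (metis antisym w.nonneg w.eq_0_iff of_rat_eq_0_iff)
      qed
    qed simp
  qed
  from rat_independent_card_le[OF nf I this] show ?thesis by (simp add: cardI)
qed simp

section \<open>Primitive elements and embeddings\<close>

definition rpoly :: "rat poly \<Rightarrow> 'a::field_char_0 \<Rightarrow> 'a"
  where "rpoly f x = poly (map_poly of_rat f) x"

lemma rpoly_0 [simp]: "rpoly 0 x = 0"
  and rpoly_pCons: "rpoly (pCons a f) x = of_rat a + x * rpoly f x"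
  by (simp_all add: rpoly_def map_poly_pCons)

lemma rpoly_1 [simp]: "rpoly 1 x = 1"
  by (simp add: one_pCons rpoly_pCons)

lemma rpoly_add: "rpoly (f + g) x = rpoly f x + rpoly g x"
proof (induction f arbitrary: g rule: pCons_induct)
  case (pCons a f)
  show ?case by (cases g) (simp add: rpoly_pCons pCons.IH of_rat_add distrib_left)
qed simp

lemma rpoly_smult: "rpoly (smult a f) x = of_rat a * rpoly f x"
  by (induction f rule: pCons_induct) (simp_all add: rpoly_pCons of_rat_mult algebra_simps)

lemma rpoly_minus: "rpoly (- f) x = - rpoly f x"
  using rpoly_smult[of "-1" f x] by simp

lemma rpoly_diff: "rpoly (f - g) x = rpoly f x - rpoly g x"
  using rpoly_add[of f "-g" x] by (simp add: rpoly_minus)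

lemma rpoly_mult: "rpoly (f * g) x = rpoly f x * rpoly g x"
  by (induction f rule: pCons_induct) (simp_all add: rpoly_pCons rpoly_add rpoly_smult algebra_simps)

lemma rpoly_power: "rpoly (f ^ k) x = rpoly f x ^ k"
  by (induction k) (simp_all add: rpoly_mult)

lemma rpoly_sum: "rpoly (sum f I) x = (\<Sum>i\<in>I. rpoly (f i) x)"
  by (induction I rule: infinite_finite_induct) (simp_all add: rpoly_add)

lemma rpoly_X [simp]: "rpoly [:0, 1:] x = x"
  by (simp add: rpoly_pCons)

lemma rpoly_monom: "rpoly (monom a k) x = of_rat a * x ^ k"
  by (simp add: Polynomial.monom_altdef rpoly_smult rpoly_power)

lemma rpoly_pcompose: "rpoly (pcompose f g) x = rpoly f (rpoly g x)"
  by (induction f rule: pCons_induct)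
    (simp_all add: rpoly_pCons pcompose_pCons rpoly_add rpoly_mult)

lemma rpoly_altdef: "rpoly f x = (\<Sum>i\<le>degree f. of_rat (coeff f i) * x ^ i)"
proof -
  have "rpoly f x = rpoly (\<Sum>i\<le>degree f. monom (coeff f i) i) x"
    by (simp add: poly_as_sum_of_monoms)
  thus ?thesis by (simp add: rpoly_sum rpoly_monom)
qed

lemma rpoly_dvd: "f dvd g \<Longrightarrow> rpoly f x = 0 \<Longrightarrow> rpoly g x = 0"
  by (auto simp: rpoly_mult)

section \<open>Field embeddings\<close>

definition embedding :: "('a::field_char_0 \<Rightarrow> 'b::field_char_0) \<Rightarrow> bool"
  where "embedding \<sigma> \<longleftrightarrow>
    \<sigma> 1 = 1 \<and> (\<forall>x y. \<sigma> (x + y) = \<sigma> x + \<sigma> y) \<and> (\<forall>x y. \<sigma> (x * y) = \<sigma> x * \<sigma> y)"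

context
  fixes \<sigma> :: "'a::field_char_0 \<Rightarrow> 'b::field_char_0"
  assumes \<sigma>: "embedding \<sigma>"
begin

lemma embedding_1: "\<sigma> 1 = 1"
  and embedding_add: "\<sigma> (x + y) = \<sigma> x + \<sigma> y"
  and embedding_mult: "\<sigma> (x * y) = \<sigma> x * \<sigma> y"
  using \<sigma> by (auto simp: embedding_def)

lemma embedding_0: "\<sigma> 0 = 0"
  using embedding_add[of 0 0] by simp

lemma embedding_minus: "\<sigma> (- x) = - \<sigma> x"
  using embedding_add[of x "-x"] embedding_0 by (simp add: eq_neg_iff_add_eq_0 add.commute)

lemma embedding_diff: "\<sigma> (x - y) = \<sigma> x - \<sigma> y"
  using embedding_add[of x "-y"] by (simp add: embedding_minus)

lemma embedding_eq_0_iff: "\<sigma> x = 0 \<longleftrightarrow> x = 0"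
proof
  assume "\<sigma> x = 0"
  thus "x = 0" using embedding_mult[of x "inverse x"] embedding_1 by (cases "x = 0") auto
qed (simp add: embedding_0)

lemma embedding_of_nat: "\<sigma> (of_nat k) = of_nat k"
  by (induction k) (simp_all add: embedding_0 embedding_1 embedding_add)

lemma embedding_of_int: "\<sigma> (of_int k) = of_int k"
  by (cases k rule: int_cases2) (simp_all add: embedding_of_nat embedding_minus)

lemma embedding_of_rat: "\<sigma> (of_rat q) = of_rat q"
proof -
  obtain a b where q: "q = Rat.Fract a b" "b > 0" by (cases q) auto
  have "\<sigma> (of_rat q) * of_int b = \<sigma> (of_rat q * of_int b)" by (simp add: embedding_mult embedding_of_int)
  also have "of_rat q * of_int b = (of_int a :: 'a)" using q by (simp add: of_rat_rat)
  also have "\<sigma> (of_int a) = of_rat q * of_int b" using q by (simp add: of_rat_rat embedding_of_int)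
  finally show ?thesis using q by simp
qed

lemma embedding_power: "\<sigma> (x ^ k) = \<sigma> x ^ k"
  by (induction k) (simp_all add: embedding_1 embedding_mult)

lemma embedding_sum: "\<sigma> (sum f I) = (\<Sum>i\<in>I. \<sigma> (f i))"
  by (induction I rule: infinite_finite_induct) (simp_all add: embedding_0 embedding_add)

lemma map_poly_embedding_mult: "map_poly \<sigma> (p * q) = map_poly \<sigma> p * map_poly \<sigma> q"
  by (rule poly_eqI) (simp add: coeff_map_poly embedding_0 coeff_mult embedding_sum embedding_mult)

lemma poly_map_poly_embedding: "poly (map_poly \<sigma> p) (\<sigma> x) = \<sigma> (poly p x)"
  by (induction p rule: pCons_induct)
    (simp_all add: map_poly_pCons embedding_0 embedding_add embedding_mult)

end

text \<open>Not normalised to be monic: only the ideal of polynomials vanishing at \<open>x\<close>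
  and the degree of its generator are used. The condition \<open>f \<noteq> 0\<close> says that
  \<open>x\<close> is algebraic.\<close>

definition min_poly :: "'a::field_char_0 \<Rightarrow> rat poly \<Rightarrow> bool"
  where "min_poly x f \<longleftrightarrow> f \<noteq> 0 \<and> (\<forall>g. rpoly g x = 0 \<longleftrightarrow> f dvd g)"

lemma min_poly_exists:
  assumes nf: "number_field TYPE('a::field_char_0)"
  obtains f where "min_poly (x :: 'a) f" "degree f \<le> number_field_degree TYPE('a)"
proof -
  let ?n = "number_field_degree TYPE('a)"
  have "\<not> rat_independent {..?n} (\<lambda>i. x ^ i)"
    using rat_independent_card_le[OF nf, of "{..?n}" "\<lambda>i. x ^ i"] by auto
  then obtain q i where q: "(\<Sum>i\<le>?n. of_rat (q i) * x ^ i) = 0" "i \<le> ?n" "q i \<noteq> 0"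
    unfolding rat_independent_def by auto
  define h where "h = (\<Sum>i\<le>?n. monom (q i) i)"
  have "coeff h i = q i" using q(2) by (simp add: h_def coeff_sum)
  hence h: "h \<noteq> 0" "rpoly h x = 0" "degree h \<le> ?n"
    using q by (auto simp: h_def rpoly_sum rpoly_monom intro!: degree_sum_le order_trans[OF degree_monom_le])
  define P where "P = (\<lambda>g::rat poly. g \<noteq> 0 \<and> rpoly g x = 0)"
  have "P h" using h by (simp add: P_def)
  then obtain f where f: "P f" "\<And>g. P g \<Longrightarrow> degree f \<le> degree g"
    using ex_has_least_nat[of P h degree] by blast
  have "min_poly x f" unfolding min_poly_def
  proof (intro conjI allI iffI)
    show "f \<noteq> 0" using f by (simp add: P_def)
    fix g assume "rpoly g x = 0"
    moreover have "rpoly g x = rpoly (g div f * f) x + rpoly (g mod f) x"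
      by (subst rpoly_add[symmetric]) simp
    ultimately have r: "rpoly (g mod f) x = 0" using f(1) by (simp add: rpoly_mult P_def)
    have "g mod f = 0"
    proof (rule ccontr)
      assume nz: "g mod f \<noteq> 0"
      hence "degree f \<le> degree (g mod f)" using f(2) r by (simp add: P_def)
      thus False using degree_mod_less'[of f g] nz f(1) by (simp add: P_def)
    qed
    thus "f dvd g" by auto
  next
    fix g assume "f dvd g"
    thus "rpoly g x = 0" using f(1) by (auto simp: P_def rpoly_mult)
  qed
  moreover have "degree f \<le> ?n" using f(2)[OF \<open>P h\<close>] h(3) by simp
  ultimately show ?thesis using that by blast
qed

lemma min_poly_degree_pos: "min_poly x f \<Longrightarrow> degree f > 0"
proof (rule ccontr)
  assume f: "min_poly x f" "\<not> degree f > 0"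
  then obtain c where "f = [:c:]" "c \<noteq> 0" by (auto elim: degree_eq_zeroE simp: min_poly_def)
  moreover have "rpoly f x = 0" using f by (auto simp: min_poly_def)
  ultimately show False by (simp add: rpoly_pCons)
qed

text \<open>Irreducibility of \<open>f\<close> in the form in which it is applied. The cofactor of
  \<open>gcd f g\<close> in \<open>f\<close> still vanishes at \<open>x\<close>, hence is divisible
  by \<open>f\<close>, and the gcd is a unit.\<close>

lemma min_poly_bezout:
  assumes f: "min_poly x f" and g: "rpoly g x \<noteq> 0"
  obtains u v where "u * f + v * g = 1"
proof -
  define d where "d = gcd f g"
  have "d dvd f" "d dvd g" by (simp_all add: d_def)
  then obtain e where e: "f = d * e" by (auto elim: dvdE)
  have "rpoly d x \<noteq> 0" using \<open>d dvd g\<close> g rpoly_dvd by blast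
  moreover have "rpoly f x = 0" using f by (simp add: min_poly_def)
  ultimately have "rpoly e x = 0" by (simp add: e rpoly_mult)
  hence "f dvd e" using f by (simp add: min_poly_def)
  hence "f dvd f div d" using e f by (auto simp: min_poly_def)
  have "is_unit d"
  proof -
    have "d * e dvd 1 * e" using \<open>f dvd e\<close> e by simp
    moreover have "e \<noteq> 0" using e f by (auto simp: min_poly_def)
    ultimately show ?thesis using dvd_times_right_cancel_iff by blast
  qed
  hence "gcd f g = 1" unfolding d_def using is_unit_gcd_iff by blast
  moreover have "fst (bezout_coefficients f g) * f + snd (bezout_coefficients f g) * g = gcd f g"
    by (rule bezout_coefficients_fst_snd)
  ultimately show ?thesis using that by metis
qed

text \<open>The Bezout identity for \<open>f\<close> and its derivative has rational coefficients,
  so it may be evaluated at a root \<open>z\<close> in any other field.\<close>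

lemma min_poly_separable:
  fixes z :: "'b::field_char_0"
  assumes f: "min_poly x f" and "rpoly f z = 0"
  shows "rpoly (pderiv f) z \<noteq> 0"
proof
  assume z: "rpoly (pderiv f) z = 0"
  have "rpoly (pderiv f) x \<noteq> 0"
  proof
    assume "rpoly (pderiv f) x = 0"
    hence "f dvd pderiv f" using f by (simp add: min_poly_def)
    moreover have "pderiv f \<noteq> 0" using min_poly_degree_pos[OF f] by (simp add: pderiv_eq_0_iff)
    ultimately have "degree f \<le> degree (pderiv f)" by (rule dvd_imp_degree_le)
    thus False using min_poly_degree_pos[OF f] by (simp add: degree_pderiv)
  qed
  then obtain u v where "u * f + v * pderiv f = 1" using min_poly_bezout[OF f] by blast
  hence "rpoly (u * f + v * pderiv f) z = 1" by simp
  thus False using assms(2) z by (simp add: rpoly_add rpoly_mult)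
qed

section \<open>Polynomials over subrings and subfields given as sets\<close>

definition coeffs_in :: "'a::field_char_0 set \<Rightarrow> 'a poly set"
  where "coeffs_in K = {p. \<forall>i. coeff p i \<in> K}"

locale subring_set =
  fixes K :: "'a::field_char_0 set"
  assumes one: "1 \<in> K" and diff: "x \<in> K \<Longrightarrow> y \<in> K \<Longrightarrow> x - y \<in> K"
    and mult: "x \<in> K \<Longrightarrow> y \<in> K \<Longrightarrow> x * y \<in> K"
begin

lemma zero: "0 \<in> K" using diff[OF one one] by simp
lemma minus: "x \<in> K \<Longrightarrow> - x \<in> K" using diff[OF zero] by fastforce
lemma add: "x \<in> K \<Longrightarrow> y \<in> K \<Longrightarrow> x + y \<in> K" using diff[of x "-y"] minus by simp
lemma sum: "(\<And>i. i \<in> I \<Longrightarrow> f i \<in> K) \<Longrightarrow> sum f I \<in> K"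
  by (induction I rule: infinite_finite_induct) (auto simp: zero add)
lemma power: "x \<in> K \<Longrightarrow> x ^ k \<in> K" by (induction k) (auto simp: one mult)

lemma coeffs_in_mult: "p \<in> coeffs_in K \<Longrightarrow> q \<in> coeffs_in K \<Longrightarrow> p * q \<in> coeffs_in K"
  by (auto simp: coeffs_in_def coeff_mult intro!: sum mult)

lemma coeffs_in_diff: "p \<in> coeffs_in K \<Longrightarrow> q \<in> coeffs_in K \<Longrightarrow> p - q \<in> coeffs_in K"
  by (auto simp: coeffs_in_def diff)

lemma coeffs_in_add: "p \<in> coeffs_in K \<Longrightarrow> q \<in> coeffs_in K \<Longrightarrow> p + q \<in> coeffs_in K"
  by (auto simp: coeffs_in_def add)

lemma coeffs_in_monom: "c \<in> K \<Longrightarrow> monom c k \<in> coeffs_in K"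
  by (auto simp: coeffs_in_def zero)

lemma coeffs_in_pCons: "pCons c p \<in> coeffs_in K \<longleftrightarrow> c \<in> K \<and> p \<in> coeffs_in K"
proof
  assume *: "pCons c p \<in> coeffs_in K"
  have "coeff (pCons c p) 0 \<in> K" "coeff (pCons c p) (Suc i) \<in> K" for i
    using * unfolding coeffs_in_def by blast+
  thus "c \<in> K \<and> p \<in> coeffs_in K" by (simp add: coeffs_in_def)
qed (auto simp: coeffs_in_def coeff_pCons split: nat.splits)

lemma coeffs_in_pcompose: "p \<in> coeffs_in K \<Longrightarrow> q \<in> coeffs_in K \<Longrightarrow> pcompose p q \<in> coeffs_in K"
  by (induction p rule: pCons_induct)
    (auto simp: pcompose_pCons coeffs_in_pCons intro!: coeffs_in_add coeffs_in_mult,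
      auto simp: coeffs_in_def zero)

text \<open>Division by a monic polynomial takes no inverses and therefore stays inside the
  subring.\<close>

lemma coeffs_in_divide:
  assumes m: "m \<in> coeffs_in K" "lead_coeff m = 1" and "p \<in> coeffs_in K"
  shows "\<exists>r\<in>coeffs_in K. m dvd p - r \<and> (r = 0 \<or> degree r < degree m)"
  using assms(3)
proof (induction "degree p" arbitrary: p rule: less_induct)
  case less
  let ?d = "degree"
  show ?case
  proof (cases "p = 0 \<or> ?d p < ?d m")
    case True
    thus ?thesis using less.prems by (intro bexI[of _ p]) auto
  next
    case False
    define t where "t = monom (lead_coeff p) (?d p - ?d m) * m"
    have t: "t \<in> coeffs_in K" unfolding t_def
      using less.prems by (intro coeffs_in_mult m coeffs_in_monom) (auto simp: coeffs_in_def)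
    have m0: "m \<noteq> 0" using m(2) by auto
    have dt: "?d t = ?d p"
      using False m0 by (auto simp: t_def degree_mult_eq degree_monom_eq)
    have lt: "lead_coeff t = lead_coeff p"
      unfolding t_def lead_coeff_mult m(2) using False by (simp add: degree_monom_eq)
    have "\<exists>r\<in>coeffs_in K. m dvd (p - t) - r \<and> (r = 0 \<or> ?d r < ?d m)"
    proof (cases "?d p = 0")
      case True
      \<comment> \<open>Subtracting \<open>t\<close> cannot lower the degree of a constant, but here
        \<open>m\<close> is a unit and the remainder is 0.\<close>
      hence "?d m = 0" using False by auto
      then obtain c where "m = [:c:]" by (auto elim: degree_eq_zeroE)
      hence "is_unit m" using m(2) by (simp add: is_unit_pCons_iff)
      hence "m dvd p - t" by (rule unit_imp_dvd)
      thus ?thesis by (intro bexI[of _ 0]) (auto simp: coeffs_in_def zero)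
    next
      case nz: False
      have "?d (p - t) < ?d p"
      proof -
        have "?d (p - t) \<le> ?d p" by (rule degree_diff_le) (simp_all add: dt)
        moreover have "?d (p - t) \<noteq> ?d p"
        proof
          assume eq: "?d (p - t) = ?d p"
          have "lead_coeff (p - t) = 0" unfolding eq using lt dt by simp
          hence "p - t = 0" using leading_coeff_0_iff by blast
          thus False using eq nz by simp
        qed
        ultimately show ?thesis by simp
      qed
      thus ?thesis using less.hyps coeffs_in_diff[OF less.prems t] by blast
    qed
    then obtain r where r: "r \<in> coeffs_in K" "m dvd (p - t) - r" "r = 0 \<or> ?d r < ?d m" by blast
    have "m dvd t" by (simp add: t_def)
    hence "m dvd p - r" using r(2) dvd_add[of m "p - t - r" t] by (simp add: algebra_simps)
    thus ?thesis using r by blast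
  qed
qed

end

locale subfield_set = subring_set +
  assumes inverse: "x \<in> K \<Longrightarrow> inverse x \<in> K"
begin

lemma relative_min_poly:
  assumes p: "p \<in> coeffs_in K" "p \<noteq> 0" "poly p x = 0"
  obtains m where "m \<in> coeffs_in K" "lead_coeff m = 1" "poly m x = 0"
    "\<And>q. q \<in> coeffs_in K \<Longrightarrow> poly q x = 0 \<Longrightarrow> m dvd q"
proof -
  define P where "P = (\<lambda>q. q \<in> coeffs_in K \<and> q \<noteq> 0 \<and> poly q x = 0)"
  obtain m0 where m0: "P m0" "\<And>q. P q \<Longrightarrow> degree m0 \<le> degree q"
    using ex_has_least_nat[of P p degree] p by (auto simp: P_def)
  define m where "m = smult (inverse (lead_coeff m0)) m0"
  have m: "m \<in> coeffs_in K" "lead_coeff m = 1" "poly m x = 0"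
    "degree m = degree m0"
    using m0(1) by (auto simp: m_def P_def coeffs_in_def intro!: mult inverse)
  have "m dvd q" if q: "q \<in> coeffs_in K" "poly q x = 0" for q
  proof -
    obtain r where r: "r \<in> coeffs_in K" "m dvd q - r" "r = 0 \<or> degree r < degree m"
      using coeffs_in_divide[OF m(1,2) q(1)] by blast
    from r(2) obtain k where k: "q - r = m * k" by (elim dvdE)
    have "poly (q - r) x = 0" unfolding k using m(3) by simp
    hence "poly r x = 0" using q(2) by simp
    have "r = 0"
    proof (rule ccontr)
      assume "r \<noteq> 0"
      hence "P r" using r(1) \<open>poly r x = 0\<close> by (simp add: P_def)
      thus False using m0(2)[of r] r(3) m(4) \<open>r \<noteq> 0\<close> by simp
    qed
    thus ?thesis using r(2) by simp
  qed
  thus ?thesis using that m by blast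
qed

end

lemma min_poly_root: "min_poly x f \<Longrightarrow> rpoly f x = 0"
  by (simp add: min_poly_def)

definition adjoin :: "'a::field_char_0 \<Rightarrow> 'a set"
  where "adjoin \<theta> = range (\<lambda>f. rpoly f \<theta>)"

lemma subfield_adjoin:
  assumes nf: "number_field TYPE('a::field_char_0)"
  shows "subfield_set (adjoin (\<theta> :: 'a))"
proof
  show "1 \<in> adjoin \<theta>" unfolding adjoin_def by (rule range_eqI[of _ _ 1]) simp
next
  fix x y assume "x \<in> adjoin \<theta>" "y \<in> adjoin \<theta>"
  then obtain f g where "x = rpoly f \<theta>" "y = rpoly g \<theta>" by (auto simp: adjoin_def)
  thus "x - y \<in> adjoin \<theta>" "x * y \<in> adjoin \<theta>"
    unfolding adjoin_def
    by (auto intro: range_eqI[of _ _ "f - g"] range_eqI[of _ _ "f * g"] simp: rpoly_diff rpoly_mult)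
next
  fix x assume "x \<in> adjoin \<theta>"
  then obtain g where x: "x = rpoly g \<theta>" by (auto simp: adjoin_def)
  show "inverse x \<in> adjoin \<theta>"
  proof (cases "x = 0")
    case True
    thus ?thesis unfolding adjoin_def by (intro range_eqI[of _ _ 0]) simp
  next
    case False
    obtain f where f: "min_poly \<theta> f" using min_poly_exists[OF nf] by blast
    then obtain u v where "u * f + v * g = 1" using min_poly_bezout False x by metis
    hence "rpoly (u * f + v * g) \<theta> = 1" by simp
    hence "rpoly v \<theta> * x = 1" by (simp add: rpoly_add rpoly_mult x min_poly_root[OF f])
    hence "inverse x = rpoly v \<theta>" using inverse_unique[of x "rpoly v \<theta>"] by (simp add: mult.commute)
    thus ?thesis by (simp add: adjoin_def)
  qed
qed

lemma of_rat_in_adjoin: "of_rat q \<in> adjoin \<theta>"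
  unfolding adjoin_def by (rule range_eqI[of _ _ "[:q:]"]) (simp add: rpoly_pCons)

lemma self_in_adjoin: "\<theta> \<in> adjoin \<theta>"
  unfolding adjoin_def by (rule range_eqI[of _ _ "[:0, 1:]"]) simp

lemma adjoin_mono: "\<alpha> \<in> adjoin \<theta> \<Longrightarrow> adjoin \<alpha> \<subseteq> adjoin \<theta>"
  unfolding adjoin_def by (auto simp: rpoly_pcompose[symmetric])

lemma finite_rpoly_roots:
  assumes "f \<noteq> 0"
  shows "finite {z::'a::field_char_0. rpoly f z = 0}"
  unfolding rpoly_def by (rule poly_roots_finite) (use assms in \<open>simp add: map_poly_eq_0_iff\<close>)

lemma embedding_to_ac: "embedding (to_ac :: 'a::field_char_0 \<Rightarrow> 'a alg_closure)"
  by (simp add: embedding_def)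

lemma map_poly_embedding_add:
  assumes "embedding \<sigma>"
  shows "map_poly \<sigma> (p + q) = map_poly \<sigma> p + map_poly \<sigma> q"
  by (rule poly_eqI) (simp add: coeff_map_poly embedding_0[OF assms] embedding_add[OF assms])

lemma poly_map_poly_pcompose:
  assumes \<sigma>: "embedding \<sigma>"
  shows "poly (map_poly \<sigma> (pcompose (map_poly of_rat f) [:a, b:])) z = rpoly f (\<sigma> a + z * \<sigma> b)"
proof (induction f rule: pCons_induct)
  case (pCons c f)
  have *: "map_poly \<sigma> [:x:] = [:\<sigma> x:]" "map_poly \<sigma> [:x, y:] = [:\<sigma> x, \<sigma> y:]" for x y
    by (simp_all add: map_poly_pCons embedding_0[OF \<sigma>])
  have "pcompose (map_poly of_rat (pCons c f)) [:a, b:]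
      = [:of_rat c:] + [:a, b:] * pcompose (map_poly of_rat f) [:a, b:]"
    by (simp add: map_poly_pCons pcompose_pCons)
  thus ?case
    by (simp only: map_poly_embedding_add[OF \<sigma>] map_poly_embedding_mult[OF \<sigma>] * poly_add poly_mult
        pCons.IH rpoly_pCons embedding_of_rat[OF \<sigma>]) simp
qed simp

lemma map_poly_of_rat_embedding:
  assumes "embedding \<sigma>"
  shows "map_poly \<sigma> (map_poly of_rat f) = map_poly of_rat f"
  by (rule poly_eqI) (simp add: coeff_map_poly embedding_0[OF assms] embedding_of_rat[OF assms])

lemma rpoly_pderiv:
  fixes z :: "'a::field_char_0"
  shows "poly (pderiv (map_poly of_rat f)) z = rpoly (pderiv f) z"
proof -
  have "pderiv (map_poly of_rat f) = (map_poly of_rat (pderiv f) :: 'a poly)"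
    by (rule poly_eqI) (simp add: coeff_pderiv coeff_map_poly of_rat_mult of_rat_add)
  thus ?thesis by (simp add: rpoly_def)
qed

text \<open>The classical choice \<open>\<theta> = \<alpha> + c \<beta>\<close>. The minimal
  polynomial \<open>m\<close> of \<open>\<beta>\<close> over the field
  \<open>adjoin \<theta>\<close> divides both \<open>g\<close> and \<open>f(\<theta> - c X)\<close>.
  By the choice of \<open>c\<close> these share only the root \<open>\<beta>\<close>, and
  \<open>g\<close> has simple roots; so \<open>m\<close> is linear and \<open>\<beta>\<close> lies
  in \<open>adjoin \<theta>\<close>.\<close>

lemma adjoin_two:
  assumes nf: "number_field TYPE('a::field_char_0)"
  obtains \<theta> :: "'a::field_char_0" where "\<alpha> \<in> adjoin \<theta>" "\<beta> \<in> adjoin \<theta>"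
proof -
  obtain f where f: "min_poly \<alpha> f" using min_poly_exists[OF nf] by blast
  obtain g where g: "min_poly \<beta> g" using min_poly_exists[OF nf] by blast
  define A where "A = {z::'a alg_closure. rpoly f z = 0}"
  define B where "B = {z::'a alg_closure. rpoly g z = 0}"
  \<comment> \<open>The values of \<open>c\<close> for which another pair of conjugates gives the
    same \<open>\<theta>\<close>. A pair with \<open>b = \<beta>\<close> contributes the default
    quotient 0, which merely excludes one more value.\<close>
  define bad where "bad = (\<lambda>(a, b). (a - to_ac \<alpha>) / (to_ac \<beta> - b)) ` (A \<times> B)"
  have "finite bad" unfolding bad_def A_def B_def
    using f g by (intro finite_imageI finite_cartesian_product finite_rpoly_roots) (auto simp: min_poly_def)
  hence "finite ((of_rat :: rat \<Rightarrow> 'a alg_closure) -` bad)"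
    by (rule finite_vimageI) (auto intro: injI)
  then obtain c :: rat where c: "of_rat c \<notin> bad"
    using ex_new_if_finite[OF infinite_UNIV_char_0] by blast
  define \<theta> where "\<theta> = \<alpha> + of_rat c * \<beta>"
  interpret K: subfield_set "adjoin \<theta>" by (rule subfield_adjoin[OF nf])
  define G where "G = (map_poly of_rat g :: 'a poly)"
  define h where "h = pcompose (map_poly of_rat f) [:\<theta>, - of_rat c:]"
  have rat_coeffs: "map_poly of_rat p \<in> coeffs_in (adjoin \<theta>)" for p
    by (auto simp: coeffs_in_def coeff_map_poly of_rat_in_adjoin)
  have G: "G \<in> coeffs_in (adjoin \<theta>)" "G \<noteq> 0" "poly G \<beta> = 0"
    using g rat_coeffs[of g] by (auto simp: G_def min_poly_def map_poly_eq_0_iff rpoly_def[symmetric])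
  have h: "h \<in> coeffs_in (adjoin \<theta>)" unfolding h_def
    using K.minus[OF of_rat_in_adjoin[of c \<theta>]] self_in_adjoin[of \<theta>]
    by (intro K.coeffs_in_pcompose rat_coeffs) (auto simp: coeffs_in_def coeff_pCons K.zero split: nat.splits)
  have h0: "poly h \<beta> = 0"
    using f by (simp add: h_def poly_pcompose \<theta>_def rpoly_def[symmetric] min_poly_def algebra_simps)
  obtain m where m: "m \<in> coeffs_in (adjoin \<theta>)" "lead_coeff m = 1" "poly m \<beta> = 0"
    "\<And>q. q \<in> coeffs_in (adjoin \<theta>) \<Longrightarrow> poly q \<beta> = 0 \<Longrightarrow> m dvd q"
    using K.relative_min_poly[OF G] by metis
  have "m dvd G" "m dvd h" using m(4) G h h0 by blast+
  then obtain e1 e2 where e: "G = m * e1" "h = m * e2" by (auto elim!: dvdE)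
  let ?\<iota> = "to_ac :: 'a \<Rightarrow> 'a alg_closure"
  note \<iota> = embedding_to_ac[where ?'a = 'a]
  define M where "M = map_poly ?\<iota> m"
  have degM: "degree M = degree m"
    unfolding M_def by (rule degree_map_poly) simp
  have "poly M (?\<iota> \<beta>) = 0" unfolding M_def using m(3) by (simp add: poly_map_poly_embedding[OF \<iota>])
  then obtain M' where M': "M = [:- ?\<iota> \<beta>, 1:] * M'" unfolding poly_eq_0_iff_dvd by (elim dvdE)
  have GM: "map_poly of_rat g = M * map_poly ?\<iota> e1"
    using e(1) map_poly_of_rat_embedding[OF \<iota>, of g] map_poly_embedding_mult[OF \<iota>, of m e1]
    by (simp add: G_def M_def)
  have hM: "map_poly ?\<iota> h = M * map_poly ?\<iota> e2"
    using e(2) map_poly_embedding_mult[OF \<iota>, of m e2] by (simp add: M_def)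
  have m0: "m \<noteq> 0" using m(2) by auto
  hence M0: "M \<noteq> 0" by (simp add: M_def map_poly_eq_0_iff)
  \<comment> \<open>A root of \<open>M'\<close> would be either a second occurrence of
    \<open>\<beta>\<close>, against separability, or another common root, against the choice of
    \<open>c\<close>.\<close>
  have "degree M' = 0"
  proof (rule ccontr)
    assume "degree M' \<noteq> 0"
    then obtain b where b: "poly M' b = 0" using alg_closed_imp_poly_has_root by blast
    hence Mb: "poly M b = 0" by (simp add: M')
    have gb: "rpoly g b = 0" using Mb by (simp add: rpoly_def GM)
    show False
    proof (cases "b = ?\<iota> \<beta>")
      case True
      then obtain M'' where M'': "M' = [:- b, 1:] * M''" using b unfolding poly_eq_0_iff_dvd by (elim dvdE)
      define q where "q = [:- b, 1:]"
      have "map_poly of_rat g = q * (q * (M'' * map_poly ?\<iota> e1))"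
        unfolding GM M' M'' True[symmetric] q_def by (simp only: mult.assoc)
      moreover have "poly q b = 0" by (simp add: q_def)
      ultimately have "poly (pderiv (map_poly of_rat g)) b = 0" by (simp add: pderiv_mult)
      thus False using min_poly_separable[OF g gb] by (simp add: rpoly_pderiv)
    next
      case False
      have "poly (map_poly ?\<iota> h) b = 0" using Mb by (simp add: hM)
      hence "rpoly f (?\<iota> \<theta> - of_rat c * b) = 0"
        unfolding h_def poly_map_poly_pcompose[OF \<iota>]
        by (simp add: embedding_of_rat[OF \<iota>] mult.commute)
      hence "?\<iota> \<theta> - of_rat c * b \<in> A" by (simp add: A_def)
      moreover have "b \<in> B" using gb by (simp add: B_def)
      ultimately have "(?\<iota> \<theta> - of_rat c * b - ?\<iota> \<alpha>) / (?\<iota> \<beta> - b) \<in> bad" unfolding bad_def by force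
      moreover have "(?\<iota> \<theta> - of_rat c * b - ?\<iota> \<alpha>) / (?\<iota> \<beta> - b) = of_rat c"
        using False by (simp add: \<theta>_def embedding_of_rat[OF \<iota>] field_simps)
      ultimately show False using c by simp
    qed
  qed
  moreover have "M' \<noteq> 0" using M0 M' by auto
  hence "degree M = degree [:- ?\<iota> \<beta>, 1:] + degree M'"
    unfolding M' by (intro degree_mult_eq) auto
  ultimately have "degree m = 1" using degM by simp
  hence "m = [:coeff m 0, coeff m 1:]"
    by (intro poly_eqI) (auto simp: coeff_pCons coeff_eq_0 split: nat.splits)
  then obtain a b where ab: "m = [:a, b:]" by blast
  hence "b = 1" "a = - \<beta>" using m(2,3) \<open>degree m = 1\<close> by (auto simp: eq_neg_iff_add_eq_0 split: if_splits)
  hence "- \<beta> \<in> adjoin \<theta>" using m(1) ab K.coeffs_in_pCons by auto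
  hence \<beta>: "\<beta> \<in> adjoin \<theta>" using K.minus by fastforce
  have "\<alpha> = \<theta> - of_rat c * \<beta>" by (simp add: \<theta>_def)
  hence "\<alpha> \<in> adjoin \<theta>" using K.diff K.mult \<beta> of_rat_in_adjoin self_in_adjoin by metis
  thus ?thesis using that \<beta> by blast
qed

theorem primitive_element:
  assumes nf: "number_field TYPE('a::field_char_0)"
  obtains \<theta> :: "'a::field_char_0" where "adjoin \<theta> = UNIV"
proof -
  obtain B :: "'a set" where B: "finite B" "rat_vs.span B = UNIV"
    using nf unfolding number_field_def by blast
  have "\<exists>\<theta>. B \<subseteq> adjoin \<theta>" using B(1)
  proof (induction B)
    case (insert b B)
    then obtain \<theta> where \<theta>: "B \<subseteq> adjoin \<theta>" by blast
    obtain \<theta>' where "\<theta> \<in> adjoin \<theta>'" "b \<in> adjoin \<theta>'" using adjoin_two[OF nf] by blast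
    thus ?case using \<theta> adjoin_mono[of \<theta> \<theta>'] by blast
  qed auto
  then obtain \<theta> where \<theta>: "B \<subseteq> adjoin \<theta>" by blast
  interpret K: subfield_set "adjoin \<theta>" by (rule subfield_adjoin[OF nf])
  have "adjoin \<theta> = UNIV"
  proof (intro equalityI subsetI)
    fix x :: 'a assume "x \<in> UNIV"
    hence "x \<in> rat_vs.span B" using B by simp
    thus "x \<in> adjoin \<theta>" unfolding rat_vs.span_finite[OF B(1)] using \<theta>
      by (auto intro!: K.sum K.mult of_rat_in_adjoin)
  qed auto
  thus ?thesis using that by blast
qed

lemma primitive_element_min_poly_degree:
  fixes \<theta> :: "'a::field_char_0"
  assumes nf: "number_field TYPE('a)" and \<theta>: "adjoin \<theta> = UNIV" and f: "min_poly \<theta> f"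
  shows "degree f = number_field_degree TYPE('a)"
proof (rule antisym)
  obtain f' where f': "min_poly \<theta> f'" "degree f' \<le> number_field_degree TYPE('a)"
    using min_poly_exists[OF nf] by blast
  have "f dvd f'" "f' \<noteq> 0" using f f'(1) min_poly_root[OF f'(1)] by (simp_all add: min_poly_def)
  thus "degree f \<le> number_field_degree TYPE('a)"
    using dvd_imp_degree_le[of f f'] f'(2) by simp
next
  let ?W = "(\<lambda>i. \<theta> ^ i) ` {..<degree f}"
  have f0: "f \<noteq> 0" "rpoly f \<theta> = 0" using f by (auto simp: min_poly_def)
  have "UNIV \<subseteq> rat_vs.span ?W"
  proof
    fix x :: 'a
    obtain g where "x = rpoly g \<theta>" using \<theta> by (auto simp: adjoin_def)
    also have "\<dots> = rpoly (g div f * f) \<theta> + rpoly (g mod f) \<theta>"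
      by (subst rpoly_add[symmetric]) simp
    also have "\<dots> = rpoly (g mod f) \<theta>" using f0 by (simp add: rpoly_mult)
    also have "\<dots> \<in> rat_vs.span ?W"
    proof (cases "g mod f = 0")
      case False
      hence "degree (g mod f) < degree f" using f0 degree_mod_less' by blast
      thus ?thesis unfolding rpoly_altdef
        by (intro rat_vs.span_sum rat_vs.span_scale rat_vs.span_base) auto
    qed (simp add: rat_vs.span_zero)
    finally show "x \<in> rat_vs.span ?W" .
  qed
  hence "number_field_degree TYPE('a) \<le> card ?W"
    unfolding number_field_degree_def by (rule rat_vs.dim_le_card) simp
  also have "\<dots> \<le> degree f" using card_image_le[of "{..<degree f}"] by simp
  finally show "number_field_degree TYPE('a) \<le> degree f" .
qed

lemma primitive_element_powers:
  fixes \<theta> :: "'a::field_char_0"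
  assumes nf: "number_field TYPE('a)" and \<theta>: "adjoin \<theta> = UNIV"
  shows "rat_independent {..<number_field_degree TYPE('a)} (\<lambda>i. \<theta> ^ i)"
  unfolding rat_independent_def
proof (intro allI impI)
  let ?n = "number_field_degree TYPE('a)"
  fix q assume q: "(\<Sum>i<?n. of_rat (q i) * \<theta> ^ i) = 0"
  obtain f where f: "min_poly \<theta> f" using min_poly_exists[OF nf] by blast
  define h where "h = (\<Sum>i<?n. monom (q i) i)"
  have "rpoly h \<theta> = 0" using q by (simp add: h_def rpoly_sum rpoly_monom)
  hence "f dvd h" using f by (simp add: min_poly_def)
  have n: "degree f = ?n" "?n > 0"
    using primitive_element_min_poly_degree[OF nf \<theta> f] min_poly_degree_pos[OF f] by simp_all
  have "degree h < ?n" unfolding h_def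
    by (rule degree_sum_less) (use n in \<open>auto intro: le_less_trans[OF degree_monom_le]\<close>)
  hence "h = 0" using dvd_imp_degree_le[OF \<open>f dvd h\<close>] n by auto
  moreover have "coeff h i = q i" if "i < ?n" for i using that by (simp add: h_def coeff_sum)
  ultimately show "\<forall>i\<in>{..<?n}. q i = 0" by auto
qed

section \<open>Embeddings into an algebraically closed field\<close>

lemma card_roots_separable:
  fixes p :: "'b::alg_closed_field poly"
  assumes "p \<noteq> 0" and sep: "\<And>z. poly p z = 0 \<Longrightarrow> poly (pderiv p) z \<noteq> 0"
  shows "card {z. poly p z = 0} = degree p"
proof -
  obtain A c where A: "size A = degree p" "p = smult c (\<Prod>x\<in>#A. [:- x, 1:])"
    using alg_closed_imp_factorization[OF assms(1)] by blast
  have c: "c \<noteq> 0" using A(2) assms(1) by auto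
  have roots: "{z. poly p z = 0} = set_mset A"
    by (subst A(2)) (use c in \<open>auto simp: poly_prod_mset prod_mset_zero_iff\<close>)
  have "count A z = 1" if "z \<in># A" for z
  proof (rule ccontr)
    assume "count A z \<noteq> 1"
    moreover have "count A z > 0" using that by simp
    ultimately have "count A z \<ge> 2" by linarith
    hence "{#z, z#} \<subseteq># A" by (simp add: subseteq_mset_def)
    then obtain A' where A': "A = {#z, z#} + A'" by (metis subset_mset.less_eqE)
    define q where "q = [:- z, 1:]"
    define R where "R = smult c (\<Prod>x\<in>#A'. [:- x, 1:])"
    have "p = q * (q * R)"
      by (subst A(2), unfold A' R_def q_def) (simp del: mult_pCons_left)
    moreover have "poly q z = 0" by (simp add: q_def)
    ultimately have "poly p z = 0 \<and> poly (pderiv p) z = 0" by (simp add: pderiv_mult)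
    thus False using sep by blast
  qed
  hence "size A = card (set_mset A)" by (simp add: size_multiset_overloaded_eq)
  thus ?thesis using roots A(1) by simp
qed

text \<open>Each root \<open>z\<close> of the minimal polynomial gives one embedding, sending a
  polynomial expression in \<open>\<theta>\<close> to the same expression in \<open>z\<close>;
  separability supplies as many roots as the degree. The target stays arbitrary, since it will be
  the complex numbers at infinity and an algebraic closure of the rationals at primes.\<close>

theorem embeddings_exist:
  fixes \<theta> :: "'a::field_char_0"
  assumes nf: "number_field TYPE('a)" and \<theta>: "adjoin \<theta> = UNIV"
  obtains E :: "('a \<Rightarrow> 'b::{alg_closed_field, field_char_0}) set"
  where "finite E" "card E = number_field_degree TYPE('a)" "\<And>\<sigma>. \<sigma> \<in> E \<Longrightarrow> embedding \<sigma>"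
    "inj_on (\<lambda>\<sigma>. \<sigma> \<theta>) E"
proof -
  obtain f where f: "min_poly \<theta> f" using min_poly_exists[OF nf] by blast
  define Z where "Z = {z::'b. rpoly f z = 0}"
  have f0: "f \<noteq> 0" using f by (simp add: min_poly_def)
  have finZ: "finite Z" unfolding Z_def by (rule finite_rpoly_roots[OF f0])
  have "card Z = degree (map_poly of_rat f :: 'b poly)"
    unfolding Z_def rpoly_def
    by (rule card_roots_separable)
      (use f0 min_poly_separable[OF f] in \<open>simp_all add: map_poly_eq_0_iff rpoly_pderiv rpoly_def[symmetric]\<close>)
  also have "\<dots> = degree f" by (rule degree_map_poly) simp
  finally have cardZ: "card Z = number_field_degree TYPE('a)"
    using primitive_element_min_poly_degree[OF nf \<theta> f] by simp
  \<comment> \<open>An arbitrary choice of expression. It does not influence \<open>ev z\<close>,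
    since two choices differ by a multiple of \<open>f\<close>.\<close>
  define rep where "rep = (\<lambda>x. SOME g. x = rpoly g \<theta>)"
  have rep: "x = rpoly (rep x) \<theta>" for x
  proof -
    obtain g where g: "x = rpoly g \<theta>" using \<theta> by (auto simp: adjoin_def)
    show ?thesis unfolding rep_def by (rule someI[of "\<lambda>g. x = rpoly g \<theta>"]) (rule g)
  qed
  define ev where "ev = (\<lambda>z x. rpoly (rep x) z :: 'b)"
  have ev: "ev z (rpoly g \<theta>) = rpoly g z" if "z \<in> Z" for z g
  proof -
    have "rpoly (rep (rpoly g \<theta>) - g) \<theta> = 0" using rep[of "rpoly g \<theta>"] by (simp add: rpoly_diff)
    hence "f dvd rep (rpoly g \<theta>) - g" using f by (simp add: min_poly_def)
    hence "rpoly (rep (rpoly g \<theta>) - g) z = 0" using that rpoly_dvd by (auto simp: Z_def)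
    thus ?thesis by (simp add: ev_def rpoly_diff)
  qed
  have ev\<theta>: "ev z \<theta> = z" if "z \<in> Z" for z using ev[OF that, of "[:0, 1:]"] by simp
  have inj: "inj_on ev Z" by (rule inj_onI) (metis ev\<theta>)
  have "embedding (ev z)" if z: "z \<in> Z" for z
    unfolding embedding_def
  proof (intro conjI allI)
    show "ev z 1 = 1" using ev[OF z, of 1] by simp
    fix x y
    show "ev z (x + y) = ev z x + ev z y"
      using ev[OF z, of "rep x + rep y"] rep[of x] rep[of y] by (simp add: rpoly_add ev_def)
    show "ev z (x * y) = ev z x * ev z y"
      using ev[OF z, of "rep x * rep y"] rep[of x] rep[of y] by (simp add: rpoly_mult ev_def)
  qed
  thus ?thesis
    using that[of "ev ` Z"] finZ cardZ inj ev\<theta> by (auto simp: card_image inj_on_def)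
qed

section \<open>Norms and local degrees\<close>

definition power_coords :: "'a::field_char_0 \<Rightarrow> nat \<Rightarrow> 'a \<Rightarrow> nat \<Rightarrow> rat"
  where "power_coords \<theta> n x = (SOME q. x = (\<Sum>i<n. of_rat (q i) * \<theta> ^ i))"

definition norm_matrix :: "'a::field_char_0 \<Rightarrow> 'a \<Rightarrow> rat mat"
  where "norm_matrix \<theta> a = (let n = number_field_degree TYPE('a) in
    mat n n (\<lambda>(i, j). power_coords \<theta> n (a * \<theta> ^ i) j))"

text \<open>The field norm; \<open>\<theta>\<close> only selects a basis. A determinant, not a
  product of embeddings, so that one rational number serves infinity and all primes although the
  embeddings have different targets.\<close>

definition rat_norm :: "'a::field_char_0 \<Rightarrow> 'a \<Rightarrow> rat"
  where "rat_norm \<theta> a = det (norm_matrix \<theta> a)"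

lemma power_coords:
  fixes \<theta> :: "'a::field_char_0"
  assumes nf: "number_field TYPE('a)" and \<theta>: "adjoin \<theta> = UNIV"
    and n: "n = number_field_degree TYPE('a)"
  shows "x = (\<Sum>i<n. of_rat (power_coords \<theta> n x i) * \<theta> ^ i)"
proof -
  obtain q where q: "x = (\<Sum>i<n. of_rat (q i) * \<theta> ^ i)"
    using rat_independent_spans[OF nf finite_lessThan primitive_element_powers[OF nf \<theta>]] n by auto
  show ?thesis unfolding power_coords_def by (rule someI[of "\<lambda>q. x = (\<Sum>i<n. of_rat (q i) * \<theta> ^ i)"]) (rule q)
qed

text \<open>The columns of the Vandermonde matrix of the conjugates of \<open>\<theta>\<close> are
  eigenvectors of multiplication by \<open>a\<close>, with the conjugates of \<open>a\<close> as
  eigenvalues.\<close>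

theorem prod_embeddings:
  fixes \<theta> a :: "'a::field_char_0" and E :: "('a \<Rightarrow> 'b::field_char_0) set"
  assumes nf: "number_field TYPE('a)" and \<theta>: "adjoin \<theta> = UNIV"
    and E: "finite E" "card E = number_field_degree TYPE('a)" "\<And>\<sigma>. \<sigma> \<in> E \<Longrightarrow> embedding \<sigma>"
      "inj_on (\<lambda>\<sigma>. \<sigma> \<theta>) E"
  shows "(\<Prod>\<sigma>\<in>E. \<sigma> a) = of_rat (rat_norm \<theta> a)"
proof -
  define n where "n = number_field_degree TYPE('a)"
  obtain s where s: "bij_betw s {0..<n} E"
    using ex_bij_betw_nat_finite[OF E(1)] E(2) n_def by metis
  hence sE: "s i \<in> E" if "i < n" for i using that by (auto simp: bij_betw_def)
  note emb = E(3)[OF sE]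
  define V where "V = mat n n (\<lambda>(j, l). s l \<theta> ^ j)"
  define D where "D = mat n n (\<lambda>(i, j). if i = j then s i a else 0)"
  define A where "A = (map_mat of_rat (norm_matrix \<theta> a) :: 'b mat)"
  have carr: "V \<in> carrier_mat n n" "D \<in> carrier_mat n n" "A \<in> carrier_mat n n"
    by (auto simp: V_def D_def A_def norm_matrix_def n_def Let_def)
  have "A * V = V * D"
  proof (rule eq_matI)
    fix i l assume "i < dim_row (V * D)" "l < dim_col (V * D)"
    hence il: "i < n" "l < n" using carr by auto
    have "(A * V) $$ (i, l) = (\<Sum>j = 0..<n. of_rat (power_coords \<theta> n (a * \<theta> ^ i) j) * s l \<theta> ^ j)"
      using il carr by (simp add: scalar_prod_def A_def V_def norm_matrix_def n_def[symmetric] Let_def)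
    also have "\<dots> = s l (\<Sum>j<n. of_rat (power_coords \<theta> n (a * \<theta> ^ i) j) * \<theta> ^ j)"
      by (simp add: embedding_sum[OF emb[OF il(2)]] embedding_mult[OF emb[OF il(2)]]
          embedding_of_rat[OF emb[OF il(2)]] embedding_power[OF emb[OF il(2)]] atLeast0LessThan)
    also have "(\<Sum>j<n. of_rat (power_coords \<theta> n (a * \<theta> ^ i) j) * \<theta> ^ j) = a * \<theta> ^ i"
      using power_coords[OF nf \<theta> n_def] by simp
    also have "s l (a * \<theta> ^ i) = s l \<theta> ^ i * s l a"
      by (simp add: embedding_mult[OF emb[OF il(2)]] embedding_power[OF emb[OF il(2)]])
    also have "\<dots> = (V * D) $$ (i, l)"
    proof -
      have "(V * D) $$ (i, l) = (\<Sum>j = 0..<n. s j \<theta> ^ i * (if j = l then s j a else 0))"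
        using il carr by (simp add: scalar_prod_def V_def D_def)
      also have "\<dots> = (\<Sum>j = 0..<n. if j = l then s j \<theta> ^ i * s j a else 0)"
        by (intro sum.cong) auto
      also have "\<dots> = s l \<theta> ^ i * s l a" using il by simp
      finally show ?thesis by simp
    qed
    finally show "(A * V) $$ (i, l) = (V * D) $$ (i, l)" .
  qed (use carr in auto)
  hence "det A * det V = det V * det D"
    using det_mult[OF carr(3,1)] det_mult[OF carr(1,2)] by metis
  \<comment> \<open>A nonzero vector killed by the transpose lists the coefficients of a nonzero
    polynomial of degree below \<open>n\<close> with \<open>n\<close> distinct roots.\<close>
  moreover have "det V \<noteq> 0"
  proof
    assume "det V = 0"
    hence "det (transpose_mat V) = 0" using det_transpose[OF carr(1)] by simp
    then obtain w where w: "w \<in> carrier_vec n" "w \<noteq> 0\<^sub>v n" "transpose_mat V *\<^sub>v w = 0\<^sub>v n"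
      using det_0_iff_vec_prod_zero[of "transpose_mat V" n] carr(1) by auto
    define p where "p = (\<Sum>j<n. monom (w $ j) j)"
    have coeff: "coeff p j = w $ j" if "j < n" for j using that by (simp add: p_def coeff_sum)
    have "\<exists>j<n. w $ j \<noteq> 0"
    proof (rule ccontr)
      assume "\<not> (\<exists>j<n. w $ j \<noteq> 0)"
      hence "w = 0\<^sub>v n" using w(1) by (intro eq_vecI) auto
      thus False using w(2) by simp
    qed
    then obtain j where "j < n" "w $ j \<noteq> 0" by blast
    hence p0: "p \<noteq> 0" "n > 0" using coeff[of j] by auto
    have root: "poly p (s l \<theta>) = 0" if l: "l < n" for l
    proof -
      have "(transpose_mat V *\<^sub>v w) $ l = (\<Sum>j = 0..<n. s l \<theta> ^ j * w $ j)"
        using l w(1) carr by (simp add: scalar_prod_def V_def)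
      also have "\<dots> = poly p (s l \<theta>)"
        by (simp add: p_def poly_sum poly_monom atLeast0LessThan mult.commute)
      finally show ?thesis using w(3) l by simp
    qed
    have "(\<lambda>\<sigma>. \<sigma> \<theta>) ` E \<subseteq> {z. poly p z = 0}" using root s by (auto simp: bij_betw_def)
    hence "card ((\<lambda>\<sigma>. \<sigma> \<theta>) ` E) \<le> card {z. poly p z = 0}"
      using poly_roots_finite[OF p0(1)] card_mono by blast
    also have "\<dots> \<le> degree p" by (rule card_poly_roots_bound[OF p0(1)])
    also have "\<dots> < n" unfolding p_def
      by (rule degree_sum_less) (use p0 in \<open>auto intro: le_less_trans[OF degree_monom_le]\<close>)
    finally show False using E(2) card_image[OF E(4)] n_def by simp
  qed
  ultimately have "det A = det D" by simp
  also have "det D = (\<Prod>i = 0..<n. s i a)"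
    using det_upper_triangular[OF _ carr(2)] by (simp add: upper_triangular_def D_def diag_mat_def
        prod.list_conv_set_nth)
  also have "\<dots> = (\<Prod>\<sigma>\<in>E. \<sigma> a)" using prod.reindex_bij_betw[OF s, of "\<lambda>\<sigma>. \<sigma> a"] by simp
  finally show ?thesis by (simp add: A_def rat_norm_def)
qed

section \<open>Lagrange interpolation\<close>

definition lagrange_basis :: "'b::field set \<Rightarrow> 'b \<Rightarrow> 'b poly"
  where "lagrange_basis Z z =
    smult (inverse (\<Prod>y\<in>Z - {z}. z - y)) (\<Prod>y\<in>Z - {z}. [:- y, 1:])"

lemma lagrange_interpolation:
  fixes p :: "'b::field poly"
  assumes Z: "finite Z" and p: "degree p < card Z"
  shows "p = (\<Sum>z\<in>Z. smult (poly p z) (lagrange_basis Z z))" (is "p = ?P")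
proof -
  have L: "poly (lagrange_basis Z z) y = (if z = y then 1 else 0)" if "y \<in> Z" "z \<in> Z" for y z
    using that Z by (auto simp: lagrange_basis_def poly_prod prod_zero_iff)
  have dL: "degree (lagrange_basis Z z) < card Z" if "z \<in> Z" for z
  proof -
    have "degree (lagrange_basis Z z) \<le> (\<Sum>y\<in>Z - {z}. degree [:- y, 1:])"
      unfolding lagrange_basis_def using Z degree_prod_sum_le[of "Z - {z}" "\<lambda>y. [:- y, 1:]"]
      by (intro order_trans[OF degree_smult_le]) (simp add: o_def)
    also have "\<dots> = card (Z - {z})" by simp
    also have "\<dots> < card Z" using that Z by (intro psubset_card_mono) auto
    finally show ?thesis .
  qed
  have "p - ?P = 0"
  proof (rule ccontr)
    assume nz: "p - ?P \<noteq> 0"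
    have "poly (p - ?P) y = 0" if y: "y \<in> Z" for y
    proof -
      have "poly ?P y = (\<Sum>z\<in>Z. if z = y then poly p z else 0)"
        unfolding poly_sum by (intro sum.cong) (auto simp: L y)
      thus ?thesis using y Z by simp
    qed
    hence "card Z \<le> card {y. poly (p - ?P) y = 0}"
      using poly_roots_finite[OF nz] by (intro card_mono) auto
    also have "\<dots> \<le> degree (p - ?P)" by (rule card_poly_roots_bound[OF nz])
    also have "\<dots> < card Z"
      using p dL Z
      by (intro degree_diff_less degree_sum_less) (auto intro: le_less_trans[OF degree_smult_le])
    finally show False by simp
  qed
  thus ?thesis by simp
qed

text \<open>The order of the quantifiers is what matters: \<open>C\<close> depends on the nodes
  only. This uniformity becomes the constant in complete independence.\<close>

lemma coeffs_bounded_by_values: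
  fixes w :: "'b::field_char_0 \<Rightarrow> real"
  assumes w: "abs_val w" and Z: "finite Z"
  obtains C where "C > 0" "\<And>(p :: 'b poly) i d. degree p < card Z \<Longrightarrow>
    (\<And>z. z \<in> Z \<Longrightarrow> w (poly p z) \<le> d) \<Longrightarrow> w (coeff p i) \<le> C * d"
proof -
  interpret w: abs_val w by fact
  let ?L = "lagrange_basis Z"
  define C where "C = (\<Sum>z\<in>Z. \<Sum>i\<le>degree (?L z). w (coeff (?L z) i)) + 1"
  have C: "C > 0" unfolding C_def by (smt (verit, best) sum_nonneg w.nonneg)
  have Cle: "(\<Sum>z\<in>Z. w (coeff (?L z) i)) \<le> C" for i
  proof -
    have "w (coeff (?L z) i) \<le> (\<Sum>i\<le>degree (?L z). w (coeff (?L z) i))" for z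
    proof (cases "i \<le> degree (?L z)")
      case True
      thus ?thesis by (intro member_le_sum) auto
    next
      case False
      thus ?thesis by (simp add: coeff_eq_0 sum_nonneg)
    qed
    hence "(\<Sum>z\<in>Z. w (coeff (?L z) i)) \<le> (\<Sum>z\<in>Z. \<Sum>i\<le>degree (?L z). w (coeff (?L z) i))"
      by (intro sum_mono)
    thus ?thesis by (simp add: C_def)
  qed
  show ?thesis
  proof (rule that[OF C])
    fix p :: "'b poly" and i d
    assume p: "degree p < card Z" "\<And>z. z \<in> Z \<Longrightarrow> w (poly p z) \<le> d"
    have "coeff p i = coeff (\<Sum>z\<in>Z. smult (poly p z) (?L z)) i"
      by (rule arg_cong[OF lagrange_interpolation[OF Z p(1)]])
    also have "\<dots> = (\<Sum>z\<in>Z. poly p z * coeff (?L z) i)" by (simp add: coeff_sum)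
    finally have "w (coeff p i) \<le> (\<Sum>z\<in>Z. w (poly p z * coeff (?L z) i))"
      using w.sum_le[of "\<lambda>z. poly p z * coeff (?L z) i" Z] by metis
    also have "\<dots> \<le> (\<Sum>z\<in>Z. d * w (coeff (?L z) i))"
      unfolding w.mult using p(2) by (intro sum_mono mult_right_mono) auto
    also have "\<dots> = d * (\<Sum>z\<in>Z. w (coeff (?L z) i))" by (simp add: sum_distrib_left)
    also have "\<dots> \<le> d * C"
    proof (rule mult_left_mono[OF Cle])
      obtain z where "z \<in> Z" using p(1) by fastforce
      thus "0 \<le> d" using p(2)[of z] w.nonneg order_trans by blast
    qed
    finally show "w (coeff p i) \<le> C * d" by (simp add: mult.commute)
  qed
qed

section \<open>Absolute values induced by embeddings\<close>

lemma embedding_absolute_value: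
  assumes "abs_val w" "embedding \<sigma>" "\<And>q. w (of_rat q) = \<alpha> q"
  shows "w \<circ> \<sigma> \<in> extending \<alpha>"
proof -
  interpret w: abs_val w by fact
  show ?thesis unfolding extending_def absolute_value_def
    using assms(2,3) by (auto simp: embedding_mult embedding_add embedding_eq_0_iff embedding_of_rat
        w.mult w.triangle)
qed

text \<open>
  Interpolating at the images of \<open>\<theta>\<close> under the embeddings inducing \<open>v\<close> shows that as many powers of
  \<open>\<theta>\<close> stay independent in the completion.
\<close>

lemma card_embeddings_le_local_degree:
  fixes \<theta> :: "'a::field_char_0" and w :: "'b::field_char_0 \<Rightarrow> real"
  assumes nf: "number_field TYPE('a)" and w: "abs_val w" and v: "abs_val v"
    and F: "finite F" "\<And>\<sigma>. \<sigma> \<in> F \<Longrightarrow> embedding \<sigma>" "inj_on (\<lambda>\<sigma>. \<sigma> \<theta>) F" "\<And>\<sigma>. \<sigma> \<in> F \<Longrightarrow> w \<circ> \<sigma> = v"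
  shows "card F \<le> local_degree v"
proof (cases "F = {}")
  case False
  interpret w: abs_val w by fact
  interpret v: abs_val v by fact
  obtain C where C: "C > 0" "\<And>(p :: 'b poly) i d. degree p < card ((\<lambda>\<sigma>. \<sigma> \<theta>) ` F) \<Longrightarrow>
    (\<And>z. z \<in> (\<lambda>\<sigma>. \<sigma> \<theta>) ` F \<Longrightarrow> w (poly p z) \<le> d) \<Longrightarrow> w (coeff p i) \<le> C * d"
    using coeffs_bounded_by_values[OF w finite_imageI[OF F(1), of "\<lambda>\<sigma>. \<sigma> \<theta>"]] by metis
  have pos: "card F > 0" using False F(1) by (simp add: card_gt_0_iff)
  have vw: "v x = w (\<sigma> x)" if "\<sigma> \<in> F" for \<sigma> x using F(4)[OF that] by auto
  have "completely_independent v (card F) (\<lambda>i. \<theta> ^ i)"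
    unfolding completely_independent_def
  proof (intro exI[of _ "inverse C"] conjI allI impI)
    show "inverse C > 0" using C(1) by simp
    fix q :: "nat \<Rightarrow> rat" and i assume i: "i < card F"
    define x where "x = (\<Sum>j<card F. of_rat (q j) * \<theta> ^ j)"
    define p :: "'b poly" where "p = (\<Sum>j<card F. monom (of_rat (q j)) j)"
    have "w (coeff p i) \<le> C * v x"
    proof (rule C(2))
      show "degree p < card ((\<lambda>\<sigma>. \<sigma> \<theta>) ` F)"
        unfolding p_def card_image[OF F(3)]
        by (rule degree_sum_less) (use pos in \<open>auto intro: le_less_trans[OF degree_monom_le]\<close>)
      fix z assume "z \<in> (\<lambda>\<sigma>. \<sigma> \<theta>) ` F"
      then obtain \<sigma> where \<sigma>: "\<sigma> \<in> F" "z = \<sigma> \<theta>" by blast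
      have "\<sigma> x = poly p z" unfolding x_def \<sigma>(2) p_def
        using F(2)[OF \<sigma>(1)] by (simp add: embedding_sum embedding_mult embedding_of_rat
            embedding_power poly_sum poly_monom)
      thus "w (poly p z) \<le> v x" using vw[OF \<sigma>(1), of x] by simp
    qed
    moreover have "w (coeff p i) = v (of_rat (q i))"
    proof -
      obtain \<sigma> where \<sigma>: "\<sigma> \<in> F" using False by blast
      thus ?thesis using i vw[OF \<sigma>] by (simp add: p_def coeff_sum embedding_of_rat[OF F(2)[OF \<sigma>]])
    qed
    ultimately show "inverse C * v (of_rat (q i)) \<le> v (\<Sum>j<card F. of_rat (q j) * \<theta> ^ j)"
      using C(1) by (simp add: x_def field_simps)
  qed
  thus ?thesis by (rule v.completely_independent_le_local_degree[OF nf])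
qed simp

text \<open>Equality in the count also leaves no room for further extensions: one not induced by an
  embedding would have positive local degree and violate the bound from weak approximation.\<close>

theorem extending_absolute_values:
  fixes \<theta> :: "'a::field_char_0" and w :: "'b::field_char_0 \<Rightarrow> real"
    and E :: "('a \<Rightarrow> 'b) set" and v :: "'a \<Rightarrow> real"
  assumes nf: "number_field TYPE('a)"
    and w: "abs_val w" "\<And>q. w (of_rat q) = \<alpha> q"
    and r: "0 < \<alpha> r" "\<alpha> r < 1"
    and E: "finite E" "card E = number_field_degree TYPE('a)" "\<And>\<sigma>. \<sigma> \<in> E \<Longrightarrow> embedding \<sigma>"
      "inj_on (\<lambda>\<sigma>. \<sigma> \<theta>) E"
  shows "extending \<alpha> = (\<lambda>\<sigma>. w \<circ> \<sigma>) ` E" (is "_ = ?V")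
    and "v \<in> extending \<alpha> \<Longrightarrow> local_degree v = card {\<sigma> \<in> E. w \<circ> \<sigma> = v}"
proof -
  have finV: "finite ?V" using E(1) by simp
  have sub: "?V \<subseteq> extending \<alpha>" using embedding_absolute_value[OF w(1) _ w(2)] E(3) by blast
  have le: "card {\<sigma> \<in> E. w \<circ> \<sigma> = v} \<le> local_degree v" if "v \<in> extending \<alpha>" for v
    by (rule card_embeddings_le_local_degree[OF nf w(1) extendingD(1)[OF that]])
      (use E in \<open>auto intro: inj_on_subset\<close>)
  have card: "(\<Sum>v\<in>?V. card {\<sigma> \<in> E. w \<circ> \<sigma> = v}) = card E"
    using sum.image_gen[OF E(1), of "\<lambda>_. 1::nat" "\<lambda>\<sigma>. w \<circ> \<sigma>"] by simp
  have upper: "(\<Sum>v\<in>V. local_degree v) \<le> card E" if "finite V" "V \<subseteq> extending \<alpha>" for V :: "('a \<Rightarrow> real) set"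
    using sum_local_degree_le[OF nf that r] E(2) by simp
  have eq: "local_degree v = card {\<sigma> \<in> E. w \<circ> \<sigma> = v}" if "v \<in> ?V" for v
  proof (rule ccontr)
    assume "local_degree v \<noteq> card {\<sigma> \<in> E. w \<circ> \<sigma> = v}"
    hence "card {\<sigma> \<in> E. w \<circ> \<sigma> = v} < local_degree v" using le[of v] sub that by fastforce
    hence "(\<Sum>v\<in>?V. card {\<sigma> \<in> E. w \<circ> \<sigma> = v}) < (\<Sum>v\<in>?V. local_degree v)"
      using le sub that finV by (intro sum_strict_mono_ex1) auto
    thus False using card upper[OF finV sub] by simp
  qed
  show V: "extending \<alpha> = ?V"
  proof (rule ccontr)
    assume "extending \<alpha> \<noteq> ?V"
    then obtain v where v: "v \<in> extending \<alpha>" "v \<notin> ?V" using sub by blast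
    have "(\<Sum>v\<in>insert v ?V. local_degree v) \<le> card E"
      using upper[of "insert v ?V"] v sub finV by blast
    moreover have "(\<Sum>v\<in>insert v ?V. local_degree v) = local_degree v + (\<Sum>v\<in>?V. local_degree v)"
      using v finV by simp
    moreover have "(\<Sum>v\<in>?V. local_degree v) = (\<Sum>v\<in>?V. card {\<sigma> \<in> E. w \<circ> \<sigma> = v})"
      using eq by (intro sum.cong) auto
    ultimately have "local_degree v = 0" using card by linarith
    thus False using abs_val.local_degree_pos[OF extendingD(1)[OF v(1)] nf] by simp
  qed
  show "v \<in> extending \<alpha> \<Longrightarrow> local_degree v = card {\<sigma> \<in> E. w \<circ> \<sigma> = v}" using eq V by simp
qed

text \<open>Take logarithms in the product over embeddings and group the embeddings by the place
  that they induce. The last claim will show that extensions of a p-adic absolute value are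
  ultrametric.\<close>

theorem sum_local_degree_ln:
  fixes \<theta> :: "'a::field_char_0" and v :: "'a \<Rightarrow> real" and w :: "'b::{alg_closed_field, field_char_0} \<Rightarrow> real"
  assumes nf: "number_field TYPE('a)" and \<theta>: "adjoin \<theta> = UNIV"
    and w: "abs_val w" "\<And>q. w (of_rat q) = \<alpha> q"
    and r: "0 < \<alpha> r" "\<alpha> r < 1" and a: "(a :: 'a) \<noteq> 0"
  shows "finite (extending \<alpha> :: ('a \<Rightarrow> real) set)"
    and "(\<Sum>v\<in>extending \<alpha>. real (local_degree v) * ln (v a)) = ln (\<alpha> (rat_norm \<theta> a))"
    and "rat_norm \<theta> a \<noteq> 0"
    and "(\<Sum>v\<in>(extending \<alpha> :: ('a \<Rightarrow> real) set). local_degree v) = number_field_degree TYPE('a)"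
    and "v \<in> extending \<alpha> \<Longrightarrow> \<exists>\<sigma>::'a \<Rightarrow> 'b. embedding \<sigma> \<and> v = w \<circ> \<sigma>"
proof -
  interpret w: abs_val w by fact
  obtain E :: "('a \<Rightarrow> 'b) set" where
    E: "finite E" "card E = number_field_degree TYPE('a)" "\<And>\<sigma>. \<sigma> \<in> E \<Longrightarrow> embedding \<sigma>"
      "inj_on (\<lambda>\<sigma>. \<sigma> \<theta>) E"
    using embeddings_exist[OF nf \<theta>] by metis
  note V = extending_absolute_values[OF nf w r E, simplified]
  show "finite (extending \<alpha> :: ('a \<Rightarrow> real) set)" unfolding V(1) using E(1) by simp
  have nz: "\<sigma> a \<noteq> 0" if "\<sigma> \<in> E" for \<sigma> using embedding_eq_0_iff[OF E(3)[OF that]] a by simp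
  have N: "(\<Prod>\<sigma>\<in>E. \<sigma> a) = of_rat (rat_norm \<theta> a)" by (rule prod_embeddings[OF nf \<theta> E])
  thus "rat_norm \<theta> a \<noteq> 0" using nz E(1) by (metis of_rat_eq_0_iff prod_zero_iff)
  have "ln (\<alpha> (rat_norm \<theta> a)) = ln (\<Prod>\<sigma>\<in>E. w (\<sigma> a))" using N w(2) by (metis w.prod)
  also have "\<dots> = (\<Sum>\<sigma>\<in>E. ln (w (\<sigma> a)))" by (rule ln_prod) (use E(1) nz in auto)
  also have "\<dots> = (\<Sum>v\<in>(\<lambda>\<sigma>. w \<circ> \<sigma>) ` E. \<Sum>\<sigma>\<in>{\<sigma> \<in> E. w \<circ> \<sigma> = v}. ln (w (\<sigma> a)))"
    by (rule sum.image_gen[OF E(1)])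
  also have "\<dots> = (\<Sum>v\<in>extending \<alpha>. real (local_degree v) * ln (v a))"
  proof (rule sum.cong)
    fix v :: "'a \<Rightarrow> real" assume v: "v \<in> extending \<alpha>"
    have "(\<Sum>\<sigma>\<in>{\<sigma> \<in> E. w \<circ> \<sigma> = v}. ln (w (\<sigma> a))) = (\<Sum>\<sigma>\<in>{\<sigma> \<in> E. w \<circ> \<sigma> = v}. ln (v a))"
      by (intro sum.cong) auto
    thus "(\<Sum>\<sigma>\<in>{\<sigma> \<in> E. w \<circ> \<sigma> = v}. ln (w (\<sigma> a))) = real (local_degree v) * ln (v a)"
      using V(2)[OF v] by simp
  qed (simp add: V(1))
  finally show "(\<Sum>v\<in>extending \<alpha>. real (local_degree v) * ln (v a)) = ln (\<alpha> (rat_norm \<theta> a))" by simp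
  have "(\<Sum>v\<in>(extending \<alpha> :: ('a \<Rightarrow> real) set). local_degree v)
      = (\<Sum>v\<in>(\<lambda>\<sigma>. w \<circ> \<sigma>) ` E. card {\<sigma> \<in> E. w \<circ> \<sigma> = v})"
    using V by (intro sum.cong) auto
  also have "\<dots> = card E" using sum.image_gen[OF E(1), of "\<lambda>_. 1::nat" "\<lambda>\<sigma>. w \<circ> \<sigma>"] by simp
  finally show "(\<Sum>v\<in>(extending \<alpha> :: ('a \<Rightarrow> real) set). local_degree v) = number_field_degree TYPE('a)"
    using E(2) by simp
  show "v \<in> extending \<alpha> \<Longrightarrow> \<exists>\<sigma>::'a \<Rightarrow> 'b. embedding \<sigma> \<and> v = w \<circ> \<sigma>" unfolding V(1) using E(3) by blast
qed

section \<open>Extending p-adic absolute values to algebraic extensions\<close>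

context subring_set
begin

lemma of_nat: "of_nat k \<in> K" by (induction k) (auto simp: zero one add)
lemma of_int: "of_int k \<in> K" by (cases k rule: int_cases2) (auto simp: of_nat minus)

lemma adjoin_element_subring: "subring_set ((\<lambda>f. poly f x) ` coeffs_in K)"
proof
  show "1 \<in> (\<lambda>f. poly f x) ` coeffs_in K"
    by (rule image_eqI[of _ _ 1]) (auto simp: coeffs_in_def one zero)
next
  fix a b assume "a \<in> (\<lambda>f. poly f x) ` coeffs_in K" "b \<in> (\<lambda>f. poly f x) ` coeffs_in K"
  then obtain f g where fg: "a = poly f x" "b = poly g x" "f \<in> coeffs_in K" "g \<in> coeffs_in K" by blast
  show "a - b \<in> (\<lambda>f. poly f x) ` coeffs_in K"
    by (rule image_eqI[of _ _ "f - g"]) (simp_all add: fg coeffs_in_diff)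
  show "a * b \<in> (\<lambda>f. poly f x) ` coeffs_in K"
    by (rule image_eqI[of _ _ "f * g"]) (simp_all add: fg coeffs_in_mult)
qed

lemma subset_adjoin_element: "K \<subseteq> (\<lambda>f. poly f x) ` coeffs_in K"
proof
  fix a assume "a \<in> K"
  thus "a \<in> (\<lambda>f. poly f x) ` coeffs_in K"
    by (intro image_eqI[of _ _ "[:a:]"]) (auto simp: coeffs_in_def coeff_pCons zero split: nat.splits)
qed

lemma element_in_adjoin_element: "x \<in> (\<lambda>f. poly f x) ` coeffs_in K"
  by (intro image_eqI[of _ _ "[:0, 1:]"]) (auto simp: coeffs_in_def coeff_pCons zero one split: nat.splits)

end

text \<open>
  A subring maximal among those avoiding \<open>1/p\<close> is a valuation ring (Chevalley); in an algebraic
  extension of the rationals its valuation has rank one.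
\<close>

locale maximal_subring = subring_set K for K :: "'a::field_char_0 set" +
  fixes \<pi> :: 'a
  assumes pi_nz: "\<pi> \<noteq> 0" and pi_in: "\<pi> \<in> K" and pi_inverse: "inverse \<pi> \<notin> K"
    and maximal: "\<And>B. subring_set B \<Longrightarrow> K \<subseteq> B \<Longrightarrow> inverse \<pi> \<notin> B \<Longrightarrow> B = K"
begin

text \<open>By maximality, \<open>K[x]\<close> contains the inverse of \<open>\<pi>\<close>.\<close>

lemma adjoin_contains:
  assumes "x \<notin> K"
  obtains n a where "\<And>i. a i \<in> K" "\<pi> * (\<Sum>i\<le>n. a i * x ^ i) = 1"
proof -
  have "(\<lambda>f. poly f x) ` coeffs_in K \<noteq> K" using element_in_adjoin_element[of x] assms by blast
  hence "inverse \<pi> \<in> (\<lambda>f. poly f x) ` coeffs_in K"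
    using maximal[OF adjoin_element_subring subset_adjoin_element] by blast
  then obtain f where f: "inverse \<pi> = poly f x" "f \<in> coeffs_in K" by blast
  have "\<pi> * (\<Sum>i\<le>degree f. coeff f i * x ^ i) = 1"
    using f(1) pi_nz by (simp add: poly_altdef[symmetric] flip: f(1))
  thus ?thesis using that[of "coeff f"] f(2) by (auto simp: coeffs_in_def)
qed

lemma power_one_minus: "b \<in> K \<Longrightarrow> \<exists>c\<in>K. (1 - \<pi> * b) ^ k = 1 - \<pi> * c"
proof (induction k)
  case 0
  show ?case by (intro bexI[of _ 0]) (auto simp: zero)
next
  case (Suc k)
  then obtain c where "c \<in> K" "(1 - \<pi> * b) ^ k = 1 - \<pi> * c" by blast
  hence "(1 - \<pi> * b) ^ Suc k = (1 - \<pi> * b) * (1 - \<pi> * c)" by simp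
  also have "\<dots> = 1 - \<pi> * (b + c - \<pi> * b * c)" by (simp add: algebra_simps)
  finally show ?case using Suc.prems \<open>c \<in> K\<close>
    by (intro bexI[of _ "b + c - \<pi> * b * c"]) (auto intro!: add diff mult pi_in)
qed

lemma pi_mult_neq_1: "b \<in> K \<Longrightarrow> \<pi> * b \<noteq> 1"
  using pi_inverse inverse_unique by metis

text \<open>Were the inverse of \<open>u = 1 - \<pi> * b\<close> outside \<open>K\<close>, clearing
  denominators in its relation would put a power of \<open>u\<close> into \<open>\<pi> K\<close>;
  but such a power is 1 modulo \<open>\<pi> K\<close>.\<close>

lemma inverse_one_minus:
  assumes b: "b \<in> K"
  shows "inverse (1 - \<pi> * b) \<in> K"
proof (rule ccontr)
  assume "inverse (1 - \<pi> * b) \<notin> K"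
  then obtain n a where a: "\<And>i. a i \<in> K" "\<pi> * (\<Sum>i\<le>n. a i * inverse (1 - \<pi> * b) ^ i) = 1"
    using adjoin_contains by blast
  define u where "u = 1 - \<pi> * b"
  have u: "u \<noteq> 0" "u \<in> K" using pi_mult_neq_1[OF b] by (auto simp: u_def intro!: diff one mult pi_in b)
  have "u ^ n = u ^ n * (\<pi> * (\<Sum>i\<le>n. a i * inverse u ^ i))" using a(2) by (simp add: u_def)
  also have "\<dots> = \<pi> * (\<Sum>i\<le>n. a i * (u ^ n * inverse u ^ i))"
    by (simp add: sum_distrib_left mult_ac)
  also have "\<dots> = \<pi> * (\<Sum>i\<le>n. a i * u ^ (n - i))"
    using u by (intro arg_cong[of _ _ "\<lambda>x. \<pi> * x"] sum.cong) (auto simp: power_diff field_simps)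
  finally have "u ^ n = \<pi> * (\<Sum>i\<le>n. a i * u ^ (n - i))" .
  moreover obtain c where c: "c \<in> K" "u ^ n = 1 - \<pi> * c" using power_one_minus[OF b] u_def by blast
  ultimately have "\<pi> * ((\<Sum>i\<le>n. a i * u ^ (n - i)) + c) = 1" by (simp add: algebra_simps)
  moreover have "(\<Sum>i\<le>n. a i * u ^ (n - i)) + c \<in> K"
    using a(1) u c by (intro add sum mult power)
  ultimately show False using pi_mult_neq_1 by blast
qed

text \<open>The quantity that descends in Chevalley's argument: a degree in which
  \<open>K[x]\<close> is seen to contain the inverse of \<open>\<pi>\<close>.\<close>

definition unit_degree :: "'a \<Rightarrow> nat \<Rightarrow> bool"
  where "unit_degree x n \<longleftrightarrow> (\<exists>a. (\<forall>i. a i \<in> K) \<and> \<pi> * (\<Sum>i\<le>n. a i * x ^ i) = 1)"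

text \<open>In the relation for \<open>inverse x\<close>, the constant term moves to the other side
  and forms the unit \<open>1 - \<pi> * g 0\<close>. Multiplication by \<open>x ^ n\<close> then
  expresses \<open>x ^ n\<close> through lower powers, and substituting this in the relation for
  \<open>x\<close> lowers its degree.\<close>

lemma unit_degree_reduce:
  assumes x: "x \<noteq> 0" and n: "unit_degree x n" and m: "unit_degree (inverse x) m" and "m \<le> n"
  shows "n > 0 \<and> unit_degree x (n - 1)"
proof -
  obtain f where f: "\<And>i. f i \<in> K" "\<pi> * (\<Sum>i\<le>n. f i * x ^ i) = 1"
    using n unfolding unit_degree_def by blast
  obtain g where g: "\<And>i. g i \<in> K" "\<pi> * (\<Sum>j\<le>m. g j * inverse x ^ j) = 1"
    using m unfolding unit_degree_def by blast
  have "n \<noteq> 0"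
  proof
    assume "n = 0"
    hence "\<pi> * f 0 = 1" using f(2) by simp
    thus False using pi_mult_neq_1 f(1) by blast
  qed
  then obtain n' where n': "n = Suc n'" using not0_implies_Suc by blast
  define u where "u = inverse (1 - \<pi> * g 0)"
  have u: "u \<in> K" "u * (1 - \<pi> * g 0) = 1"
    unfolding u_def using inverse_one_minus[OF g(1)] pi_mult_neq_1[OF g(1)] by auto
  have "(\<Sum>j\<le>m. g j * inverse x ^ j) = g 0 + (\<Sum>j\<in>{1..m}. g j * inverse x ^ j)"
    by (simp add: sum.atMost_shift sum.atLeast1_atMost_eq)
  hence "1 - \<pi> * g 0 = \<pi> * (\<Sum>j\<in>{1..m}. g j * inverse x ^ j)"
    using g(2) by (simp add: algebra_simps)
  hence "1 = u * (\<pi> * (\<Sum>j\<in>{1..m}. g j * inverse x ^ j))" using u(2) by simp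
  hence "x ^ n = x ^ n * (u * (\<pi> * (\<Sum>j\<in>{1..m}. g j * inverse x ^ j)))" by simp
  also have "\<dots> = (\<Sum>j\<in>{1..m}. u * \<pi> * g j * (x ^ n * inverse x ^ j))"
    by (simp add: sum_distrib_left mult_ac)
  also have "\<dots> = (\<Sum>j\<in>{1..m}. u * \<pi> * g j * x ^ (n - j))"
    using x \<open>m \<le> n\<close> by (intro sum.cong) (auto simp: power_diff field_simps)
  \<comment> \<open>Since \<open>j\<close> starts at 1, all exponents \<open>n - j\<close> are at
    most \<open>n'\<close>; the terms are collected by exponent.\<close>
  also have "\<dots> = (\<Sum>j\<in>{1..m}. \<Sum>i\<le>n'. if i = n - j then u * \<pi> * g j * x ^ i else 0)"
    using \<open>m \<le> n\<close> n' by (intro sum.cong) auto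
  also have "\<dots> = (\<Sum>i\<le>n'. (\<Sum>j\<in>{1..m}. if i = n - j then u * \<pi> * g j else 0) * x ^ i)"
    by (subst sum.swap) (auto simp: sum_distrib_right intro!: sum.cong)
  finally have xn: "x ^ n = (\<Sum>i\<le>n'. (\<Sum>j\<in>{1..m}. if i = n - j then u * \<pi> * g j else 0) * x ^ i)" .
  define h where "h = (\<lambda>i. f i + f n * (\<Sum>j\<in>{1..m}. if i = n - j then u * \<pi> * g j else 0))"
  have "h i \<in> K" for i unfolding h_def
    using f(1) g(1) u(1) by (intro add mult sum) (auto intro!: mult pi_in zero)
  moreover have "\<pi> * (\<Sum>i\<le>n'. h i * x ^ i) = 1"
  proof -
    have "(\<Sum>i\<le>n'. h i * x ^ i) = (\<Sum>i\<le>n'. f i * x ^ i) + f n * x ^ n"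
      unfolding xn h_def by (simp add: algebra_simps sum.distrib sum_distrib_left)
    also have "\<dots> = (\<Sum>i\<le>n. f i * x ^ i)" by (simp add: n')
    finally show ?thesis using f(2) by simp
  qed
  ultimately show ?thesis unfolding unit_degree_def n' by auto
qed

text \<open>With least degrees for \<open>x\<close> and for its inverse, whichever is not the
  smaller one could still be lowered.\<close>

lemma valuation_ring:
  assumes x: "x \<noteq> 0"
  shows "x \<in> K \<or> inverse x \<in> K"
proof (rule ccontr)
  assume "\<not> (x \<in> K \<or> inverse x \<in> K)"
  hence ex: "\<exists>n. unit_degree x n" "\<exists>n. unit_degree (inverse x) n"
    unfolding unit_degree_def using adjoin_contains by metis+
  define n where "n = (LEAST n. unit_degree x n)"
  define m where "m = (LEAST n. unit_degree (inverse x) n)"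
  have n: "unit_degree x n" and m: "unit_degree (inverse x) m"
    unfolding n_def m_def using ex by (auto intro: LeastI_ex)
  have n': "\<not> unit_degree x k" if "k < n" for k using that unfolding n_def by (rule not_less_Least)
  have m': "\<not> unit_degree (inverse x) k" if "k < m" for k using that unfolding m_def by (rule not_less_Least)
  show False
  proof (cases "m \<le> n")
    case True
    thus False using unit_degree_reduce[OF x n m True] n'[of "n - 1"] by simp
  next
    case False
    thus False using unit_degree_reduce[of "inverse x" m n] x n m m'[of "m - 1"] by simp
  qed
qed

lemma inverse_power_notin: "k > 0 \<Longrightarrow> inverse \<pi> ^ k \<notin> K"
proof
  assume k: "k > 0" "inverse \<pi> ^ k \<in> K"
  then obtain j where j: "k = Suc j" using not0_implies_Suc by blast
  have "\<pi> ^ j * inverse \<pi> ^ k \<in> K" by (rule mult[OF power[OF pi_in] k(2)])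
  moreover have "\<pi> ^ j * inverse \<pi> ^ k = inverse \<pi>"
    using pi_nz by (simp add: j power_inverse field_simps)
  ultimately show False using pi_inverse by simp
qed

lemma pi_powi_in_iff: "\<pi> powi k \<in> K \<longleftrightarrow> k \<ge> 0"
proof (cases k rule: int_cases2)
  case (nonneg n)
  thus ?thesis by (simp add: power pi_in)
next
  case (nonpos n)
  thus ?thesis using inverse_power_notin[of n]
    by (cases "n = 0") (auto simp: power_int_minus power_inverse one)
qed

end

section \<open>The real valuation of a maximal subring avoiding \<open>1/p\<close>\<close>

locale padic_maximal_subring = maximal_subring K "of_nat p" for K :: "'a::field_char_0 set" and p :: nat +
  assumes prime: "prime p" and algebraic: "\<And>x::'a. \<exists>f. f \<noteq> 0 \<and> rpoly f x = 0"
begin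

lemma coprime_inverse:
  assumes "\<not> int p dvd c"
  shows "inverse (of_int c) \<in> K"
proof -
  have "coprime c (int p)" using prime_imp_coprime[of "int p" c] assms prime
    by (simp add: Rings.coprime_commute)
  then obtain s t where st: "s * c + t * int p = 1" using bezout_int[of c "int p"] by auto
  have "(of_int (s * c + t * int p) :: 'a) = 1" using st by simp
  hence sc: "of_int s * of_int c = 1 - of_nat p * (of_int t :: 'a)" by (simp add: algebra_simps)
  have "1 - of_nat p * (of_int t :: 'a) \<noteq> 0" using pi_mult_neq_1[OF of_int[of t]] by simp
  moreover from this have "(of_int c :: 'a) \<noteq> 0" using sc by auto
  ultimately have "inverse (of_int c) = of_int s * inverse (1 - of_nat p * (of_int t :: 'a))"
    unfolding sc[symmetric] by (simp add: field_simps)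
  thus ?thesis using inverse_one_minus[OF of_int[of t]] by (simp add: mult of_int)
qed

text \<open>If \<open>x \<notin> K\<close>, then \<open>inverse x\<close> is in \<open>K\<close>.
  Dividing an integral equation for \<open>x\<close> by the power of \<open>x\<close> below the top
  one shows that the leading coefficient times \<open>x\<close> is in \<open>K\<close>; the part of
  that coefficient prime to \<open>p\<close> is invertible in \<open>K\<close>, and a power of
  \<open>p\<close> remains.\<close>

lemma scaled_in: "\<exists>e. of_nat p ^ e * x \<in> K"
proof (cases "x \<in> K")
  case True
  thus ?thesis by (intro exI[of _ 0]) simp
next
  case False
  hence "x \<noteq> 0" using zero by auto
  hence ix: "inverse x \<in> K" using valuation_ring False by blast
  obtain f where f: "f \<noteq> 0" "rpoly f x = 0" using algebraic by blast
  obtain c :: "int poly" and b where cb: "smult (of_int b) f = map_poly of_int c" "b \<noteq> 0"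
  proof -
    define b where "b = (\<Prod>i\<le>degree f. snd (quotient_of (coeff f i)))"
    have "\<exists>c::int. of_int b * coeff f i = of_int c" for i
    proof (cases "i \<le> degree f")
      case True
      obtain u v where uv: "quotient_of (coeff f i) = (u, v)" by force
      have "v dvd b" unfolding b_def using True uv by (metis atMost_iff dvd_prodI finite_atMost snd_conv)
      then obtain k where "b = v * k" by blast
      moreover have "coeff f i = of_int u / of_int v" "v > 0"
        using quotient_of_div[OF uv] quotient_of_denom_pos[OF uv] by auto
      ultimately show ?thesis by (intro exI[of _ "u * k"]) simp
    qed (auto simp: coeff_eq_0 intro: exI[of _ 0])
    then obtain c where c: "\<And>i. of_int b * coeff f i = of_int (c i)" by metis
    have "b \<noteq> 0" unfolding b_def
      using quotient_of_denom_pos' by (auto simp: prod_zero_iff less_imp_neq[THEN not_sym])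
    have "smult (of_int b) f = map_poly of_int (\<Sum>i\<le>degree f. monom (c i) i)"
    proof (rule poly_eqI)
      fix i
      have "coeff f i = 0 \<Longrightarrow> c i = 0" using c[of i] by simp
      thus "coeff (smult (of_int b) f) i = coeff (map_poly of_int (\<Sum>i\<le>degree f. monom (c i) i)) i"
        by (cases "i \<le> degree f") (auto simp: c coeff_map_poly coeff_sum coeff_eq_0)
    qed
    thus ?thesis using that \<open>b \<noteq> 0\<close> by blast
  qed
  define m where "m = degree c"
  have c0: "c \<noteq> 0" using cb f(1) by auto
  have "rpoly (smult (of_int b) f) x = 0" by (simp add: rpoly_smult f(2))
  hence "rpoly (map_poly of_int c) x = 0" unfolding cb(1) .
  moreover have "degree (map_poly of_int c :: rat poly) = m" unfolding m_def by (rule degree_map_poly) simp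
  ultimately have eq: "(\<Sum>i\<le>m. of_int (coeff c i) * x ^ i) = 0"
    by (simp add: rpoly_altdef coeff_map_poly)
  have "m \<noteq> 0"
  proof
    assume "m = 0"
    hence "coeff c 0 = 0" using eq by simp
    thus False using c0 \<open>m = 0\<close> by (metis leading_coeff_0_iff m_def)
  qed
  then obtain m' where m': "m = Suc m'" using not0_implies_Suc by blast
  have "(\<Sum>i\<le>m. of_int (coeff c i) * x ^ i) * inverse x ^ m' =
      (\<Sum>i\<le>m'. of_int (coeff c i) * (x ^ i * inverse x ^ m')) + of_int (coeff c m) * (x ^ m * inverse x ^ m')"
    by (simp add: m' sum_distrib_left sum_distrib_right algebra_simps)
  also have "x ^ m * inverse x ^ m' = x" using \<open>x \<noteq> 0\<close> by (simp add: m' field_simps power_inverse)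
  also have "(\<Sum>i\<le>m'. of_int (coeff c i) * (x ^ i * inverse x ^ m')) =
      (\<Sum>i\<le>m'. of_int (coeff c i) * inverse x ^ (m' - i))"
  proof (intro sum.cong refl)
    fix i assume "i \<in> {..m'}"
    hence "inverse x ^ m' = inverse x ^ i * inverse x ^ (m' - i)" by (simp flip: power_add)
    thus "of_int (coeff c i) * (x ^ i * inverse x ^ m') = of_int (coeff c i) * inverse x ^ (m' - i)"
      using \<open>x \<noteq> 0\<close> by (simp add: power_inverse)
  qed
  finally have "of_int (coeff c m) * x = - (\<Sum>i\<le>m'. of_int (coeff c i) * inverse x ^ (m' - i))"
    using eq by (simp add: eq_neg_iff_add_eq_0 add.commute)
  hence cx: "of_int (coeff c m) * x \<in> K"
    using ix by (simp add: minus sum mult of_int power)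
  have "coeff c m \<noteq> 0" using c0 by (simp add: m_def)
  moreover have "\<not> is_unit (int p)" using prime by (simp add: prime_nat_iff)
  ultimately obtain d where d: "coeff c m = int p ^ multiplicity (int p) (coeff c m) * d" "\<not> int p dvd d"
    using multiplicity_decompose' by metis
  have "inverse (of_int d) * (of_int (coeff c m) * x) \<in> K"
    using coprime_inverse[OF d(2)] cx by (rule mult)
  moreover have "d \<noteq> 0" using d(2) by auto
  moreover have "(of_int (coeff c m) :: 'a) = of_nat p ^ multiplicity (int p) (coeff c m) * of_int d"
    by (subst d(1)) simp
  ultimately have "of_nat p ^ multiplicity (int p) (coeff c m) * x \<in> K" by (simp add: field_simps)
  thus ?thesis by blast
qed

text \<open>Membership says that \<open>m\<close> times the valuation of \<open>x\<close> is at
  least \<open>k\<close>. The value group may fail to be discrete, so the valuation is a supremum of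
  rational lower bounds.\<close>

definition exponents :: "'a \<Rightarrow> real set"
  where "exponents x = {real_of_int k / real m | k m. m > 0 \<and> x ^ m * of_nat p powi (- k) \<in> K}"

definition val :: "'a \<Rightarrow> real"
  where "val x = Sup (exponents x)"

lemma exponentsI: "m > 0 \<Longrightarrow> x ^ m * of_nat p powi (- k) \<in> K \<Longrightarrow> real_of_int k / real m \<in> exponents x"
  by (auto simp: exponents_def)

lemma exponents_nonempty: "exponents x \<noteq> {}"
proof -
  obtain e where "of_nat p ^ e * x \<in> K" using scaled_in by blast
  hence "real_of_int (- int e) / real 1 \<in> exponents x"
    by (intro exponentsI) (auto simp: mult.commute)
  thus ?thesis by blast
qed

lemma p_nz: "(of_nat p :: 'a) \<noteq> 0" by (rule pi_nz)

text \<open>Rank one enters here: a power of \<open>p\<close> carrying \<open>inverse x\<close> into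
  \<open>K\<close> bounds all exponents of \<open>x\<close>.\<close>

lemma exponents_bdd: "x \<noteq> 0 \<Longrightarrow> bdd_above (exponents x)"
proof -
  assume x: "x \<noteq> 0"
  obtain e where e: "of_nat p ^ e * inverse x \<in> K" using scaled_in by blast
  have "t \<le> real e" if t: "t \<in> exponents x" for t
  proof -
    obtain k m where km: "t = real_of_int k / real m" "m > 0" "x ^ m * of_nat p powi (- k) \<in> K"
      using t by (auto simp: exponents_def)
    have "(of_nat p ^ e * inverse x) ^ m * (x ^ m * of_nat p powi (- k)) \<in> K"
      by (rule mult[OF power[OF e] km(3)])
    also have "(of_nat p ^ e * inverse x) ^ m * (x ^ m * of_nat p powi (- k)) =
        of_nat p powi (int (e * m)) * of_nat p powi (- k)"
    proof -
      have "(of_nat p ^ e * inverse x) ^ m * (x ^ m * of_nat p powi (- k))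
          = of_nat p ^ (e * m) * (inverse x * x) ^ m * of_nat p powi (- k)"
        by (simp only: power_mult_distrib power_mult[symmetric] mult_ac)
      moreover have "inverse x * x = 1" using x by simp
      ultimately show ?thesis by (simp only: power_int_of_nat power_one mult_1_right)
    qed
    also have "\<dots> = of_nat p powi (int (e * m) - k)" using p_nz by (simp add: power_int_diff power_int_minus field_simps)
    finally have "k \<le> int (e * m)" using pi_powi_in_iff by simp
    hence "real_of_int k \<le> real e * real m" by (metis of_int_le_iff of_int_of_nat_eq of_nat_mult)
    thus ?thesis using km by (simp add: divide_le_eq)
  qed
  thus ?thesis by (auto simp: bdd_above_def)
qed

lemma val_ge: "x \<noteq> 0 \<Longrightarrow> m > 0 \<Longrightarrow> x ^ m * of_nat p powi (- k) \<in> K \<Longrightarrow> real_of_int k / real m \<le> val x"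
  unfolding val_def by (intro cSup_upper exponentsI exponents_bdd)

lemma val_le:
  assumes "\<And>k m. m > 0 \<Longrightarrow> x ^ m * of_nat p powi (- k) \<in> K \<Longrightarrow> real_of_int k / real m \<le> c"
  shows "val x \<le> c"
  unfolding val_def by (intro cSup_least exponents_nonempty) (use assms in \<open>auto simp: exponents_def\<close>)

text \<open>Raising the two memberships to the powers \<open>m'\<close> and \<open>m\<close> gives
  the exponents a common denominator.\<close>

lemma val_mult_ge:
  assumes xy: "x \<noteq> 0" "y \<noteq> 0"
  shows "val x + val y \<le> val (x * y)"
proof -
  have *: "real_of_int k / real m + real_of_int k' / real m' \<le> val (x * y)"
    if "m > 0" "x ^ m * of_nat p powi (- k) \<in> K" "m' > 0" "y ^ m' * of_nat p powi (- k') \<in> K" for k m k' m'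
  proof -
    have "(x ^ m * of_nat p powi (- k)) ^ m' * (y ^ m' * of_nat p powi (- k')) ^ m \<in> K"
      by (rule mult[OF power[OF that(2)] power[OF that(4)]])
    also have "(x ^ m * of_nat p powi (- k)) ^ m' * (y ^ m' * of_nat p powi (- k')) ^ m
        = (x * y) ^ (m * m') * (of_nat p powi ((- k) * int m') * of_nat p powi ((- k') * int m))"
    proof -
      have pw: "((of_nat p :: 'a) powi j) ^ l = of_nat p powi (j * int l)" for j l
        by (simp only: power_int_mult power_int_of_nat)
      show ?thesis unfolding power_mult_distrib pw by (simp add: power_mult[symmetric] mult_ac)
    qed
    also have "of_nat p powi ((- k) * int m') * of_nat p powi ((- k') * int m)
        = (of_nat p :: 'a) powi (- (k * int m' + k' * int m))"
      using p_nz by (subst power_int_add[symmetric]) auto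
    finally have "real_of_int (k * int m' + k' * int m) / real (m * m') \<le> val (x * y)"
      using xy that by (intro val_ge) auto
    moreover have "real_of_int (k * int m' + k' * int m) / real (m * m')
        = real_of_int k / real m + real_of_int k' / real m'"
      using that(1,3) by (simp add: add_divide_distrib)
    ultimately show ?thesis by simp
  qed
  have "val x \<le> val (x * y) - val y"
  proof (rule val_le)
    fix k m assume km: "m > (0::nat)" "x ^ m * of_nat p powi (- k) \<in> K"
    have "val y \<le> val (x * y) - real_of_int k / real m"
    proof (rule val_le)
      fix k' m' assume "m' > (0::nat)" "y ^ m' * of_nat p powi (- k') \<in> K"
      from *[OF km this] show "real_of_int k' / real m' \<le> val (x * y) - real_of_int k / real m" by simp
    qed
    thus "real_of_int k / real m \<le> val (x * y) - val y" by simp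
  qed
  thus ?thesis by simp
qed

lemma val_nonneg: "x \<in> K \<Longrightarrow> x \<noteq> 0 \<Longrightarrow> val x \<ge> 0"
  using val_ge[of x 1 0] by simp

lemma val_powi: "val (of_nat p powi j) = real_of_int j"
proof (rule antisym)
  show "val (of_nat p powi j) \<le> real_of_int j"
  proof (rule val_le)
    fix k m assume km: "m > (0::nat)" "((of_nat p :: 'a) powi j) ^ m * of_nat p powi (- k) \<in> K"
    have "((of_nat p :: 'a) powi j) ^ m * of_nat p powi (- k) = of_nat p powi (j * int m - k)"
      using p_nz by (simp add: power_int_mult power_int_diff power_int_minus field_simps)
    hence "k \<le> j * int m" using km pi_powi_in_iff by simp
    hence "real_of_int k \<le> real_of_int j * real m" by (metis of_int_le_iff of_int_mult of_int_of_nat_eq)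
    thus "real_of_int k / real m \<le> real_of_int j" using km by (simp add: divide_le_eq)
  qed
  show "real_of_int j \<le> val (of_nat p powi j)"
    using val_ge[of "of_nat p powi j" 1 j] p_nz by (simp add: power_int_minus one)
qed

text \<open>Otherwise some rational \<open>k / m\<close> fits strictly in between. Then
  \<open>x ^ m / p ^ k\<close> is not in \<open>K\<close>, so its inverse is, which bounds the
  valuation of \<open>inverse x\<close> from below.\<close>

lemma val_inverse_ge:
  assumes x: "x \<noteq> 0"
  shows "- val x \<le> val (inverse x)"
proof (rule ccontr)
  assume "\<not> - val x \<le> val (inverse x)"
  hence "val x < - val (inverse x)" by simp
  then obtain r where r: "r \<in> \<rat>" "val x < r" "r < - val (inverse x)" using Rats_dense_in_real by blast
  obtain k m where km: "r = real_of_int k / real m" "m > 0"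
  proof -
    obtain q where q: "r = of_rat q" using r(1) by (auto simp: Rats_def)
    obtain a b where ab: "quotient_of q = (a, b)" by force
    have "r = real_of_int a / real (nat b)" "nat b > 0"
      using quotient_of_div[OF ab] quotient_of_denom_pos[OF ab] by (simp_all add: q of_rat_divide)
    thus ?thesis using that by blast
  qed
  have "x ^ m * of_nat p powi (- k) \<notin> K" using val_ge[OF x km(2), of k] r(2) km(1) by auto
  hence "inverse (x ^ m * of_nat p powi (- k)) \<in> K"
    using valuation_ring[of "x ^ m * of_nat p powi (- k)"] x p_nz by auto
  hence "inverse x ^ m * of_nat p powi (- (- k)) \<in> K" by (simp add: power_inverse power_int_minus)
  hence "real_of_int (- k) / real m \<le> val (inverse x)" using x km(2) by (intro val_ge) auto
  thus False using r(3) km(1) by simp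
qed

lemma val_mult:
  assumes "x \<noteq> 0" "y \<noteq> 0"
  shows "val (x * y) = val x + val y"
proof (rule antisym)
  have "val (x * y) + val (inverse y) \<le> val (x * y * inverse y)" using assms by (intro val_mult_ge) auto
  hence "val (x * y) + val (inverse y) \<le> val x" using assms by (simp add: mult.assoc)
  thus "val (x * y) \<le> val x + val y" using val_inverse_ge[OF assms(2)] by simp
qed (rule val_mult_ge[OF assms])

definition absv :: "'a \<Rightarrow> real"
  where "absv x = (if x = 0 then 0 else real p powr (- val x))"

lemma absv_mult: "absv (x * y) = absv x * absv y"
  by (auto simp: absv_def val_mult powr_add[symmetric])

lemma absv_le_1: "x \<in> K \<Longrightarrow> absv x \<le> 1"
  using prime_gt_1_nat[OF prime] val_nonneg[of x] powr_mono[of "- val x" 0 "real p"]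
  by (auto simp: absv_def)

lemma absv_nonneg: "absv x \<ge> 0" by (simp add: absv_def)

text \<open>One of the two quotients lies in \<open>K\<close>, so one summand can be factored out
  and leaves an element of \<open>K\<close>, of absolute value at most 1.\<close>

lemma absv_ultrametric: "absv (x + y) \<le> max (absv x) (absv y)"
proof -
  have *: "absv (x + y) \<le> absv x" if "x \<noteq> 0" "y * inverse x \<in> K" for x y
  proof -
    have "x + y = x * (1 + y * inverse x)" using that by (simp add: algebra_simps)
    hence "absv (x + y) = absv x * absv (1 + y * inverse x)" by (simp add: absv_mult)
    also have "\<dots> \<le> absv x * 1" using that by (intro mult_left_mono absv_le_1 absv_nonneg add one)
    finally show ?thesis by simp
  qed
  show ?thesis
  proof (cases "x = 0 \<or> y = 0")
    case False
    hence "x * inverse y \<in> K \<or> y * inverse x \<in> K" using valuation_ring[of "x * inverse y"] by (auto simp: mult.commute)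
    thus ?thesis using *[of x y] *[of y x] False by (auto simp: add.commute)
  qed (auto simp: absv_nonneg)
qed

lemma nonarchimedean_absv: "nonarchimedean_place_over p absv"
proof -
  have p: "real p > 0" using prime_gt_0_nat[OF prime] by simp
  have "absv (x + y) \<le> absv x + absv y" for x y
    using absv_ultrametric[of x y] absv_nonneg[of x] absv_nonneg[of y] by linarith
  moreover have "absv (of_nat p) = 1 / real p"
    using val_powi[of 1] p_nz p by (simp add: absv_def powr_minus inverse_eq_divide)
  ultimately show ?thesis
    unfolding nonarchimedean_place_over_def absolute_value_def
    using p absv_ultrametric absv_mult by (auto simp: absv_nonneg) (auto simp: absv_def split: if_splits)
qed

end

text \<open>Zorn's lemma, started at \<open>\<int>\<close>, yields the maximal subring. Only
  algebraicity is asked of the field, so the result applies directly to an algebraic closure of the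
  rationals.\<close>

theorem padic_absolute_value_exists:
  assumes p: "prime p" and alg: "\<And>x::'a::field_char_0. \<exists>f. f \<noteq> 0 \<and> rpoly f x = 0"
  obtains v :: "'a::field_char_0 \<Rightarrow> real" where "nonarchimedean_place_over p v"
proof -
  define F where "F = {A::'a set. subring_set A \<and> inverse (of_nat p) \<notin> A}"
  have "\<exists>M\<in>F. \<forall>Y\<in>F. M \<subseteq> Y \<longrightarrow> Y = M"
  proof (rule subset_Zorn_nonempty)
    have "subring_set (\<int> :: 'a set)" by unfold_locales auto
    moreover have "inverse (of_nat p) \<notin> (\<int> :: 'a set)"
    proof
      assume "inverse (of_nat p) \<in> (\<int> :: 'a set)"
      then obtain k where "inverse (of_nat p :: 'a) = of_int k" by (auto elim: Ints_cases)
      hence "of_int (k * int p) = (of_int 1 :: 'a)" using prime_gt_0_nat[OF p] by (simp add: field_simps)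
      hence "k * int p = 1" using of_int_eq_iff by blast
      thus False using prime_gt_1_nat[OF p] by (metis int_one_le_iff_zero_less mult.commute
        nat_int of_nat_1_eq_iff zmult_eq_1_iff order_less_irrefl zero_less_one of_nat_0_le_iff not_one_le_zero
        abs_of_nat zdvd1_eq dvd_triv_right)
    qed
    ultimately show "F \<noteq> {}" by (auto simp: F_def)
  next
    fix C assume C: "C \<noteq> {}" "subset.chain F C"
    have sub: "\<And>A. A \<in> C \<Longrightarrow> subring_set A \<and> inverse (of_nat p) \<notin> A"
      using C(2) by (auto simp: subset_chain_def F_def)
    have two: "\<exists>A\<in>C. x \<in> A \<and> y \<in> A" if "x \<in> \<Union>C" "y \<in> \<Union>C" for x y
      using that C(2) unfolding subset_chain_def by blast
    have "subring_set (\<Union>C)"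
    proof
      show "1 \<in> \<Union>C" using C(1) sub subring_set.one by blast
      fix x y assume "x \<in> \<Union>C" "y \<in> \<Union>C"
      then obtain A where "A \<in> C" "x \<in> A" "y \<in> A" using two by blast
      thus "x - y \<in> \<Union>C" "x * y \<in> \<Union>C" using sub subring_set.diff subring_set.mult by blast+
    qed
    thus "\<Union>C \<in> F" using sub by (auto simp: F_def)
  qed
  then obtain K where K0: "K \<in> F" "\<And>Y. Y \<in> F \<Longrightarrow> K \<subseteq> Y \<Longrightarrow> Y = K" by blast
  have K: "subring_set K" "inverse (of_nat p) \<notin> K"
    "\<And>Y. subring_set Y \<Longrightarrow> K \<subseteq> Y \<Longrightarrow> inverse (of_nat p) \<notin> Y \<Longrightarrow> Y = K"
    using K0 by (simp_all add: F_def)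
  interpret K: subring_set K by (rule K(1))
  interpret padic_maximal_subring K p
    by unfold_locales (use p K alg prime_gt_0_nat[OF p] in \<open>auto simp: K.of_nat\<close>)
  show ?thesis using that nonarchimedean_absv by blast
qed

section \<open>The product formula\<close>

text \<open>Explicit on the rationals, so that their product formula reduces to prime factorisation
  and all places over \<open>p\<close> extend one and the same function.\<close>

definition padic_abs :: "nat \<Rightarrow> rat \<Rightarrow> real"
  where "padic_abs p q = (if q = 0 then 0 else
    (1 / real p) ^ multiplicity p (nat \<bar>fst (quotient_of q)\<bar>) /
    (1 / real p) ^ multiplicity p (nat (snd (quotient_of q))))"

lemma rat_fraction:
  fixes q :: rat
  obtains a b where "quotient_of q = (a, b)" "q = of_int a / of_int b" "b > 0" "q \<noteq> 0 \<longleftrightarrow> a \<noteq> 0"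
proof -
  obtain a b where ab: "quotient_of q = (a, b)" by force
  thus ?thesis using that quotient_of_div[OF ab] quotient_of_denom_pos[OF ab] by auto
qed

section \<open>Nonarchimedean places on the rationals\<close>

locale nonarch_place = abs_val v for v :: "'a::field_char_0 \<Rightarrow> real" +
  fixes p :: nat
  assumes prime: "prime p" and ultrametric: "v (x + y) \<le> max (v x) (v y)"
    and v_p: "v (of_nat p) = 1 / real p"
begin

lemma p_gt_1: "real p > 1"
  using prime_gt_1_nat[OF prime] by simp

lemma sum_le_bound: "(\<And>i. i \<in> I \<Longrightarrow> v (f i) \<le> C) \<Longrightarrow> C \<ge> 0 \<Longrightarrow> v (sum f I) \<le> C"
proof (induction I rule: infinite_finite_induct)
  case (insert i I)
  thus ?case using ultrametric[of "f i" "sum f I"] by (auto intro: order_trans)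
qed auto

lemma of_nat_le_1: "v (of_nat k) \<le> 1"
proof (induction k)
  case (Suc k)
  thus ?case using ultrametric[of 1 "of_nat k"] by simp
qed simp

lemma of_int_le_1: "v (of_int k) \<le> 1"
  by (cases k rule: int_cases2) (simp_all add: of_nat_le_1)

lemma of_nat_coprime:
  assumes "\<not> p dvd k"
  shows "v (of_nat k) = 1"
proof (rule antisym[OF of_nat_le_1])
  have "coprime (int k) (int p)"
    using prime_imp_coprime[of "int p" "int k"] assms prime by (simp add: Rings.coprime_commute)
  then obtain s t where st: "s * int k + t * int p = 1" using bezout_int[of "int k" "int p"] by auto
  have "(of_int (s * int k + t * int p) :: 'a) = 1" using st by simp
  hence "1 \<le> max (v (of_int s * of_nat k)) (v (of_int t * of_nat p))"
    using ultrametric[of "of_int s * of_nat k" "of_int t * of_nat p"] by simp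
  also have "\<dots> \<le> max (v (of_nat k)) (1 / real p)"
    unfolding mult v_p
    using mult_right_mono[OF of_int_le_1[of s], of "v (of_nat k)"]
      mult_right_mono[OF of_int_le_1[of t], of "1 / real p"] by (auto simp: le_max_iff_disj max_def)
  finally show "1 \<le> v (of_nat k)" using p_gt_1 by (auto simp: le_max_iff_disj divide_simps)
qed

lemma of_nat_eq:
  assumes "k > 0"
  shows "v (of_nat k) = (1 / real p) ^ multiplicity p k"
proof -
  obtain d where d: "k = p ^ multiplicity p k * d" "\<not> p dvd d"
    using multiplicity_decompose'[of k p] assms prime by (metis not_prime_unit not_gr_zero)
  have "v (of_nat k) = v (of_nat p) ^ multiplicity p k * v (of_nat d)"
    by (subst d(1)) (simp add: mult power)
  thus ?thesis using of_nat_coprime[OF d(2)] v_p by simp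
qed

lemma of_rat_eq: "v (of_rat q) = padic_abs p q"
proof (cases "q = 0")
  case False
  obtain a b where ab: "quotient_of q = (a, b)" "q = of_int a / of_int b" "b > 0" "q \<noteq> 0 \<longleftrightarrow> a \<noteq> 0"
    by (rule rat_fraction)
  have "v (of_int k) = (1 / real p) ^ multiplicity p (nat \<bar>k\<bar>)" if "k \<noteq> 0" for k
    using of_nat_eq[of "nat \<bar>k\<bar>"] that by (cases k rule: int_cases2) simp_all
  from this[of a] this[of b] show ?thesis using False ab
    by (simp add: padic_abs_def of_rat_divide divide)
qed (simp add: padic_abs_def)

end

lemma nonarch_placeI:
  "prime p \<Longrightarrow> nonarchimedean_place_over p v \<Longrightarrow> nonarch_place v p"
  by unfold_locales (auto simp: nonarchimedean_place_over_def)

lemma sum_multiplicity_ln: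
  assumes "k > 0" "finite P" "\<And>p. p \<in> P \<Longrightarrow> prime p" "prime_factors k \<subseteq> P"
  shows "(\<Sum>p\<in>P. real (multiplicity p k) * ln (real p)) = ln (real k)"
proof -
  have "(\<Sum>p\<in>P. real (multiplicity p k) * ln (real p)) = (\<Sum>p\<in>prime_factors k. real (multiplicity p k) * ln (real p))"
    using assms by (intro sum.mono_neutral_right) (auto simp: prime_factors_multiplicity)
  also have "\<dots> = (\<Sum>p\<in>prime_factors k. ln (real p ^ multiplicity p k))"
    by (intro sum.cong) (auto simp: ln_realpow prime_gt_0_nat in_prime_factors_iff)
  also have "\<dots> = ln (\<Prod>p\<in>prime_factors k. real p ^ multiplicity p k)"
    by (intro ln_prod[symmetric]) (auto simp: prime_gt_0_nat in_prime_factors_iff)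
  also have "(\<Prod>p\<in>prime_factors k. real p ^ multiplicity p k) = real (\<Prod>p\<in>prime_factors k. p ^ multiplicity p k)"
    by simp
  also have "(\<Prod>p\<in>prime_factors k. p ^ multiplicity p k) = k"
    using assms(1) by (simp add: prime_factorization_nat[symmetric])
  finally show ?thesis .
qed

lemma finite_padic_abs_neq_1: "finite {p. prime p \<and> padic_abs p q \<noteq> 1 \<and> q \<noteq> 0}"
proof -
  obtain a b where ab: "quotient_of q = (a, b)" "q = of_int a / of_int b" "b > 0" "q \<noteq> 0 \<longleftrightarrow> a \<noteq> 0"
    by (rule rat_fraction)
  have "{p. prime p \<and> padic_abs p q \<noteq> 1 \<and> q \<noteq> 0} \<subseteq> prime_factors (nat \<bar>a\<bar>) \<union> prime_factors (nat b)"
  proof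
    fix p assume p: "p \<in> {p. prime p \<and> padic_abs p q \<noteq> 1 \<and> q \<noteq> 0}"
    hence "multiplicity p (nat \<bar>a\<bar>) > 0 \<or> multiplicity p (nat b) > 0"
      using ab(1) by (intro ccontr[of "_ \<or> _"]) (auto simp: padic_abs_def)
    thus "p \<in> prime_factors (nat \<bar>a\<bar>) \<union> prime_factors (nat b)"
      using p by (auto simp: prime_factors_multiplicity)
  qed
  thus ?thesis by (rule finite_subset) simp
qed

lemma rat_product_formula:
  assumes q: "q \<noteq> 0" and P: "finite P" "\<And>p. p \<in> P \<Longrightarrow> prime p"
    "\<And>p. prime p \<Longrightarrow> p \<notin> P \<Longrightarrow> padic_abs p q = 1"
  shows "ln \<bar>real_of_rat q\<bar> + (\<Sum>p\<in>P. ln (padic_abs p q)) = 0"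
proof -
  obtain a b where ab: "quotient_of q = (a, b)" "q = of_int a / of_int b" "b > 0" "q \<noteq> 0 \<longleftrightarrow> a \<noteq> 0"
    by (rule rat_fraction)
  define P' where "P' = P \<union> prime_factors (nat \<bar>a\<bar>) \<union> prime_factors (nat b)"
  have P': "finite P'" "\<And>p. p \<in> P' \<Longrightarrow> prime p"
    using P by (auto simp: P'_def in_prime_factors_iff)
  have "(\<Sum>p\<in>P. ln (padic_abs p q)) = (\<Sum>p\<in>P'. ln (padic_abs p q))"
  proof (rule sum.mono_neutral_left[OF P'(1)])
    show "P \<subseteq> P'" by (auto simp: P'_def)
    show "\<forall>p\<in>P' - P. ln (padic_abs p q) = 0" using P(3) P'(2) by simp
  qed
  also have "\<dots> = (\<Sum>p\<in>P'. real (multiplicity p (nat b)) * ln (real p)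
      - real (multiplicity p (nat \<bar>a\<bar>)) * ln (real p))"
  proof (intro sum.cong refl)
    fix p assume "p \<in> P'"
    hence "real p > 0" using P'(2) prime_gt_0_nat by simp
    thus "ln (padic_abs p q) = real (multiplicity p (nat b)) * ln (real p)
      - real (multiplicity p (nat \<bar>a\<bar>)) * ln (real p)"
      using q ab(1) by (simp add: padic_abs_def ln_div ln_realpow power_divide)
  qed
  also have "\<dots> = ln (real (nat b)) - ln (real (nat \<bar>a\<bar>))"
  proof -
    have 1: "prime_factors (nat b) \<subseteq> P'" "prime_factors (nat \<bar>a\<bar>) \<subseteq> P'"
      unfolding P'_def by blast+
    have 2: "nat b > 0" "nat \<bar>a\<bar> > 0" using ab q by simp_all
    show ?thesis
      by (simp only: sum_subtractf sum_multiplicity_ln[OF 2(1) P' 1(1)] sum_multiplicity_ln[OF 2(2) P' 1(2)])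
  qed
  also have "\<dots> = - ln \<bar>real_of_rat q\<bar>"
    using ab q by (simp add: of_rat_divide ln_div)
  finally show ?thesis by simp
qed

text \<open>The embedding \<open>to_ac\<close> of the rationals coincides with
  \<open>of_rat\<close>, which turns algebraicity over the base field into a statement on
  \<open>rpoly\<close>.\<close>

lemma rat_alg_closure_algebraic: "\<exists>f. f \<noteq> 0 \<and> rpoly f (x :: rat alg_closure) = 0"
proof -
  obtain f :: "rat poly" where f: "f \<noteq> 0" "poly (map_poly to_ac f) x = 0"
    by (rule alg_closure_algebraic)
  have "(of_rat q :: rat) = q" for q
    by (cases q) (simp add: of_rat_rat Fract_of_int_quotient)
  hence "to_ac (q :: rat) = of_rat q" for q
    using embedding_of_rat[OF embedding_to_ac[where ?'a = rat], of q] by simp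
  hence "to_ac = (of_rat :: rat \<Rightarrow> rat alg_closure)" by auto
  thus ?thesis using f by (auto simp: rpoly_def)
qed

section \<open>Places above infinity and above a prime\<close>

definition arch_places :: "('a::field_char_0 \<Rightarrow> real) set"
  where "arch_places = {v. archimedean_place v}"

definition places_over :: "nat \<Rightarrow> ('a::field_char_0 \<Rightarrow> real) set"
  where "places_over p = {v. nonarchimedean_place_over p v}"

lemma places_overD: "prime p \<Longrightarrow> v \<in> places_over p \<Longrightarrow> nonarch_place v p"
  by (rule nonarch_placeI) (simp_all add: places_over_def)

lemma arch_places_extending: "arch_places = extending (\<lambda>q. \<bar>real_of_rat q\<bar>)"
  by (auto simp: arch_places_def extending_def archimedean_place_def)

lemma places_over_subset_extending:
  assumes "prime p"
  shows "places_over p \<subseteq> extending (padic_abs p)"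
proof
  fix v :: "'a \<Rightarrow> real" assume "v \<in> places_over p"
  then interpret nonarch_place v p by (rule places_overD[OF assms])
  show "v \<in> extending (padic_abs p)"
    by (simp add: extending_def of_rat_eq absolute_value)
qed

text \<open>Read off from a place above \<open>p\<close> on the algebraic closure, whose value at
  \<open>p\<close> is prescribed.\<close>

lemma padic_abs_p: "prime p \<Longrightarrow> padic_abs p (of_nat p) = 1 / real p"
proof -
  assume p: "prime p"
  obtain w :: "rat alg_closure \<Rightarrow> real" where "nonarchimedean_place_over p w"
    using padic_absolute_value_exists[OF p rat_alg_closure_algebraic] by metis
  then interpret nonarch_place w p by (rule nonarch_placeI[OF p])
  show ?thesis using of_rat_eq[of "of_nat p"] v_p by simp
qed

context
  fixes \<theta> :: "'a::field_char_0"
  assumes nf: "number_field TYPE('a)" and \<theta>: "adjoin \<theta> = UNIV"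
begin

lemma arch_places_sum:
  assumes "a \<noteq> 0"
  shows "finite (arch_places :: ('a \<Rightarrow> real) set)"
    and "(\<Sum>v\<in>arch_places. real (local_degree v) * ln (v a)) = ln \<bar>real_of_rat (rat_norm \<theta> a)\<bar>"
    and "rat_norm \<theta> a \<noteq> 0"
    and "(\<Sum>v\<in>(arch_places :: ('a \<Rightarrow> real) set). local_degree v) = number_field_degree TYPE('a)"
proof -
  have w: "abs_val (cmod :: complex \<Rightarrow> real)"
    by (simp add: abs_val_def absolute_value_def norm_mult norm_triangle_ineq)
  have wq: "cmod (of_rat q) = \<bar>real_of_rat q\<bar>" for q
    by (cases q) (simp add: of_rat_rat norm_divide)
  have r: "0 < \<bar>real_of_rat (1/2)\<bar>" "\<bar>real_of_rat (1/2)\<bar> < 1" by (simp_all add: of_rat_divide)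
  note * = sum_local_degree_ln[OF nf \<theta> w wq r assms]
  show "finite (arch_places :: ('a \<Rightarrow> real) set)"
    and "(\<Sum>v\<in>arch_places. real (local_degree v) * ln (v a)) = ln \<bar>real_of_rat (rat_norm \<theta> a)\<bar>"
    and "rat_norm \<theta> a \<noteq> 0"
    and "(\<Sum>v\<in>(arch_places :: ('a \<Rightarrow> real) set). local_degree v) = number_field_degree TYPE('a)"
    unfolding arch_places_extending using * by auto
qed

lemma places_over_sum:
  assumes p: "prime p" and "a \<noteq> 0"
  shows "finite (places_over p :: ('a \<Rightarrow> real) set)"
    and "(\<Sum>v\<in>places_over p. real (local_degree v) * ln (v a)) = ln (padic_abs p (rat_norm \<theta> a))"
proof -
  obtain w :: "rat alg_closure \<Rightarrow> real" where "nonarchimedean_place_over p w"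
    using padic_absolute_value_exists[OF p rat_alg_closure_algebraic] by metis
  then interpret w: nonarch_place w p by (rule nonarch_placeI[OF p])
  have r: "0 < padic_abs p (of_nat p)" "padic_abs p (of_nat p) < 1"
    unfolding padic_abs_p[OF p] using w.p_gt_1 by (auto simp: divide_simps)
  note * = sum_local_degree_ln[OF nf \<theta> w.abs_val_axioms w.of_rat_eq r \<open>a \<noteq> 0\<close>]
  \<comment> \<open>Membership in \<open>extending\<close> only includes the triangle inequality;
    the ultrametric one is inherited from \<open>w\<close> through an embedding.\<close>
  have "places_over p = (extending (padic_abs p) :: ('a \<Rightarrow> real) set)"
  proof
    show "extending (padic_abs p) \<subseteq> (places_over p :: ('a \<Rightarrow> real) set)"
    proof
      fix v :: "'a \<Rightarrow> real" assume v: "v \<in> extending (padic_abs p)"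
      obtain \<sigma> :: "'a \<Rightarrow> rat alg_closure" where \<sigma>: "embedding \<sigma>" "v = w \<circ> \<sigma>" using *(5)[OF v] by blast
      thus "v \<in> places_over p"
        using v w.ultrametric w.v_p
        by (auto simp: places_over_def nonarchimedean_place_over_def extending_def
            embedding_add[OF \<sigma>(1)] embedding_of_nat[OF \<sigma>(1)])
    qed
  qed (rule places_over_subset_extending[OF p])
  thus "finite (places_over p :: ('a \<Rightarrow> real) set)"
    and "(\<Sum>v\<in>places_over p. real (local_degree v) * ln (v a)) = ln (padic_abs p (rat_norm \<theta> a))"
    using *(1,2) by simp_all
qed

end

text \<open>If \<open>v a > 1\<close>, the leading term would strictly exceed all other terms in the
  equation for \<open>a\<close>.\<close>

lemma (in nonarch_place) le_1_if_coeffs_units: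
  assumes f: "f \<noteq> 0" "rpoly f a = 0"
    and c: "\<And>i. coeff f i \<noteq> 0 \<Longrightarrow> padic_abs p (coeff f i) = 1"
  shows "v a \<le> 1"
proof (rule ccontr)
  assume gt: "\<not> v a \<le> 1"
  define m where "m = degree f"
  have ci: "v (of_rat (coeff f i)) \<le> 1" for i
    using c[of i] of_rat_eq[of "coeff f i"] by (cases "coeff f i = 0") auto
  have cm: "v (of_rat (coeff f m)) = 1"
    using c[of m] f(1) by (simp add: m_def of_rat_eq)
  have "{..m} = insert m {..<m}" by auto
  hence "of_rat (coeff f m) * a ^ m = - (\<Sum>i<m. of_rat (coeff f i) * a ^ i)"
    using f(2) unfolding rpoly_altdef m_def[symmetric] by (simp add: eq_neg_iff_add_eq_0)
  hence eq: "v a ^ m = v (\<Sum>i<m. of_rat (coeff f i) * a ^ i)"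
    using cm by (metis minus mult mult_1 power)
  show False
  proof (cases m)
    case 0
    thus False using eq by simp
  next
    case (Suc k)
    have "v (\<Sum>i<m. of_rat (coeff f i) * a ^ i) \<le> v a ^ k"
    proof (rule sum_le_bound)
      fix i assume "i \<in> {..<m}"
      hence "v a ^ i \<le> v a ^ k" using gt Suc by (intro power_increasing) auto
      thus "v (of_rat (coeff f i) * a ^ i) \<le> v a ^ k"
        unfolding mult power using mult_mono[OF ci[of i], of "v a ^ i" "v a ^ k"] by simp
    qed simp
    moreover have "v a ^ k < v a ^ m" using gt Suc power_strict_increasing[of k m "v a"] by simp
    ultimately show False using eq by simp
  qed
qed

section \<open>Finiteness and the product formula over a number field\<close>

lemma finite_bad_primes:
  assumes nf: "number_field TYPE('a::field_char_0)"
  shows "\<exists>P. finite P \<and> (\<forall>p v. prime p \<longrightarrow> p \<notin> P \<longrightarrow> v \<in> places_over p \<longrightarrow> v (a :: 'a) \<le> 1)"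
proof -
  obtain f where f: "min_poly a f" using min_poly_exists[OF nf] by blast
  define P where "P = (\<Union>i\<le>degree f.
    {p. prime p \<and> padic_abs p (coeff f i) \<noteq> 1 \<and> coeff f i \<noteq> 0})"
  have "v a \<le> 1" if p: "prime p" "p \<notin> P" "v \<in> places_over p" for p v
  proof -
    interpret nonarch_place v p by (rule places_overD[OF p(1,3)])
    have "padic_abs p (coeff f i) = 1" if "coeff f i \<noteq> 0" for i
      using p that le_degree[OF that] by (auto simp: P_def)
    thus ?thesis using f min_poly_root[OF f] le_1_if_coeffs_units by (auto simp: min_poly_def)
  qed
  moreover have "finite P" unfolding P_def using finite_padic_abs_neq_1 by auto
  ultimately show ?thesis by blast
qed

lemma places_eq: "places = arch_places \<union> (\<Union>p\<in>{p. prime p}. places_over p)"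
  by (auto simp: places_def arch_places_def places_over_def)

lemma places_over_disjoint:
  assumes "prime p" "prime q" "p \<noteq> q"
  shows "places_over p \<inter> (places_over q :: ('a::field_char_0 \<Rightarrow> real) set) = {}"
proof (rule ccontr)
  assume "places_over p \<inter> (places_over q :: ('a \<Rightarrow> real) set) \<noteq> {}"
  then obtain v :: "'a \<Rightarrow> real" where v: "v \<in> places_over p" "v \<in> places_over q" by blast
  interpret p: nonarch_place v p by (rule places_overD[OF assms(1) v(1)])
  interpret q: nonarch_place v q by (rule places_overD[OF assms(2) v(2)])
  have "\<not> p dvd q" using assms primes_dvd_imp_eq by blast
  hence "v (of_nat q) = 1" by (rule p.of_nat_coprime)
  thus False using q.v_p q.p_gt_1 by simp
qed

lemma arch_places_disjoint:
  assumes "prime p"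
  shows "arch_places \<inter> (places_over p :: ('a::field_char_0 \<Rightarrow> real) set) = {}"
proof (rule ccontr)
  assume "arch_places \<inter> (places_over p :: ('a \<Rightarrow> real) set) \<noteq> {}"
  then obtain v :: "'a \<Rightarrow> real" where v: "v \<in> arch_places" "v \<in> places_over p" by blast
  interpret p: nonarch_place v p by (rule places_overD[OF assms v(2)])
  have "v (of_rat (of_nat p)) = \<bar>real_of_rat (of_nat p)\<bar>"
    using v(1) unfolding arch_places_def archimedean_place_def by blast
  moreover have "1 / real p < 1" using p.p_gt_1 by simp
  ultimately show False using p.v_p p.p_gt_1 by simp
qed

text \<open>Away from the primes occurring in the minimal polynomials of \<open>a\<close> and
  \<open>inverse a\<close>, both are bounded by 1. The second claim keeps whole fibres over primes,
  because the norm only controls sums over complete fibres.\<close>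

theorem finite_places_neq_1:
  assumes nf: "number_field TYPE('a::field_char_0)" and a: "(a :: 'a) \<noteq> 0"
  shows "finite {v \<in> places. v a \<noteq> 1}"
    and "\<exists>P. finite P \<and> (\<forall>p\<in>P. prime p) \<and>
      (\<forall>v\<in>places. v a \<noteq> 1 \<longrightarrow> v \<in> arch_places \<union> (\<Union>p\<in>P. places_over p))"
proof -
  obtain \<theta> :: 'a where \<theta>: "adjoin \<theta> = UNIV" using primitive_element[OF nf] by blast
  obtain P1 where P1: "finite P1" "\<And>p v. prime p \<Longrightarrow> p \<notin> P1 \<Longrightarrow> v \<in> places_over p \<Longrightarrow> v a \<le> 1"
    using finite_bad_primes[OF nf] by metis
  obtain P2 where P2: "finite P2" "\<And>p v. prime p \<Longrightarrow> p \<notin> P2 \<Longrightarrow> v \<in> places_over p \<Longrightarrow> v (inverse a) \<le> 1"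
    using finite_bad_primes[OF nf] by metis
  define P where "P = {p \<in> P1 \<union> P2. prime p}"
  have P: "finite P" "\<forall>p\<in>P. prime p" using P1 P2 by (auto simp: P_def)
  have cover: "\<forall>v\<in>places. v a \<noteq> 1 \<longrightarrow> v \<in> arch_places \<union> (\<Union>p\<in>P. places_over p)"
  proof (intro ballI impI, rule ccontr)
    fix v :: "'a \<Rightarrow> real"
    assume v: "v \<in> places" "v a \<noteq> 1" "v \<notin> arch_places \<union> (\<Union>p\<in>P. places_over p)"
    then obtain p where p: "prime p" "v \<in> places_over p" "p \<notin> P" by (auto simp: places_eq)
    interpret nonarch_place v p by (rule places_overD[OF p(1,2)])
    have "v a \<le> 1" "v (inverse a) \<le> 1" using P1 P2 p by (auto simp: P_def)
    moreover have "v a > 0" using a by simp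
    ultimately have "v a = 1" by (simp add: inverse inverse_le_1_iff)
    thus False using v(2) by simp
  qed
  thus "\<exists>P. finite P \<and> (\<forall>p\<in>P. prime p) \<and>
      (\<forall>v\<in>places. v a \<noteq> 1 \<longrightarrow> v \<in> arch_places \<union> (\<Union>p\<in>P. places_over p))"
    using P by blast
  have "finite (arch_places \<union> (\<Union>p\<in>P. places_over p) :: ('a \<Rightarrow> real) set)"
    using arch_places_sum(1)[OF nf \<theta> a] places_over_sum(1)[OF nf \<theta> _ a] P by auto
  thus "finite {v \<in> places. v a \<noteq> 1}" by (rule rev_finite_subset) (use cover in auto)
qed

text \<open>Any finite \<open>W\<close> containing the places with \<open>v a \<noteq> 1\<close> is
  allowed, so that one set can later serve several elements at once.\<close>

theorem product_formula:
  assumes nf: "number_field TYPE('a::field_char_0)" and a: "(a :: 'a) \<noteq> 0"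
    and W: "finite W" "W \<subseteq> places" "\<And>v. v \<in> places \<Longrightarrow> v \<notin> W \<Longrightarrow> v a = 1"
  shows "(\<Sum>v\<in>W. real (local_degree v) * ln (v a)) = 0"
proof -
  obtain \<theta> :: 'a where \<theta>: "adjoin \<theta> = UNIV" using primitive_element[OF nf] by blast
  obtain P0 where P0: "finite P0" "\<forall>p\<in>P0. prime p"
    "\<forall>v\<in>places. v a \<noteq> 1 \<longrightarrow> v \<in> arch_places \<union> (\<Union>p\<in>P0. places_over p)"
    using finite_places_neq_1(2)[OF nf a] by blast
  define N where "N = rat_norm \<theta> a"
  have N: "N \<noteq> 0" unfolding N_def by (rule arch_places_sum(3)[OF nf \<theta> a])
  \<comment> \<open>Primes dividing the norm are added, so that the product formula over the
    rationals applies to \<open>N\<close> with the same set.\<close>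
  define P where "P = P0 \<union> {p. prime p \<and> padic_abs p N \<noteq> 1 \<and> N \<noteq> 0}"
  have P: "finite P" "\<And>p. p \<in> P \<Longrightarrow> prime p"
    using P0 finite_padic_abs_neq_1[of N] by (auto simp: P_def)
  define W0 :: "('a \<Rightarrow> real) set" where "W0 = arch_places \<union> (\<Union>p\<in>P. places_over p)"
  note fin = arch_places_sum(1)[OF nf \<theta> a] places_over_sum(1)[OF nf \<theta> P(2) a]
  have W0: "finite W0" "W0 \<subseteq> places" using fin P by (auto simp: W0_def places_eq)
  let ?f = "\<lambda>v::'a \<Rightarrow> real. real (local_degree v) * ln (v a)"
  have f0: "?f v = 0" if "v \<in> places" "v \<notin> W" for v using W(3)[OF that] by simp
  have f1: "?f v = 0" if v: "v \<in> places" "v \<notin> W0" for v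
  proof -
    have "v \<notin> arch_places \<union> (\<Union>p\<in>P0. places_over p)" using v(2) unfolding W0_def P_def by blast
    hence "v a = 1" using P0(3) v(1) by blast
    thus ?thesis by simp
  qed
  have "sum ?f W = sum ?f (W \<union> W0)"
    by (rule sum.mono_neutral_left) (use W(1) W0 f0 in blast)+
  also have "\<dots> = sum ?f W0"
    by (rule sum.mono_neutral_right) (use W(1,2) W0 f1 in blast)+
  also have "\<dots> = sum ?f arch_places + sum ?f (\<Union>p\<in>P. places_over p)"
    unfolding W0_def
    by (rule sum.union_disjoint) (use fin P arch_places_disjoint in \<open>blast+\<close>)
  also have "sum ?f (\<Union>p\<in>P. places_over p) = (\<Sum>p\<in>P. sum ?f (places_over p))"
    by (rule sum.UNION_disjoint) (use fin P places_over_disjoint in \<open>blast+\<close>)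
  also have "\<dots> = (\<Sum>p\<in>P. ln (padic_abs p N))"
    unfolding N_def by (intro sum.cong refl places_over_sum(2)[OF nf \<theta> P(2) a])
  also have "sum ?f arch_places = ln \<bar>real_of_rat N\<bar>"
    unfolding N_def by (rule arch_places_sum(2)[OF nf \<theta> a])
  also have "ln \<bar>real_of_rat N\<bar> + (\<Sum>p\<in>P. ln (padic_abs p N)) = 0"
    by (rule rat_product_formula[OF N P]) (use N in \<open>auto simp: P_def\<close>)
  finally show ?thesis .
qed

lemma
  assumes nf: "number_field TYPE('a::field_char_0)"
  shows finite_arch_places: "finite (arch_places :: ('a \<Rightarrow> real) set)"
    and sum_arch_local_degree:
      "(\<Sum>v\<in>(arch_places :: ('a \<Rightarrow> real) set). local_degree v) = number_field_degree TYPE('a)"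
proof -
  obtain \<theta> :: 'a where \<theta>: "adjoin \<theta> = UNIV" using primitive_element[OF nf] by blast
  note * = arch_places_sum[OF nf \<theta> one_neq_zero]
  show "finite (arch_places :: ('a \<Rightarrow> real) set)"
    "(\<Sum>v\<in>(arch_places :: ('a \<Rightarrow> real) set). local_degree v) = number_field_degree TYPE('a)"
    using *(1,4) by simp_all
qed

section \<open>Small values of polynomials at integers\<close>

text \<open>Up to sign, the distances from \<open>x0\<close> to all other points of the interval
  multiply to a product of two factorials dividing \<open>fact N\<close>. Integers have absolute
  value at most 1, so passing to a divisor or to fewer points can only increase the value.\<close>

lemma prod_differences_ge_nonarch:
  assumes "nonarch_place v p" "T \<subseteq> {A..A + int N} - {x0}" "x0 \<in> {A..A + int N}"
  shows "v (of_nat (fact N)) \<le> (\<Prod>x\<in>T. v (of_int (x - x0)))"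
proof -
  interpret nonarch_place v p by fact
  define a where "a = nat (x0 - A)"
  define b where "b = nat (A + int N - x0)"
  have ab: "int a = x0 - A" "int b = A + int N - x0" "a + b = N"
    using assms(3) by (auto simp: a_def b_def)
  have "(\<Prod>x\<in>{A..<x0}. v (of_int (x - x0))) = (\<Prod>k\<in>{1..a}. v (of_nat k))"
    by (rule prod.reindex_bij_witness[of _ "\<lambda>k. x0 - int k" "\<lambda>x. nat (x0 - x)"])
      (use ab minus_commute in \<open>auto simp: of_nat_nat minus_commute\<close>)
  hence 1: "(\<Prod>x\<in>{A..<x0}. v (of_int (x - x0))) = v (of_nat (fact a))"
    by (simp add: fact_prod prod)
  have "(\<Prod>x\<in>{x0<..A + int N}. v (of_int (x - x0))) = (\<Prod>k\<in>{1..b}. v (of_nat k))"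
    by (rule prod.reindex_bij_witness[of _ "\<lambda>k. x0 + int k" "\<lambda>x. nat (x - x0)"])
      (use ab in \<open>auto simp: of_nat_nat\<close>)
  hence 2: "(\<Prod>x\<in>{x0<..A + int N}. v (of_int (x - x0))) = v (of_nat (fact b))"
    by (simp add: fact_prod prod)
  have "fact N = fact a * fact b * (N choose a)"
  proof -
    have "a \<le> N" "N - a = b" using ab(3) by simp_all
    thus ?thesis using binomial_fact_lemma[of a N] by simp
  qed
  hence "v (of_nat (fact N)) = v (of_nat (fact a)) * v (of_nat (fact b)) * v (of_nat (N choose a))"
    by (simp only: of_nat_mult mult)
  also have "\<dots> \<le> v (of_nat (fact a)) * v (of_nat (fact b)) * 1"
    by (intro mult_left_mono of_nat_le_1 mult_nonneg_nonneg nonneg)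
  also have "\<dots> = (\<Prod>x\<in>{A..<x0} \<union> {x0<..A + int N}. v (of_int (x - x0)))"
  proof -
    have "(\<Prod>x\<in>{A..<x0} \<union> {x0<..A + int N}. v (of_int (x - x0)))
        = (\<Prod>x\<in>{A..<x0}. v (of_int (x - x0))) * (\<Prod>x\<in>{x0<..A + int N}. v (of_int (x - x0)))"
      by (rule prod.union_disjoint) auto
    thus ?thesis by (simp only: 1 2 mult_1_right)
  qed
  also have "\<dots> \<le> (\<Prod>x\<in>T. v (of_int (x - x0)))"
  proof -
    have U: "T \<subseteq> {A..<x0} \<union> {x0<..A + int N}" using assms(2) by auto
    have "(\<Prod>x\<in>{A..<x0} \<union> {x0<..A + int N}. v (of_int (x - x0)))
        = (\<Prod>x\<in>T. v (of_int (x - x0))) * (\<Prod>x\<in>({A..<x0} \<union> {x0<..A + int N}) - T. v (of_int (x - x0)))"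
      using prod.subset_diff[OF U, of "\<lambda>x. v (of_int (x - x0))"] by (simp add: mult.commute)
    also have "\<dots> \<le> (\<Prod>x\<in>T. v (of_int (x - x0))) * 1"
      by (intro mult_left_mono prod_le_1 prod_nonneg) (auto simp: of_int_le_1 simp del: of_int_diff)
    finally show ?thesis by simp
  qed
  finally show ?thesis .
qed

text \<open>
  Split off the point \<open>x0\<close> where the value is smallest: writing \<open>f = f(x0) + (X - x0) q\<close>, at all other
  points \<open>f(x0)\<close> is dominated, so that \<open>q\<close> is at most \<open>m(x) / |x - x0|\<close> there.
\<close>

lemma prod_values_ge_nonarch:
  assumes v: "nonarch_place v p" and "degree f \<le> d"
    and "\<And>i. v (coeff f i) \<le> 1" and "\<exists>i. v (coeff f i) = 1"
    and "T \<subseteq> {A..A + int N}"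
    and "\<And>x. x \<in> T \<Longrightarrow> v (poly f (of_int x)) \<le> m x" and "0 < \<kappa>" "\<kappa> \<le> 1"
    and "\<And>x. x \<in> T \<Longrightarrow> \<kappa> \<le> m x" and "\<And>x. x \<in> T \<Longrightarrow> m x \<le> 1"
  shows "(\<kappa> * v (of_nat (fact N))) ^ d \<le> (\<Prod>x\<in>T. m x)"
  using assms(2-)
proof (induction d arbitrary: f T m)
  interpret nonarch_place v p by fact
  case 0
  then obtain c where c: "f = [:c:]" by (auto elim: degree_eq_zeroE)
  obtain i where i: "v (coeff f i) = 1" using 0(3) by blast
  hence "coeff f i \<noteq> 0" by auto
  hence "i = 0" using c by (cases i) auto
  hence "v c = 1" using i c by simp
  hence "1 \<le> m x" if "x \<in> T" for x using 0(5)[OF that] c by simp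
  thus ?case by (simp add: prod_ge_1)
next
  interpret nonarch_place v p by fact
  case (Suc d)
  have finT: "finite T" using Suc.prems(4) finite_subset by blast
  have le1: "\<kappa> * v (of_nat (fact N)) \<le> 1"
    using mult_mono[OF Suc.prems(7) of_nat_le_1[of "fact N"]] by simp
  have nn: "0 \<le> \<kappa> * v (of_nat (fact N))" using Suc.prems(6) by simp
  show ?case
  proof (cases "\<exists>x\<in>T. m x < 1")
    case False
    hence "1 \<le> (\<Prod>x\<in>T. m x)" by (intro prod_ge_1) auto
    thus ?thesis using power_le_one[OF nn le1, of "Suc d"] by linarith
  next
    case True
    hence "T \<noteq> {}" by auto
    hence "Min (m ` T) \<in> m ` T" using finT by (intro Min_in) auto
    then obtain x0 where x0: "x0 \<in> T" "m x0 = Min (m ` T)" by auto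
    have min: "m x0 \<le> m x" if "x \<in> T" for x unfolding x0(2) using that finT by simp
    have m0: "m x0 < 1" using True min by fastforce
    define c where "c = (of_int x0 :: 'a)"
    define q where "q = synthetic_div f c"
    have fq: "[:- c, 1:] * q + [:poly f c:] = f" unfolding q_def by (rule synthetic_div_correct')
    have fc: "v (poly f c) \<le> m x0" using Suc.prems(5)[OF x0(1)] by (simp add: c_def)
    have cS: "coeff f (Suc i) = coeff q i - c * coeff q (Suc i)" for i
      by (subst fq[symmetric]) simp
    have c0: "coeff f 0 = poly f c - c * coeff q 0"
      by (subst fq[symmetric]) (simp add: fq)
    have vc: "v (c * y) \<le> v y" for y
      unfolding mult c_def using mult_right_mono[OF of_int_le_1[of x0], of "v y"] by simp
    have ultra_minus: "v (a - b) \<le> max (v a) (v b)" for a b using ultrametric[of a "-b"] by simp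
    have dq: "degree q \<le> d" using Suc.prems(1) by (simp add: q_def degree_synthetic_div)
    \<comment> \<open>Descending induction: a coefficient of the quotient is determined by one of
      \<open>f\<close> and by the next higher coefficient of the quotient. The claim at stage
      \<open>k\<close> covers all indices above \<open>degree q - k\<close>.\<close>
    have q1: "v (coeff q i) \<le> 1" for i
    proof -
      have "\<forall>i. degree q < i + k \<longrightarrow> v (coeff q i) \<le> 1" for k
      proof (induction k)
        case 0
        show ?case by (simp add: coeff_eq_0)
      next
        case (Suc k)
        show ?case
        proof (intro allI impI)
          fix i assume "degree q < i + Suc k"
          hence "v (coeff q (Suc i)) \<le> 1" using Suc.IH by simp
          moreover have "coeff q i = coeff f (Suc i) + c * coeff q (Suc i)" by (simp add: cS)
          ultimately show "v (coeff q i) \<le> 1"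
            using ultrametric[of "coeff f (Suc i)" "c * coeff q (Suc i)"] vc[of "coeff q (Suc i)"]
              \<open>\<And>i. v (coeff f i) \<le> 1\<close>[of "Suc i"] by (simp add: le_max_iff_disj max_def split: if_splits)
        qed
      qed
      from this[of "Suc (degree q)"] show ?thesis by simp
    qed
    \<comment> \<open>The value split off has absolute value below 1, so a unit coefficient of
      \<open>f\<close> has to come from \<open>q\<close>.\<close>
    have q_ex: "\<exists>i. v (coeff q i) = 1"
    proof (rule ccontr)
      assume "\<not> (\<exists>i. v (coeff q i) = 1)"
      hence lt: "v (coeff q i) < 1" for i using q1[of i] by (metis order_le_less)
      have "v (coeff f i) < 1" for i
      proof (cases i)
        case 0
        have "v (coeff f 0) \<le> max (v (poly f c)) (v (c * coeff q 0))"
          unfolding c0 by (rule ultra_minus)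
        also have "\<dots> < 1" using fc m0 vc[of "coeff q 0"] lt[of 0] by simp
        finally show ?thesis using 0 by simp
      next
        case (Suc j)
        have "v (coeff f (Suc j)) \<le> max (v (coeff q j)) (v (c * coeff q (Suc j)))"
          unfolding cS by (rule ultra_minus)
        also have "\<dots> < 1" using vc[of "coeff q (Suc j)"] lt[of j] lt[of "Suc j"] by simp
        finally show ?thesis using Suc by simp
      qed
      thus False using Suc.prems(3) by (metis less_irrefl)
    qed
    define T' where "T' = T - {x0}"
    define \<delta> where "\<delta> = (\<lambda>x. v (of_int (x - x0)))"
    \<comment> \<open>Capping at 1 restores the hypothesis \<open>m x \<le> 1\<close> for the
      induction; it is legitimate because \<open>q\<close> is bounded by 1 at integers too.\<close>
    define m' where "m' = (\<lambda>x. min 1 (m x / \<delta> x))"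
    have \<delta>: "0 < \<delta> x" "\<delta> x \<le> 1" if "x \<in> T'" for x
    proof -
      have "of_int (x - x0) \<noteq> (0::'a)" using that by (subst of_int_eq_0_iff) (auto simp: T'_def)
      thus "0 < \<delta> x" "\<delta> x \<le> 1" unfolding \<delta>_def by (simp_all only: pos_iff of_int_le_1 not_False_eq_True)
    qed
    have mpos: "0 < m x" if "x \<in> T" for x using Suc.prems(6) Suc.prems(8)[OF that] by linarith
    have IH: "(\<kappa> * v (of_nat (fact N))) ^ d \<le> (\<Prod>x\<in>T'. m' x)"
    proof (rule Suc.IH[OF dq q1 q_ex])
      show "T' \<subseteq> {A..A + int N}" using Suc.prems(4) by (auto simp: T'_def)
      fix x assume x: "x \<in> T'"
      hence xT: "x \<in> T" by (simp add: T'_def)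
      have "v (poly q (of_int x)) \<le> 1"
        unfolding poly_altdef
        by (rule sum_le_bound) (use q1 of_int_le_1 in \<open>auto simp: mult power intro!: mult_le_one power_le_one\<close>)
      moreover have "v (poly q (of_int x)) \<le> m x / \<delta> x"
      proof -
        have "poly f (of_int x) = poly ([:- c, 1:] * q + [:poly f c:]) (of_int x)" by (simp only: fq)
        also have "\<dots> = of_int (x - x0) * poly q (of_int x) + poly f c"
          by (simp add: c_def algebra_simps)
        finally have "of_int (x - x0) * poly q (of_int x) = poly f (of_int x) - poly f c" by simp
        hence "\<delta> x * v (poly q (of_int x)) \<le> max (v (poly f (of_int x))) (v (poly f c))"
          unfolding \<delta>_def mult[symmetric] by (simp only: ultra_minus)
        also have "\<dots> \<le> m x" using Suc.prems(5)[OF xT] fc min[OF xT] by simp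
        finally show ?thesis using \<delta>[OF x] by (simp add: field_simps)
      qed
      ultimately show "v (poly q (of_int x)) \<le> m' x" by (simp add: m'_def)
      have "m x \<le> m x / \<delta> x" using \<delta>[OF x] mpos[OF xT] by (simp add: field_simps)
      thus "\<kappa> \<le> m' x" using Suc.prems(7) Suc.prems(8)[OF xT] by (simp add: m'_def)
      show "m' x \<le> 1" by (simp add: m'_def)
    qed (use Suc.prems in auto)
    have \<delta>prod: "v (of_nat (fact N)) \<le> (\<Prod>x\<in>T'. \<delta> x)"
      unfolding \<delta>_def by (rule prod_differences_ge_nonarch[OF v]) (use Suc.prems(4) x0(1) in \<open>auto simp: T'_def\<close>)
    have \<delta>nonneg: "0 \<le> (\<Prod>x\<in>T'. \<delta> x)" by (rule prod_nonneg) (use \<delta> less_imp_le in blast)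
    have m'pos: "0 < m' x" if "x \<in> T'" for x
      using \<delta>[OF that] mpos[of x] that by (auto simp: m'_def T'_def)
    have "(\<kappa> * v (of_nat (fact N))) ^ Suc d = \<kappa> * (v (of_nat (fact N)) * (\<kappa> * v (of_nat (fact N))) ^ d)"
      by simp
    \<comment> \<open>The point \<open>x0\<close> pays \<open>\<kappa>\<close> and the distances to
      it pay \<open>fact N\<close>; this happens at most once per degree.\<close>
    also have "\<dots> \<le> m x0 * ((\<Prod>x\<in>T'. \<delta> x) * (\<Prod>x\<in>T'. m' x))"
    proof (intro mult_mono \<delta>prod IH)
      show "\<kappa> \<le> m x0" by (rule Suc.prems(8)[OF x0(1)])
    qed (use \<delta>nonneg less_imp_le[OF mpos[OF x0(1)]] nn in auto)
    also have "(\<Prod>x\<in>T'. \<delta> x) * (\<Prod>x\<in>T'. m' x) = (\<Prod>x\<in>T'. \<delta> x * m' x)" by (simp add: prod.distrib)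
    also have "m x0 * (\<Prod>x\<in>T'. \<delta> x * m' x) \<le> m x0 * (\<Prod>x\<in>T'. m x)"
    proof (intro mult_left_mono prod_mono conjI)
      fix x assume x: "x \<in> T'"
      show "0 \<le> \<delta> x * m' x" using \<delta>[OF x] m'pos[OF x] by simp
      have "\<delta> x * m' x \<le> \<delta> x * (m x / \<delta> x)" using \<delta>[OF x] by (intro mult_left_mono) (auto simp: m'_def)
      thus "\<delta> x * m' x \<le> m x" using \<delta>[OF x] by simp
    qed (use mpos[OF x0(1)] in simp)
    also have "m x0 * (\<Prod>x\<in>T'. m x) = (\<Prod>x\<in>T. m x)"
      unfolding T'_def using prod.remove[OF finT x0(1), of m] by simp
    finally show ?thesis .
  qed
qed

section \<open>Values at archimedean places\<close>

locale arch_place = abs_val v for v :: "'a::field_char_0 \<Rightarrow> real" +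
  assumes of_rat_eq: "v (of_rat q) = \<bar>real_of_rat q\<bar>"
begin

lemma of_int_eq: "v (of_int k) = \<bar>real_of_int k\<bar>"
  using of_rat_eq[of "of_int k"] by simp

lemma coeff_prod_linear_le:
  assumes "finite Y" "\<And>y. y \<in> Y \<Longrightarrow> v y \<le> M" "M \<ge> 0"
  shows "v (coeff (\<Prod>y\<in>Y. [:- y, 1:]) i) \<le> (1 + M) ^ card Y"
  using assms(1,2)
proof (induction Y arbitrary: i)
  case empty
  show ?case by (cases i) auto
next
  case (insert y Y)
  let ?p = "\<Prod>y\<in>Y. [:- y, 1:]"
  have IH: "v (coeff ?p j) \<le> (1 + M) ^ card Y" for j using insert by auto
  have nn: "0 \<le> (1 + M) ^ card Y" using assms(3) by simp
  have yp: "v (y * coeff ?p i) \<le> M * (1 + M) ^ card Y"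
    unfolding mult using insert.prems[of y] IH[of i] assms(3) by (intro mult_mono) auto
  have eq: "(\<Prod>y\<in>insert y Y. [:- y, 1:]) = [:- y, 1:] * ?p" using insert.hyps by simp
  have "v (coeff ([:- y, 1:] * ?p) i) \<le> (1 + M) ^ card Y + M * (1 + M) ^ card Y"
  proof (cases i)
    case 0
    thus ?thesis using yp nn by simp
  next
    case (Suc j)
    have e: "coeff ([:- y, 1:] * ?p) i = coeff ?p j - y * coeff ?p i" using Suc by simp
    show ?thesis unfolding e using triangle_minus[of "coeff ?p j" "y * coeff ?p i"] yp IH[of j] by linarith
  qed
  thus ?case unfolding eq using insert.hyps by (simp add: algebra_simps)
qed

text \<open>Otherwise \<open>f\<close> would be interpolated from \<open>d + 1\<close> tiny values.
  Distinct integer nodes are at distance at least 1, so the coefficients of the Lagrange basis are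
  at most \<open>(2 * M) ^ d\<close>, and no coefficient of \<open>f\<close> could reach 1.\<close>

lemma card_small_values_le:
  assumes f: "degree f \<le> d" "v (coeff f i) = 1"
    and T: "finite T" "\<And>x. x \<in> T \<Longrightarrow> \<bar>real_of_int x\<bar> \<le> M" and M: "M \<ge> 1"
  shows "card {x \<in> T. v (poly f (of_int x)) < 1 / ((real d + 1) * (2 * M) ^ d)} \<le> d"
proof (rule ccontr)
  let ?bad = "{x \<in> T. v (poly f (of_int x)) < 1 / ((real d + 1) * (2 * M) ^ d)}"
  assume "\<not> card ?bad \<le> d"
  hence "Suc d \<le> card ?bad" by simp
  then obtain U where U: "U \<subseteq> ?bad" "card U = Suc d" "finite U"
    by (rule obtain_subset_with_card_n)
  define Z where "Z = (of_int ` U :: 'a set)"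
  have Z: "finite Z" "card Z = Suc d" using U by (auto simp: Z_def card_image inj_on_def)
  have L: "v (coeff (lagrange_basis Z z) i) \<le> (2 * M) ^ d" if z: "z \<in> Z" for z
  proof -
    have card: "card (Z - {z}) = d" using Z z by simp
    have "1 \<le> v (z - y)" if "y \<in> Z - {z}" for y
    proof -
      obtain a b where ab: "z = of_int a" "y = of_int b" using z \<open>y \<in> Z - {z}\<close> by (auto simp: Z_def)
      hence "a \<noteq> b" using that by auto
      have "v (z - y) = \<bar>real_of_int (a - b)\<bar>" unfolding ab of_int_diff[symmetric] by (rule of_int_eq)
      thus ?thesis using \<open>a \<noteq> b\<close> by linarith
    qed
    hence "1 \<le> (\<Prod>y\<in>Z - {z}. v (z - y))" by (rule prod_ge_1)
    hence 1: "inverse (\<Prod>y\<in>Z - {z}. v (z - y)) \<le> 1" by (simp add: inverse_le_1_iff)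
    have "v (coeff (\<Prod>y\<in>Z - {z}. [:- y, 1:]) i) \<le> (1 + M) ^ card (Z - {z})"
    proof (rule coeff_prod_linear_le)
      fix y assume "y \<in> Z - {z}"
      then obtain b where "b \<in> U" "y = of_int b" by (auto simp: Z_def)
      thus "v y \<le> M" using T(2)[of b] U(1) by (auto simp: of_int_eq)
    qed (use Z M in auto)
    also have "\<dots> \<le> (2 * M) ^ d" unfolding card using M by (intro power_mono) auto
    finally have 2: "v (coeff (\<Prod>y\<in>Z - {z}. [:- y, 1:]) i) \<le> (2 * M) ^ d" .
    have "v (coeff (lagrange_basis Z z) i)
        = inverse (\<Prod>y\<in>Z - {z}. v (z - y)) * v (coeff (\<Prod>y\<in>Z - {z}. [:- y, 1:]) i)"
      by (simp add: lagrange_basis_def mult inverse prod)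
    also have "\<dots> \<le> 1 * (2 * M) ^ d" using 1 2 by (intro mult_mono) auto
    finally show ?thesis by simp
  qed
  have Mp: "(2 * M) ^ d > 0" using M by simp
  have "1 = v (coeff (\<Sum>z\<in>Z. smult (poly f z) (lagrange_basis Z z)) i)"
    using lagrange_interpolation[of Z f] Z f by simp
  also have "\<dots> \<le> (\<Sum>z\<in>Z. v (poly f z * coeff (lagrange_basis Z z) i))"
    using sum_le[of "\<lambda>z. poly f z * coeff (lagrange_basis Z z) i" Z] by (simp add: coeff_sum)
  also have "\<dots> < (\<Sum>z\<in>Z. 1 / ((real d + 1) * (2 * M) ^ d) * (2 * M) ^ d)"
  proof (rule sum_strict_mono)
    fix z assume z: "z \<in> Z"
    then obtain x where x: "x \<in> U" "z = of_int x" by (auto simp: Z_def)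
    have "v (poly f z * coeff (lagrange_basis Z z) i) \<le> v (poly f z) * (2 * M) ^ d"
      unfolding mult by (rule mult_left_mono[OF L[OF z]]) simp
    also have "\<dots> < 1 / ((real d + 1) * (2 * M) ^ d) * (2 * M) ^ d"
      using U(1) x Mp by (intro mult_strict_right_mono) auto
    finally show "v (poly f z * coeff (lagrange_basis Z z) i) < 1 / ((real d + 1) * (2 * M) ^ d) * (2 * M) ^ d" .
  qed (use Z in auto)
  also have "\<dots> = 1" using Z Mp M by simp
  finally show False by simp
qed

text \<open>At most \<open>d\<close> points fall below the interpolation threshold, and those are
  still bounded below by \<open>\<kappa>\<close>.\<close>

lemma prod_values_ge:
  assumes f: "degree f \<le> d" "v (coeff f i) = 1"
    and T: "finite T" "\<And>x. x \<in> T \<Longrightarrow> \<bar>real_of_int x\<bar> \<le> M" and M: "M \<ge> 1"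
    and m: "\<And>x. x \<in> T \<Longrightarrow> v (poly f (of_int x)) \<le> m x" "\<And>x. x \<in> T \<Longrightarrow> \<kappa> \<le> m x"
    and \<kappa>: "0 < \<kappa>" "\<kappa> \<le> 1"
  shows "\<kappa> ^ d * (1 / ((real d + 1) * (2 * M) ^ d)) ^ card T \<le> (\<Prod>x\<in>T. m x)"
proof -
  define b where "b = 1 / ((real d + 1) * (2 * M) ^ d)"
  define S where "S = {x \<in> T. v (poly f (of_int x)) < b}"
  have "1 * 1 \<le> (real d + 1) * (2 * M) ^ d" using M by (intro mult_mono one_le_power) auto
  hence b: "0 < b" "b \<le> 1" by (auto simp: b_def)
  have S: "S \<subseteq> T" "card S \<le> d" unfolding S_def b_def using card_small_values_le[OF f T M] by auto
  have "\<kappa> ^ d * b ^ card T \<le> \<kappa> ^ card S * b ^ card (T - S)"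
    using b \<kappa> S T(1) by (intro mult_mono power_decreasing card_mono) auto
  also have "\<dots> = (\<Prod>x\<in>S. \<kappa>) * (\<Prod>x\<in>T - S. b)" by simp
  also have "\<dots> \<le> (\<Prod>x\<in>S. m x) * (\<Prod>x\<in>T - S. m x)"
  proof (intro mult_mono prod_mono conjI)
    fix x assume "x \<in> T - S"
    thus "b \<le> m x" using m(1)[of x] by (auto simp: S_def)
  next
    show "0 \<le> (\<Prod>x\<in>S. m x)" using m(2) \<kappa>(1) S(1) by (intro prod_nonneg) (meson less_imp_le order_trans subsetD)
  qed (use b \<kappa> m(2) S(1) in \<open>auto intro!: prod_nonneg\<close>)
  also have "\<dots> = (\<Prod>x\<in>T. m x)" using prod.subset_diff[OF S(1) T(1), of m] by (simp add: mult.commute)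
  finally show ?thesis by (simp add: b_def)
qed

end

section \<open>Resultants\<close>

text \<open>A nonzero element of least degree in the ideal of \<open>p\<close> and \<open>q\<close>
  divides both.\<close>

lemma poly_bezout:
  fixes p q :: "'a::field poly"
  assumes cop: "coprime p q" and nz: "q \<noteq> 0"
  obtains u w where "u * p + w * q = 1"
proof -
  define J where "J = {u * p + w * q | u w. True}"
  have J: "a * g + b * h \<in> J" if "g \<in> J" "h \<in> J" for a b g h
  proof -
    obtain u w u' w' where "g = u * p + w * q" "h = u' * p + w' * q" using \<open>g \<in> J\<close> \<open>h \<in> J\<close> by (auto simp: J_def)
    hence "a * g + b * h = (a * u + b * u') * p + (a * w + b * w') * q" by (simp add: algebra_simps)
    thus ?thesis unfolding J_def by blast
  qed
  have pq: "p \<in> J" "q \<in> J"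
    unfolding J_def by (auto intro: exI[of _ 1] exI[of _ 0])
  obtain g where g: "g \<in> J \<and> g \<noteq> 0"
      "\<And>h. h \<in> J \<and> h \<noteq> 0 \<Longrightarrow> degree g \<le> degree h"
    using ex_has_least_nat[of "\<lambda>g. g \<in> J \<and> g \<noteq> 0" q degree] pq nz by blast
  have "g dvd h" if h: "h \<in> J" for h
  proof -
    have "1 * h + (- (h div g)) * g \<in> J" using J h g(1) by blast
    hence "h mod g \<in> J" by (simp add: minus_div_mult_eq_mod flip: minus_mult_left)
    hence "h mod g = 0" using g(2)[of "h mod g"] g(1) degree_mod_less'[of g h] by force
    thus ?thesis by auto
  qed
  hence "is_unit g" using cop pq coprime_common_divisor by blast
  then obtain k where "1 = g * k" by (auto elim: dvdE)
  moreover obtain u w where "g = u * p + w * q" using g(1) by (auto simp: J_def)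
  ultimately have "(k * u) * p + (k * w) * q = 1" by (simp add: algebra_simps)
  thus ?thesis using that by blast
qed

text \<open>Rows of the Sylvester matrix, kept as polynomials so that they can be evaluated at a
  point; column 0 holds their constant terms.\<close>

definition resultant_row :: "'a::comm_ring_1 poly \<Rightarrow> 'a poly \<Rightarrow> nat \<Rightarrow> 'a poly"
  where "resultant_row p q i = (let n = degree q in
    if i < n then monom 1 i * p else monom 1 (i - n) * q)"

definition resultant_mat :: "'a::comm_ring_1 poly \<Rightarrow> 'a poly \<Rightarrow> 'a mat"
  where "resultant_mat p q = (let e = degree p + degree q in
    mat e e (\<lambda>(i, j). coeff (resultant_row p q i) j))"

lemma degree_resultant_row:
  fixes p q :: "'a::idom poly"
  assumes "i < degree p + degree q"
  shows "degree (resultant_row p q i) < degree p + degree q"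
proof -
  have "degree (monom 1 k * f) \<le> k + degree f" for k and f :: "'a poly"
    using degree_mult_le[of "monom 1 k" f] degree_monom_le[of "1::'a" k] by linarith
  from this[of i p] this[of "i - degree q" q] assms show ?thesis
    by (auto simp: resultant_row_def Let_def)
qed

text \<open>A vector killed by the transpose is a relation \<open>u * p + t * q = 0\<close> with
  \<open>t\<close> of degree below that of \<open>p\<close>. Coprimality makes \<open>p\<close>
  divide \<open>t\<close>, so \<open>t\<close> and then \<open>u\<close> vanish.\<close>

lemma resultant_det_nonzero:
  fixes p q :: "'a::field poly"
  assumes cop: "coprime p q" and p: "p \<noteq> 0" and q: "q \<noteq> 0"
  shows "det (resultant_mat p q) \<noteq> 0"
proof
  let ?n = "degree q" and ?m = "degree p"
  define e where "e = ?m + ?n"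
  define A where "A = resultant_mat p q"
  have A: "A \<in> carrier_mat e e" by (simp add: A_def resultant_mat_def Let_def e_def)
  assume "det (resultant_mat p q) = 0"
  hence "det (transpose_mat A) = 0" using det_transpose[OF A] by (simp add: A_def)
  then obtain w where w: "w \<in> carrier_vec e" "w \<noteq> 0\<^sub>v e" "transpose_mat A *\<^sub>v w = 0\<^sub>v e"
    using det_0_iff_vec_prod_zero[of "transpose_mat A" e] A by auto
  define u where "u = (\<Sum>i<?n. monom (w $ i) i)"
  define t where "t = (\<Sum>i<?m. monom (w $ (?n + i)) i)"
  have "(\<Sum>i<e. smult (w $ i) (resultant_row p q i)) = 0"
  proof (rule poly_eqI)
    fix j
    show "coeff (\<Sum>i<e. smult (w $ i) (resultant_row p q i)) j = coeff 0 j"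
    proof (cases "j < e")
      case True
      have "(transpose_mat A *\<^sub>v w) $ j = (\<Sum>i = 0..<e. coeff (resultant_row p q i) j * w $ i)"
        using True w(1) A by (simp add: scalar_prod_def A_def resultant_mat_def Let_def e_def)
      thus ?thesis using w(3) True by (simp add: coeff_sum atLeast0LessThan mult.commute)
    next
      case False
      hence "coeff (resultant_row p q i) j = 0" if "i < e" for i
        using degree_resultant_row[of i p q] that by (intro coeff_eq_0) (simp add: e_def)
      thus ?thesis by (simp add: coeff_sum)
    qed
  qed
  also have "(\<Sum>i<e. smult (w $ i) (resultant_row p q i)) = u * p + t * q"
  proof -
    have "{..<e} = {..<?n} \<union> {?n..<?n + ?m}" by (auto simp: e_def)
    hence "(\<Sum>i<e. smult (w $ i) (resultant_row p q i))
        = (\<Sum>i<?n. smult (w $ i) (resultant_row p q i)) +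
          (\<Sum>i\<in>{?n..<?n + ?m}. smult (w $ i) (resultant_row p q i))"
      by (simp add: sum.union_disjoint ivl_disj_int)
    also have "(\<Sum>i<?n. smult (w $ i) (resultant_row p q i)) = u * p"
      by (simp add: u_def sum_distrib_right resultant_row_def smult_monom flip: mult_smult_left)
    also have "(\<Sum>i\<in>{?n..<?n + ?m}. smult (w $ i) (resultant_row p q i))
        = (\<Sum>i<?m. smult (w $ (?n + i)) (resultant_row p q (?n + i)))"
      by (rule sum.reindex_bij_witness[of _ "\<lambda>i. ?n + i" "\<lambda>i. i - ?n"]) auto
    also have "\<dots> = t * q"
      by (simp add: t_def sum_distrib_right resultant_row_def smult_monom flip: mult_smult_left)
    finally show ?thesis .
  qed
  finally have ut: "u * p + t * q = 0" .
  have du: "coeff u i = (if i < ?n then w $ i else 0)" for i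
    by (auto simp: u_def coeff_sum)
  have dt: "coeff t i = (if i < ?m then w $ (?n + i) else 0)" for i
    by (auto simp: t_def coeff_sum)
  obtain a b where ab: "a * p + b * q = 1" using poly_bezout[OF cop q] by blast
  have "t = t * (a * p + b * q)" using ab by simp
  also have "\<dots> = (t * a) * p + b * (t * q)" by (simp add: algebra_simps)
  also have "t * q = - (u * p)" using ut by (simp add: eq_neg_iff_add_eq_0 add.commute)
  finally have "t = (t * a - b * u) * p" by (simp add: algebra_simps)
  hence "p dvd t" by (metis dvd_triv_right)
  have t0: "t = 0"
  proof (rule ccontr)
    assume "t \<noteq> 0"
    hence "?m \<le> degree t" using dvd_imp_degree_le[OF \<open>p dvd t\<close>] by simp
    hence "coeff t (degree t) = 0" using dt by simp
    thus False using \<open>t \<noteq> 0\<close> by simp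
  qed
  hence "u = 0" using ut p by simp
  have "w $ i = 0" if "i < e" for i
  proof (cases "i < ?n")
    case True
    thus ?thesis using du[of i] \<open>u = 0\<close> by simp
  next
    case False
    hence "i - ?n < ?m" "?n + (i - ?n) = i" using that by (simp_all add: e_def)
    thus ?thesis using dt[of "i - ?n"] t0 by simp
  qed
  hence "w = 0\<^sub>v e" using w(1) by (intro eq_vecI) auto
  thus False using w(2) by simp
qed

section \<open>Sizes of determinants and of the resultant\<close>

context abs_val
begin

lemma of_sign [simp]: "v (of_int (sign \<tau>)) = 1"
  by (simp add: sign_def)

lemma det_summand_le:
  assumes "\<tau> permutes {0..<k}" "\<And>i j. i < k \<Longrightarrow> j < k \<Longrightarrow> v (B $$ (i, j)) \<le> G"
  shows "v (of_int (sign \<tau>) * (\<Prod>i = 0..<k. B $$ (i, \<tau> i))) \<le> G ^ k"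
proof -
  have "(\<Prod>i = 0..<k. v (B $$ (i, \<tau> i))) \<le> (\<Prod>i = 0..<k. G)"
    using assms permutes_in_image[OF assms(1)] by (intro prod_mono) auto
  thus ?thesis by (simp add: mult prod)
qed

lemma det_le:
  assumes B: "B \<in> carrier_mat k k" and "\<And>i j. i < k \<Longrightarrow> j < k \<Longrightarrow> v (B $$ (i, j)) \<le> G"
  shows "v (det B) \<le> fact k * G ^ k"
proof -
  have "v (det B) \<le> (\<Sum>\<tau> | \<tau> permutes {0..<k}. v (of_int (sign \<tau>) * (\<Prod>i = 0..<k. B $$ (i, \<tau> i))))"
    unfolding det_def'[OF B] by (rule sum_le)
  also have "\<dots> \<le> (\<Sum>\<tau> | \<tau> permutes {0..<k}. G ^ k)"
    using det_summand_le[OF _ assms(2)] by (intro sum_mono) auto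
  also have "\<dots> = fact k * G ^ k" by (simp add: card_permutations)
  finally show ?thesis .
qed

end

lemma (in nonarch_place) det_le_nonarch:
  assumes B: "B \<in> carrier_mat k k" and "\<And>i j. i < k \<Longrightarrow> j < k \<Longrightarrow> v (B $$ (i, j)) \<le> G" "G \<ge> 0"
  shows "v (det B) \<le> G ^ k"
  unfolding det_def'[OF B] using det_summand_le[OF _ assms(2)] assms(3)
  by (intro sum_le_bound) auto

text \<open>The cofactors of column 0 annihilate all other columns, so in the expansion the constant
  terms may be replaced by the values of the rows at \<open>x\<close>. These are multiples of the
  values of \<open>p\<close> and \<open>q\<close>.\<close>

lemma resultant_cofactor_expansion:
  fixes p q :: "'a::field poly"
  assumes e: "e = degree p + degree q" "e > 0"
  defines "A \<equiv> resultant_mat p q"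
  shows "det A = (\<Sum>i = 0..<e. cofactor A i 0 * poly (resultant_row p q i) x)"
proof -
  have A: "A \<in> carrier_mat e e" by (simp add: A_def resultant_mat_def Let_def e)
  have row: "poly (resultant_row p q i) x = (\<Sum>j = 0..<e. A $$ (i, j) * x ^ j)" if "i < e" for i
  proof -
    have "poly (resultant_row p q i) x = (\<Sum>j\<le>degree (resultant_row p q i). coeff (resultant_row p q i) j * x ^ j)"
      by (rule poly_altdef)
    also have "\<dots> = (\<Sum>j = 0..<e. coeff (resultant_row p q i) j * x ^ j)"
      using degree_resultant_row[of i p q] that e by (intro sum.mono_neutral_left) (auto simp: coeff_eq_0)
    finally show ?thesis using that by (simp add: A_def resultant_mat_def Let_def e)
  qed
  have adj: "(\<Sum>i = 0..<e. cofactor A i 0 * A $$ (i, j)) = (if j = 0 then det A else 0)" if "j < e" for j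
  proof -
    have "(adj_mat A * A) $$ (0, j) = (det A \<cdot>\<^sub>m 1\<^sub>m e) $$ (0, j)" using adj_mat(3)[OF A] by simp
    moreover have "(adj_mat A * A) $$ (0, j) = (\<Sum>i = 0..<e. cofactor A i 0 * A $$ (i, j))"
      using that e(2) A by (simp add: scalar_prod_def adj_mat_def)
    ultimately show ?thesis using that e(2) by auto
  qed
  have "(\<Sum>i = 0..<e. cofactor A i 0 * poly (resultant_row p q i) x)
      = (\<Sum>i = 0..<e. \<Sum>j = 0..<e. cofactor A i 0 * A $$ (i, j) * x ^ j)"
    using row by (simp add: sum_distrib_left mult.assoc)
  also have "\<dots> = (\<Sum>j = 0..<e. (\<Sum>i = 0..<e. cofactor A i 0 * A $$ (i, j)) * x ^ j)"
    by (subst sum.swap) (simp add: sum_distrib_right)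
  also have "\<dots> = (\<Sum>j = 0..<e. if j = 0 then det A else 0)"
    using adj by (intro sum.cong) auto
  also have "\<dots> = det A" using e(2) by simp
  finally show ?thesis by simp
qed

lemma coeff_resultant_row:
  "\<exists>k. coeff (resultant_row p q i) j \<in> {0, coeff p k, coeff q k}"
  unfolding resultant_row_def Let_def
  by (cases "i < degree q") (auto simp: coeff_monom_mult)

lemma (in abs_val) resultant_mat_le:
  fixes f g :: "'a poly"
  assumes "\<And>i. v (coeff f i) \<le> G" "\<And>i. v (coeff g i) \<le> G" "G \<ge> 0"
    and "i < degree f + degree g" "j < degree f + degree g"
  shows "v (resultant_mat f g $$ (i, j)) \<le> G"
  using coeff_resultant_row[of f g i j] assms by (auto simp: resultant_mat_def Let_def)

lemma poly_resultant_row_le: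
  fixes f g :: "'a::field_char_0 poly"
  assumes v: "abs_val v" and x: "v x \<le> M" "M \<ge> 1" and deg: "degree f \<le> d" "degree g \<le> d"
    and i: "i < degree f + degree g"
  shows "v (poly (resultant_row f g i) x) \<le> M ^ d * max (v (poly f x)) (v (poly g x))"
proof -
  interpret abs_val v by fact
  have pow: "v x ^ k \<le> M ^ d" if "k \<le> d" for k
    using power_mono[OF x(1), of k] power_increasing[OF that x(2)] by simp
  show ?thesis
  proof (cases "i < degree g")
    case True
    thus ?thesis using pow[of i] deg x
      by (auto simp: resultant_row_def Let_def poly_monom mult power intro!: mult_mono)
  next
    case False
    thus ?thesis using pow[of "i - degree g"] deg i x
      by (auto simp: resultant_row_def Let_def poly_monom mult power intro!: mult_mono)
  qed
qed

text \<open>The determinant bound \<open>C\<close> is a parameter because it is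
  \<open>G ^ (e - 1)\<close> at finite places and carries a factorial at archimedean ones.\<close>

lemma cofactor_le:
  assumes det: "\<And>B. B \<in> carrier_mat (e - 1) (e - 1) \<Longrightarrow>
      (\<And>i j. i < e - 1 \<Longrightarrow> j < e - 1 \<Longrightarrow> v (B $$ (i, j)) \<le> G) \<Longrightarrow> v (det B) \<le> C"
    and v: "abs_val v" and A: "A \<in> carrier_mat e e" "\<And>i j. i < e \<Longrightarrow> j < e \<Longrightarrow> v (A $$ (i, j)) \<le> G"
    and "i < e" "e > 0"
  shows "v (cofactor A i 0) \<le> C"
proof -
  interpret abs_val v by fact
  have "v (cofactor A i 0) = v (det (mat_delete A i 0))"
    unfolding cofactor_def by (simp add: mult power)
  also have "\<dots> \<le> C"
  proof (rule det)
    show "mat_delete A i 0 \<in> carrier_mat (e - 1) (e - 1)" using A(1) by (rule mat_delete_carrier)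
    fix k l assume "k < e - 1" "l < e - 1"
    thus "v (mat_delete A i 0 $$ (k, l)) \<le> G"
      using A by (auto simp: mat_delete_def)
  qed
  finally show ?thesis .
qed

text \<open>Cofactors of size \<open>G ^ (e - 1)\<close> keep \<open>p\<close> and \<open>q\<close>
  from being small simultaneously. \<open>R\<close> and \<open>e\<close> are fixed before
  \<open>v\<close>, so a single element serves all places. The last bound compares \<open>R\<close>
  with \<open>G ^ e\<close> at an archimedean place without reference to a point.\<close>

theorem resultant_bounds:
  fixes p q :: "'a::field_char_0 poly"
  assumes cop: "coprime p q" and q: "q \<noteq> 0" and deg: "degree p \<le> d" "degree q \<le> d" and d: "d \<ge> 1"
  obtains R e where "R \<noteq> 0" "e \<ge> 1" "e \<le> 2 * d"
    "\<And>v P x G. nonarch_place v P \<Longrightarrow> (\<And>i. v (coeff p i) \<le> G) \<Longrightarrow> (\<And>i. v (coeff q i) \<le> G) \<Longrightarrow>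
      v R \<le> G ^ (e - 1) * max (v (poly p (of_int x))) (v (poly q (of_int x)))"
    "\<And>v x M G. arch_place v \<Longrightarrow> (\<And>i. v (coeff p i) \<le> G) \<Longrightarrow> (\<And>i. v (coeff q i) \<le> G) \<Longrightarrow>
      \<bar>real_of_int x\<bar> \<le> M \<Longrightarrow> M \<ge> 1 \<Longrightarrow>
      v R \<le> fact (2 * d) * M ^ d * G ^ (e - 1) * max (v (poly p (of_int x))) (v (poly q (of_int x)))"
    "\<And>v G. arch_place v \<Longrightarrow> (\<And>i. v (coeff p i) \<le> G) \<Longrightarrow> (\<And>i. v (coeff q i) \<le> G) \<Longrightarrow>
      v R \<le> fact (2 * d) * G ^ e"
proof (cases "degree p + degree q = 0")
  case True
  then obtain c where c: "q = [:c:]" "c \<noteq> 0" using q by (metis add_is_0 degree_eq_zeroE pCons_eq_0_iff)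
  have f1: "(1::real) \<le> fact (2 * d)" by (rule fact_ge_1)
  show ?thesis
  \<comment> \<open>For two constants the Sylvester matrix is empty. The constant \<open>q\<close>
    takes the place of the resultant, with \<open>e = 1\<close> so that
    \<open>G ^ (e - 1) = 1\<close>.\<close>
  proof (rule that[of c 1])
    fix v :: "'a \<Rightarrow> real" and x M G
    assume v: "arch_place v" "\<bar>real_of_int x\<bar> \<le> M" "M \<ge> 1"
    interpret arch_place v by fact
    have "1 * 1 \<le> fact (2 * d) * M ^ d" using f1 v(3) by (intro mult_mono one_le_power) auto
    hence "1 * v c \<le> (fact (2 * d) * M ^ d) * max (v (poly p (of_int x))) (v c)"
      by (intro mult_mono) auto
    thus "v c \<le> fact (2 * d) * M ^ d * G ^ (1 - 1) * max (v (poly p (of_int x))) (v (poly q (of_int x)))"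
      by (simp add: c)
  next
    fix v :: "'a \<Rightarrow> real" and G
    assume v: "arch_place v" "\<And>i. v (coeff q i) \<le> G"
    interpret arch_place v by fact
    have "v c \<le> G" using v(2)[of 0] by (simp add: c)
    hence "1 * v c \<le> fact (2 * d) * G" using f1 by (intro mult_mono) auto
    thus "v c \<le> fact (2 * d) * G ^ 1" by simp
  qed (use c d in auto)
next
  case False
  define e where "e = degree p + degree q"
  have e: "e > 0" "e \<le> 2 * d" using False deg by (auto simp: e_def)
  have p: "p \<noteq> 0"
  proof
    assume "p = 0"
    hence "is_unit q" using cop by simp
    hence "degree q = 0" using is_unit_iff_degree[OF q] by simp
    thus False using False \<open>p = 0\<close> by simp
  qed
  define A where "A = resultant_mat p q"
  have A: "A \<in> carrier_mat e e" by (simp add: A_def resultant_mat_def Let_def e_def)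
  have "det A \<noteq> 0" unfolding A_def by (rule resultant_det_nonzero[OF cop p q])
  note expand = resultant_cofactor_expansion[OF e_def e(1), folded A_def]
  have mat_le: "v (A $$ (i, j)) \<le> G"
    if "abs_val v" "\<And>i. v (coeff p i) \<le> G" "\<And>i. v (coeff q i) \<le> G" "i < e" "j < e" for v i j and G :: real
  proof -
    interpret abs_val v by fact
    have "G \<ge> 0" using that(2)[of 0] nonneg order_trans by blast
    thus ?thesis unfolding A_def using that by (intro resultant_mat_le) (auto simp: e_def)
  qed
  have fact_le: "(fact e :: real) \<le> fact (2 * d)" using e(2) by (rule fact_mono)
  show ?thesis
  proof (rule that[of "det A" e])
    fix v :: "'a \<Rightarrow> real" and P x and G :: real
    assume v: "nonarch_place v P" and G: "\<And>i. v (coeff p i) \<le> G" "\<And>i. v (coeff q i) \<le> G"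
    interpret nonarch_place v P by fact
    have G0: "G \<ge> 0" using G(1)[of 0] nonneg order_trans by blast
    let ?m = "max (v (poly p (of_int x))) (v (poly q (of_int x)))"
    show "v (det A) \<le> G ^ (e - 1) * ?m"
      unfolding expand[of "of_int x"]
    proof (rule sum_le_bound)
      fix i assume i: "i \<in> {0..<e}"
      have "v (cofactor A i 0) \<le> G ^ (e - 1)"
        using i e G0 by (intro cofactor_le[OF det_le_nonarch abs_val_axioms A mat_le[OF abs_val_axioms G]]) auto
      moreover have "v (poly (resultant_row p q i) (of_int x)) \<le> 1 ^ d * ?m"
        using i of_int_le_1 deg by (intro poly_resultant_row_le[OF abs_val_axioms]) (auto simp: e_def)
      ultimately show "v (cofactor A i 0 * poly (resultant_row p q i) (of_int x)) \<le> G ^ (e - 1) * ?m"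
        unfolding mult using G0 by (intro mult_mono) auto
    qed (use G0 in \<open>auto simp: le_max_iff_disj\<close>)
  next
    fix v :: "'a \<Rightarrow> real" and x and M G :: real
    assume v: "arch_place v" and G: "\<And>i. v (coeff p i) \<le> G" "\<And>i. v (coeff q i) \<le> G"
      and M: "\<bar>real_of_int x\<bar> \<le> M" "M \<ge> 1"
    interpret arch_place v by fact
    have G0: "G \<ge> 0" using G(1)[of 0] nonneg order_trans by blast
    let ?m = "max (v (poly p (of_int x))) (v (poly q (of_int x)))"
    have m0: "?m \<ge> 0" by (simp add: le_max_iff_disj)
    have "v (det A) \<le> (\<Sum>i = 0..<e. v (cofactor A i 0 * poly (resultant_row p q i) (of_int x)))"
      unfolding expand[of "of_int x"] by (rule sum_le)
    also have "\<dots> \<le> (\<Sum>i = 0..<e. (fact (e - 1) * G ^ (e - 1)) * (M ^ d * ?m))"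
    proof (rule sum_mono)
      fix i assume i: "i \<in> {0..<e}"
      have "v (cofactor A i 0) \<le> fact (e - 1) * G ^ (e - 1)"
        using i e by (intro cofactor_le[OF det_le abs_val_axioms A mat_le[OF abs_val_axioms G]]) auto
      moreover have "v (poly (resultant_row p q i) (of_int x)) \<le> M ^ d * ?m"
        using i M deg by (intro poly_resultant_row_le[OF abs_val_axioms]) (auto simp: e_def of_int_eq)
      ultimately show "v (cofactor A i 0 * poly (resultant_row p q i) (of_int x)) \<le> (fact (e - 1) * G ^ (e - 1)) * (M ^ d * ?m)"
        unfolding mult using G0 by (intro mult_mono) auto
    qed
    \<comment> \<open>The number \<open>e\<close> of summands completes the factorial coming from
      the cofactors.\<close>
    also have "\<dots> = fact e * (M ^ d * G ^ (e - 1) * ?m)" using e(1) fact_reduce[of e, where 'a = real] by simp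
    also have "\<dots> \<le> fact (2 * d) * (M ^ d * G ^ (e - 1) * ?m)"
      using fact_le M G0 m0 by (intro mult_right_mono mult_nonneg_nonneg) auto
    finally show "v (det A) \<le> fact (2 * d) * M ^ d * G ^ (e - 1) * ?m" by (simp add: mult.assoc)
  next
    fix v :: "'a \<Rightarrow> real" and G :: real
    assume v: "arch_place v" and G: "\<And>i. v (coeff p i) \<le> G" "\<And>i. v (coeff q i) \<le> G"
    interpret arch_place v by fact
    have G0: "G \<ge> 0" using G(1)[of 0] nonneg order_trans by blast
    have "v (det A) \<le> fact e * G ^ e"
      using mat_le[OF abs_val_axioms G] by (intro det_le[OF A]) auto
    also have "\<dots> \<le> fact (2 * d) * G ^ e" using fact_le G0 by (intro mult_right_mono) auto
    finally show "v (det A) \<le> fact (2 * d) * G ^ e" .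
  qed (use e \<open>det A \<noteq> 0\<close> in auto)
qed

section \<open>Heights of values and of coefficients\<close>

text \<open>A denominator of least degree leaves no common factor to cancel.\<close>

lemma quot_repr_exists:
  fixes F :: "'a::field_char_0 poly fract"
  shows "\<exists>PQ. snd PQ \<noteq> 0 \<and> coprime (fst PQ) (snd PQ) \<and> F = Fract (fst PQ) (snd PQ)"
proof -
  define S where "S = {PQ. snd PQ \<noteq> 0 \<and> F = Fract (fst PQ) (snd PQ)}"
  obtain p0 q0 where "F = Fract p0 q0" "q0 \<noteq> 0" by (cases F) auto
  hence "(p0, q0) \<in> S" by (simp add: S_def)
  then obtain PQ where PQ: "PQ \<in> S" "\<And>y. y \<in> S \<Longrightarrow> degree (snd PQ) \<le> degree (snd y)"
    using ex_has_least_nat[of "\<lambda>y. y \<in> S" "(p0, q0)" "\<lambda>y. degree (snd y)"] by blast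
  obtain p q where pq: "PQ = (p, q)" by force
  have q: "q \<noteq> 0" "F = Fract p q" using PQ(1) pq by (auto simp: S_def)
  have "coprime p q"
  proof (rule coprimeI)
    fix g assume "g dvd p" "g dvd q"
    then obtain p' q' where pq': "p = g * p'" "q = g * q'" by (auto elim!: dvdE)
    hence nz: "g \<noteq> 0" "q' \<noteq> 0" using q by auto
    hence "F = Fract p' q'" using q by (simp add: pq' eq_fract)
    hence "(p', q') \<in> S" using nz by (simp add: S_def)
    hence "degree q \<le> degree q'" using PQ(2) pq by fastforce
    hence "degree g = 0" using nz by (simp add: pq' degree_mult_eq)
    thus "is_unit g" using nz by (simp add: is_unit_iff_degree)
  qed
  thus ?thesis using q by (intro exI[of _ "(p, q)"]) simp
qed

lemma
  shows ratfun_den_nonzero: "ratfun_den F \<noteq> 0"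
    and ratfun_coprime: "coprime (ratfun_num F) (ratfun_den F)"
  using someI_ex[OF quot_repr_exists[of F]] by (simp_all add: ratfun_num_def ratfun_den_def quot_repr_def)

section \<open>Weighted sums over places\<close>

lemma infsum_places:
  assumes "finite W" "W \<subseteq> places" "\<And>v. v \<in> places \<Longrightarrow> v \<notin> W \<Longrightarrow> f v = (0::real)"
  shows "infsum f places = sum f W"
proof -
  have "infsum f places = infsum f W" using assms by (intro infsum_cong_neutral) auto
  thus ?thesis using assms(1) by simp
qed

lemma number_field_degree_pos:
  assumes "number_field TYPE('a::field_char_0)"
  shows "number_field_degree TYPE('a) > 0"
proof -
  obtain f where "min_poly (0 :: 'a) f" "degree f \<le> number_field_degree TYPE('a)"
    using min_poly_exists[OF assms] by blast
  thus ?thesis using min_poly_degree_pos by fastforce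
qed

definition weight :: "('a::field_char_0 \<Rightarrow> real) \<Rightarrow> real"
  where "weight v = real (local_degree v) / real (number_field_degree TYPE('a))"

lemma weight_nonneg [simp]: "0 \<le> weight v"
  by (simp add: weight_def)

lemma sum_weight_ln:
  assumes nf: "number_field TYPE('a::field_char_0)" and "(a :: 'a) \<noteq> 0"
    and W: "finite W" "W \<subseteq> places" "\<And>v. v \<in> places \<Longrightarrow> v \<notin> W \<Longrightarrow> v a = 1"
  shows "(\<Sum>v\<in>W. weight v * ln (v a)) = 0"
proof -
  have "(\<Sum>v\<in>W. real (local_degree v) * ln (v a)) = 0"
    by (rule product_formula[OF nf assms(2) W(1,2)]) (rule W(3))
  thus ?thesis by (simp add: weight_def flip: sum_divide_distrib)
qed

lemma sum_arch_weight:
  assumes nf: "number_field TYPE('a::field_char_0)"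
  shows "(\<Sum>v\<in>(arch_places :: ('a \<Rightarrow> real) set). weight v) = 1"
  using sum_arch_local_degree[OF nf] number_field_degree_pos[OF nf]
  by (simp add: weight_def flip: sum_divide_distrib of_nat_sum)

text \<open>The archimedean places have total weight 1 and take the value \<open>k\<close>, so by
  the product formula the finite places contribute the opposite. With \<open>k = fact N\<close> this
  evaluates the factorial losses.\<close>

lemma sum_nonarch_weight_ln_nat:
  assumes nf: "number_field TYPE('a::field_char_0)" and "k > 0"
    and W: "finite W" "W \<subseteq> places" "arch_places \<subseteq> W" "\<And>v. v \<in> places \<Longrightarrow> v \<notin> W \<Longrightarrow> v (of_nat k :: 'a) = 1"
  shows "(\<Sum>v\<in>W - arch_places. weight v * ln (v (of_nat k))) = - ln (real k)"
proof -
  have "(\<Sum>v\<in>arch_places. weight v * ln (v (of_nat k :: 'a))) = (\<Sum>v\<in>(arch_places :: ('a \<Rightarrow> real) set). weight v * ln (real k))"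
  proof (intro sum.cong refl)
    fix v :: "'a \<Rightarrow> real" assume "v \<in> arch_places"
    hence "v (of_rat (of_nat k)) = \<bar>real_of_rat (of_nat k)\<bar>"
      unfolding arch_places_def archimedean_place_def by blast
    thus "weight v * ln (v (of_nat k)) = weight v * ln (real k)" by simp
  qed
  also have "\<dots> = ln (real k)" using sum_arch_weight[OF nf] by (simp flip: sum_distrib_right)
  finally have "(\<Sum>v\<in>arch_places. weight v * ln (v (of_nat k :: 'a))) = ln (real k)" .
  moreover have "(\<Sum>v\<in>W. weight v * ln (v (of_nat k))) = 0"
    by (rule sum_weight_ln[OF nf _ W(1,2)]) (use assms(2) W(4) in simp_all)
  ultimately show ?thesis
    using sum.subset_diff[OF W(3,1), of "\<lambda>v. weight v * ln (v (of_nat k))"] by simp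
qed

text \<open>At a given place it suffices to follow whichever of \<open>p\<close> and
  \<open>q\<close> has a coefficient of size \<open>G\<close>: its values bound the maximum of the
  two from below.\<close>

lemma (in abs_val) normalised_max_coeff:
  fixes p q :: "'a poly"
  assumes le: "\<And>i. v (coeff p i) \<le> G" "\<And>i. v (coeff q i) \<le> G"
    and ex: "(\<exists>i. v (coeff p i) = G) \<or> (\<exists>i. v (coeff q i) = G)" and G: "G > 0"
    and deg: "degree p \<le> d" "degree q \<le> d"
  obtains f i where "degree f \<le> d" "\<And>j. v (coeff f j) \<le> 1" "v (coeff f i) = 1"
    "\<And>x. v (poly f x) \<le> max (v (poly p x)) (v (poly q x)) / G"
proof -
  obtain g i where g: "g \<in> {p, q}" "v (coeff g i) = G" using ex by blast
  define f where "f = smult (inverse (coeff g i)) g"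
  show ?thesis
  proof (rule that[of f i])
    show "degree f \<le> d"
      unfolding f_def using deg g(1) by (auto intro: order_trans[OF degree_smult_le])
    show "v (coeff f j) \<le> 1" for j
      using le[of j] g G by (auto simp: f_def mult inverse divide field_simps)
    show "v (coeff f i) = 1" using g(2) G by (simp add: f_def mult inverse)
    show "v (poly f x) \<le> max (v (poly p x)) (v (poly q x)) / G" for x
      using g G by (auto simp: f_def mult inverse divide divide_simps)
  qed
qed

text \<open>The function \<open>m x / G\<close> majorises the normalised polynomial and, by the
  resultant, is at least \<open>\<kappa> = v R / G ^ e\<close> at every point. The estimate for
  products then turns into sums by taking logarithms.\<close>

lemma nonarch_loss:
  fixes p q :: "'a::field_char_0 poly"
  assumes v: "nonarch_place v P"
    and le: "\<And>i. v (coeff p i) \<le> G" "\<And>i. v (coeff q i) \<le> G"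
    and ex: "(\<exists>i. v (coeff p i) = G) \<or> (\<exists>i. v (coeff q i) = G)" and G: "G > 0"
    and deg: "degree p \<le> d" "degree q \<le> d"
    and T: "T \<subseteq> {a..a + int N}" "T \<noteq> {}" "\<And>x. x \<in> T \<Longrightarrow> poly q (of_int x) \<noteq> 0"
    and R: "R \<noteq> 0" "e \<ge> 1" "\<And>x. v R \<le> G ^ (e - 1) * max (v (poly p (of_int x))) (v (poly q (of_int x)))"
  shows "(\<Sum>x\<in>T. ln G - ln (max (v (poly p (of_int x))) (v (poly q (of_int x)))))
    \<le> real d * (real e * ln G - ln (v R)) - real d * ln (v (of_nat (fact N)))"
proof -
  interpret nonarch_place v P by fact
  define m where "m = (\<lambda>x. max (v (poly p (of_int x))) (v (poly q (of_int x))))"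
  define \<kappa> where "\<kappa> = v R / G ^ e"
  obtain f i where f: "degree f \<le> d" "\<And>j. v (coeff f j) \<le> 1" "v (coeff f i) = 1"
    "\<And>x. v (poly f x) \<le> max (v (poly p x)) (v (poly q x)) / G"
    using normalised_max_coeff[OF le ex G deg] by metis
  have finT: "finite T" using T(1) finite_subset by blast
  have mpos: "0 < m x" if "x \<in> T" for x using T(3)[OF that] by (simp add: m_def less_max_iff_disj)
  have mG0: "0 < m x / G" if "x \<in> T" for x using mpos[OF that] G by simp
  have \<kappa>0: "0 < \<kappa>" using R(1) G by (simp add: \<kappa>_def)
  have \<kappa>m: "\<kappa> \<le> m x / G" for x
  proof -
    have "G ^ e = G ^ (e - 1) * G" using R(2) by (cases e) auto
    thus ?thesis using R(3)[of x] G by (simp add: \<kappa>_def m_def field_simps)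
  qed
  have mG: "m x \<le> G" for x
  proof -
    have "v (poly g (of_int x)) \<le> G" if "\<And>i. v (coeff g i) \<le> G" for g
      unfolding poly_altdef
    proof (rule sum_le_bound)
      fix i
      have "v (coeff g i) * v (of_int x) ^ i \<le> G * 1"
        using that G of_int_le_1[of x] by (intro mult_mono power_le_one) auto
      thus "v (coeff g i * of_int x ^ i) \<le> G" by (simp add: mult power)
    qed (use G in simp)
    thus ?thesis using le by (simp add: m_def)
  qed
  have m1: "m x / G \<le> 1" for x using mG G by (simp add: divide_le_eq)
  have \<kappa>1: "\<kappa> \<le> 1" using order_trans[OF \<kappa>m m1] .
  have fact0: "0 < v (of_nat (fact N))" by simp
  have "(\<kappa> * v (of_nat (fact N))) ^ d \<le> (\<Prod>x\<in>T. m x / G)"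
    by (rule prod_values_ge_nonarch[OF v f(1,2) _ T(1) _ \<kappa>0 \<kappa>1 \<kappa>m m1])
      (use f(3,4) in \<open>auto simp: m_def\<close>)
  hence "ln ((\<kappa> * v (of_nat (fact N))) ^ d) \<le> ln (\<Prod>x\<in>T. m x / G)"
    by (subst ln_le_cancel_iff[OF _ prod_pos[OF mG0]]) (use \<kappa>0 fact0 in simp_all)
  also have "ln (\<Prod>x\<in>T. m x / G) = (\<Sum>x\<in>T. ln (m x / G))"
    by (rule ln_prod) (use finT mG0 less_imp_neq[OF mG0] in \<open>fastforce+\<close>)
  also have "\<dots> = (\<Sum>x\<in>T. ln (m x) - ln G)"
  proof (intro sum.cong refl)
    fix x assume "x \<in> T"
    hence "0 < m x" by (rule mpos)
    thus "ln (m x / G) = ln (m x) - ln G" using G by (simp add: ln_div)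
  qed
  also have "\<dots> = - (\<Sum>x\<in>T. ln G - ln (m x))" by (simp flip: sum_negf)
  also have "ln ((\<kappa> * v (of_nat (fact N))) ^ d) = real d * (ln (v R) - real e * ln G + ln (v (of_nat (fact N))))"
    using \<kappa>0 fact0 G R(1) by (simp add: ln_realpow ln_mult \<kappa>_def ln_div)
  finally show ?thesis by (simp add: m_def algebra_simps)
qed

text \<open>Two defects appear compared with finite places: the factor
  \<open>fact (2 * d) * M ^ d\<close> in \<open>\<kappa>\<close>, paid by at most \<open>d\<close>
  points, and the threshold \<open>b\<close>, paid by every point. The latter produces the terms d
  log(2M) + log(d + 1) of the final bound.\<close>

lemma arch_loss:
  fixes p q :: "'a::field_char_0 poly"
  assumes v: "arch_place v"
    and le: "\<And>i. v (coeff p i) \<le> G" "\<And>i. v (coeff q i) \<le> G"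
    and ex: "(\<exists>i. v (coeff p i) = G) \<or> (\<exists>i. v (coeff q i) = G)" and G: "G > 0"
    and deg: "degree p \<le> d" "degree q \<le> d"
    and T: "finite T" "\<And>x. x \<in> T \<Longrightarrow> \<bar>real_of_int x\<bar> \<le> M" "\<And>x. x \<in> T \<Longrightarrow> poly q (of_int x) \<noteq> 0"
    and M: "M \<ge> 1"
    and R: "R \<noteq> 0" "e \<ge> 1" "\<And>x. x \<in> T \<Longrightarrow>
        v R \<le> fact (2 * d) * M ^ d * G ^ (e - 1) * max (v (poly p (of_int x))) (v (poly q (of_int x)))"
      "v R \<le> fact (2 * d) * G ^ e"
  shows "(\<Sum>x\<in>T. ln G - ln (max (v (poly p (of_int x))) (v (poly q (of_int x)))))
    \<le> real d * (real e * ln G - ln (v R)) + real d * (ln (fact (2 * d)) + real d * ln M)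
      + real (card T) * (real d * ln (2 * M) + ln (real d + 1))"
proof -
  interpret arch_place v by fact
  define m where "m = (\<lambda>x. max (v (poly p (of_int x))) (v (poly q (of_int x))))"
  define C where "C = fact (2 * d) * M ^ d"
  define \<kappa> where "\<kappa> = v R / (C * G ^ e)"
  define b where "b = 1 / ((real d + 1) * (2 * M) ^ d)"
  obtain f i where f: "degree f \<le> d" "\<And>j. v (coeff f j) \<le> 1" "v (coeff f i) = 1"
    "\<And>x. v (poly f x) \<le> max (v (poly p x)) (v (poly q x)) / G"
    using normalised_max_coeff[OF le ex G deg] by metis
  have C: "C > 0" using M by (simp add: C_def)
  have mpos: "0 < m x" if "x \<in> T" for x using T(3)[OF that] by (simp add: m_def less_max_iff_disj)
  have mG0: "0 < m x / G" if "x \<in> T" for x using mpos[OF that] G by simp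
  have \<kappa>0: "0 < \<kappa>" using R(1) G C by (simp add: \<kappa>_def)
  have \<kappa>m: "\<kappa> \<le> m x / G" if "x \<in> T" for x
  proof -
    have "G ^ e = G ^ (e - 1) * G" using R(2) by (cases e) auto
    moreover have "v R \<le> C * G ^ (e - 1) * m x" using R(3)[OF that] by (simp add: C_def m_def)
    ultimately show ?thesis using G C by (simp add: \<kappa>_def field_simps)
  qed
  \<comment> \<open>At finite places \<open>\<kappa> \<le> 1\<close> follows from
    \<open>m x \<le> G\<close>; here the values may exceed \<open>G\<close>, so it is derived from
    the bound on \<open>R\<close> free of \<open>x\<close>.\<close>
  have "fact (2 * d) * 1 \<le> C" unfolding C_def using M by (intro mult_left_mono one_le_power) auto
  hence "fact (2 * d) * G ^ e \<le> C * G ^ e" using G by (intro mult_right_mono) auto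
  hence "v R \<le> C * G ^ e" using R(4) by linarith
  hence \<kappa>1: "\<kappa> \<le> 1" using C G by (simp add: \<kappa>_def divide_le_eq)
  have b: "b > 0" using M by (simp add: b_def)
  have "\<kappa> ^ d * b ^ card T \<le> (\<Prod>x\<in>T. m x / G)"
    unfolding b_def
    by (rule prod_values_ge[OF f(1,3) T(1,2) M _ \<kappa>m \<kappa>0 \<kappa>1]) (use f(4) in \<open>auto simp: m_def\<close>)
  hence "ln (\<kappa> ^ d * b ^ card T) \<le> ln (\<Prod>x\<in>T. m x / G)"
    by (subst ln_le_cancel_iff[OF _ prod_pos[OF mG0]]) (use \<kappa>0 b in simp_all)
  also have "ln (\<Prod>x\<in>T. m x / G) = (\<Sum>x\<in>T. ln (m x / G))"
    by (rule ln_prod) (use T(1) mG0 less_imp_neq[OF mG0] in \<open>fastforce+\<close>)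
  also have "\<dots> = (\<Sum>x\<in>T. ln (m x) - ln G)"
  proof (intro sum.cong refl)
    fix x assume "x \<in> T"
    hence "0 < m x" by (rule mpos)
    thus "ln (m x / G) = ln (m x) - ln G" using G by (simp add: ln_div)
  qed
  also have "\<dots> = - (\<Sum>x\<in>T. ln G - ln (m x))" by (simp flip: sum_negf)
  also have "ln (\<kappa> ^ d * b ^ card T) = real d * ln \<kappa> + real (card T) * ln b"
    using \<kappa>0 b by (simp add: ln_mult ln_realpow)
  also have "ln \<kappa> = ln (v R) - (ln (fact (2 * d)) + real d * ln M + real e * ln G)"
    using R(1) C G M by (simp add: \<kappa>_def ln_div ln_mult ln_realpow C_def)
  also have "ln b = - (ln (real d + 1) + real d * ln (2 * M))"
  proof -
    have "ln (s * t) = ln s + ln t" if "s > 0" "t > 0" for s t :: real using that by (simp add: ln_mult)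
    hence "ln ((real d + 1) * (2 * M) ^ d) = ln (real d + 1) + ln ((2 * M) ^ d)" using M by simp
    moreover have "ln ((2 * M) ^ d) = real d * ln (2 * M)" by (rule ln_realpow)
    moreover have "ln b = - ln ((real d + 1) * (2 * M) ^ d)" unfolding b_def by (simp only: ln_inverse inverse_eq_divide[symmetric])
    ultimately show ?thesis by linarith
  qed
  finally show ?thesis by (simp add: m_def algebra_simps)
qed

lemma places_abs_val: "v \<in> places \<Longrightarrow> abs_val v"
  by (auto simp: places_def archimedean_place_def nonarchimedean_place_over_def abs_val_def)

lemma arch_placesD: "v \<in> arch_places \<Longrightarrow> arch_place v"
  by (auto simp: arch_places_def archimedean_place_def arch_place_def abs_val_def arch_place_axioms_def)

lemma nonarch_placesD:
  assumes "v \<in> places" "v \<notin> arch_places"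
  obtains p where "nonarch_place v p"
  using assms places_overD by (auto simp: places_eq)

text \<open>The factor \<open>2 d^2\<close> of the height on the right is \<open>d\<close>
  exceptional points times \<open>2 d\<close>, which bounds the degree \<open>e\<close> of the
  resultant in the coefficients. Replacing \<open>e\<close> by \<open>2 d\<close> relies on the
  nonnegativity stated first.\<close>

theorem ratfun_height_inequality:
  fixes F :: "'a::field_char_0 poly fract"
  assumes nf: "number_field TYPE('a)" and deg: "ratfun_degree F \<le> d" and d: "d \<ge> 1"
    and T: "T \<subseteq> {a..a + int N}" "T \<noteq> {}" "\<And>x. x \<in> T \<Longrightarrow> \<not> ratfun_pole F (of_int x)"
      "\<And>x. x \<in> T \<Longrightarrow> \<bar>real_of_int x\<bar> \<le> M" and M: "M \<ge> 1"
    and H: "\<And>x. x \<in> T \<Longrightarrow> height (ratfun_eval F (of_int x)) \<le> H"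
  shows "0 \<le> ratfun_height F"
    and "real (card T) * ratfun_height F \<le>
      real (card T) * (H + real d * ln (2 * M) + ln (real d + 1))
      + real d * (2 * real d * ratfun_height F + ln (fact (2 * d)) + real d * ln M) + real d * ln (fact N)"
proof -
  define p q where "p = ratfun_num F" and "q = ratfun_den F"
  have cop: "coprime p q" and q0: "q \<noteq> 0"
    unfolding p_def q_def by (rule ratfun_coprime, rule ratfun_den_nonzero)
  have degs: "degree p \<le> d" "degree q \<le> d"
    using deg by (auto simp: ratfun_degree_def p_def q_def)
  have qx: "poly q (of_int x) \<noteq> 0" if "x \<in> T" for x using T(3)[OF that] by (simp add: ratfun_pole_def q_def)
  have finT: "finite T" using T(1) finite_subset by blast
  obtain R e where Re: "R \<noteq> 0" "e \<ge> 1" "e \<le> 2 * d"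
    and Rn: "\<And>v P x G. nonarch_place v P \<Longrightarrow> (\<And>i. v (coeff p i) \<le> G) \<Longrightarrow> (\<And>i. v (coeff q i) \<le> G) \<Longrightarrow>
      v R \<le> G ^ (e - 1) * max (v (poly p (of_int x))) (v (poly q (of_int x)))"
    and Ra: "\<And>v x M G. arch_place v \<Longrightarrow> (\<And>i. v (coeff p i) \<le> G) \<Longrightarrow> (\<And>i. v (coeff q i) \<le> G) \<Longrightarrow>
      \<bar>real_of_int x\<bar> \<le> M \<Longrightarrow> M \<ge> 1 \<Longrightarrow>
      v R \<le> fact (2 * d) * M ^ d * G ^ (e - 1) * max (v (poly p (of_int x))) (v (poly q (of_int x)))"
    and Ra': "\<And>v G. arch_place v \<Longrightarrow> (\<And>i. v (coeff p i) \<le> G) \<Longrightarrow> (\<And>i. v (coeff q i) \<le> G) \<Longrightarrow>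
      v R \<le> fact (2 * d) * G ^ e"
  proof (rule resultant_bounds[OF cop q0 degs d], goal_cases)
    case (1 R e)
    show ?case by (rule 1(1); fact 1)
  qed
  define cs where "cs = set (coeffs p) \<union> set (coeffs q)"
  have cs: "finite cs" by (simp add: cs_def)
  define c where "c = lead_coeff q"
  have c: "c \<in> cs" "c \<noteq> 0" using q0 by (auto simp: c_def cs_def coeff_in_coeffs)
  \<comment> \<open>All nonzero elements whose absolute values enter. Outside \<open>W\<close> they
    have absolute value 1, so every height and every product formula becomes a sum over this one
    finite set.\<close>
  define E where "E = (cs \<union> (\<lambda>x. poly p (of_int x)) ` T \<union> (\<lambda>x. poly q (of_int x)) ` T
    \<union> {R, of_nat (fact N)}) - {0}"
  have E: "finite E" "0 \<notin> E" using cs finT by (auto simp: E_def)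
  define W where "W = arch_places \<union> (\<Union>y\<in>E. {v \<in> places. v y \<noteq> 1})"
  have "finite {v \<in> places. v y \<noteq> 1}" if "y \<in> E" for y
    by (rule finite_places_neq_1(1)[OF nf]) (use that E(2) in auto)
  hence "finite W" unfolding W_def using finite_arch_places[OF nf] E(1) by blast
  moreover have "W \<subseteq> places" "arch_places \<subseteq> W" by (auto simp: W_def places_eq)
  ultimately have W: "finite W" "W \<subseteq> places" "arch_places \<subseteq> W" by blast+
  have out: "v y = 1" if "v \<in> places" "v \<notin> W" "y \<in> E" for v y using that by (auto simp: W_def)
  have sum0: "(\<Sum>v\<in>W. weight v * ln (v y)) = 0" if "y \<in> E" for y
    by (rule sum_weight_ln[OF nf _ W(1,2)]) (use that E(2) out in auto)
  define G where "G = (\<lambda>v::'a \<Rightarrow> real. Max (v ` cs))"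
  have Gge: "v y \<le> G v" if "y \<in> cs" for v y using that cs by (simp add: G_def)
  have Gcoeff: "v (coeff f i) \<le> G v" if "v \<in> places" "f = p \<or> f = q" for v f i
  proof -
    interpret abs_val v using that(1) by (rule places_abs_val)
    show ?thesis
    proof (cases "coeff f i = 0")
      case True
      thus ?thesis using order_trans[OF nonneg Gge[OF c(1), of v]] by simp
    next
      case False
      hence "coeff f i \<in> set (coeffs f)" by (auto simp: range_coeff[symmetric] intro: coeff_in_coeffs le_degree)
      thus ?thesis using that(2) by (intro Gge) (auto simp: cs_def)
    qed
  qed
  have Gpos: "G v > 0" if "v \<in> places" for v
  proof -
    interpret abs_val v using that by (rule places_abs_val)
    show ?thesis using Gge[OF c(1), of v] c(2) less_le_trans pos_iff by blast
  qed
  have Gex: "(\<exists>i. v (coeff p i) = G v) \<or> (\<exists>i. v (coeff q i) = G v)" for v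
  proof -
    have "G v \<in> v ` cs" unfolding G_def using cs c(1) by (intro Max_in) auto
    then obtain y where y: "y \<in> cs" "G v = v y" by blast
    hence "(\<exists>i. y = coeff p i) \<or> (\<exists>i. y = coeff q i)"
      using range_coeff[of p] range_coeff[of q] by (auto simp: cs_def)
    thus ?thesis using y(2) by metis
  qed
  define m where "m = (\<lambda>(v::'a \<Rightarrow> real) x. max (v (poly p (of_int x))) (v (poly q (of_int x))))"
  have hF: "ratfun_height F = (\<Sum>v\<in>W. weight v * ln (G v))"
  proof -
    have "G v = 1" if v: "v \<in> places" "v \<notin> W" for v
    proof (rule antisym)
      interpret abs_val v using v(1) by (rule places_abs_val)
      have "v y \<le> 1" if "y \<in> cs" for y
        using out[OF v, of y] that by (cases "y = 0") (auto simp: E_def)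
      thus "G v \<le> 1" unfolding G_def using cs c(1) by (subst Max_le_iff) auto
      show "1 \<le> G v" using Gge[OF c(1), of v] out[OF v, of c] c by (simp add: E_def)
    qed
    hence "infsum (\<lambda>v. weight v * ln (G v)) places = (\<Sum>v\<in>W. weight v * ln (G v))"
      by (intro infsum_places[OF W(1,2)]) simp
    moreover have "ratfun_height F = infsum (\<lambda>v. weight v * ln (G v)) places"
      by (simp add: ratfun_height_def weight_def G_def cs_def p_def q_def)
    ultimately show ?thesis by simp
  qed
  have hx: "height (ratfun_eval F (of_int x)) = (\<Sum>v\<in>W. weight v * ln (m v x))" if x: "x \<in> T" for x
  proof -
    let ?y = "ratfun_eval F (of_int x)"
    have y: "?y = poly p (of_int x) / poly q (of_int x)" by (simp add: ratfun_eval_def p_def q_def)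
    have "height ?y = (\<Sum>v\<in>W. weight v * ln (max 1 (v ?y)))"
      unfolding height_def weight_def[symmetric]
    proof (rule infsum_places[OF W(1,2)])
      fix v :: "'a \<Rightarrow> real" assume v: "v \<in> places" "v \<notin> W"
      interpret abs_val v using v(1) by (rule places_abs_val)
      have "v ?y \<le> 1"
        using out[OF v, of "poly p (of_int x)"] out[OF v, of "poly q (of_int x)"] x qx[OF x]
        by (cases "poly p (of_int x) = 0") (auto simp: y divide E_def)
      thus "weight v * ln (max 1 (v ?y)) = 0" by (simp add: max_def)
    qed
    also have "\<dots> = (\<Sum>v\<in>W. weight v * ln (m v x) - weight v * ln (v (poly q (of_int x))))"
    proof (intro sum.cong refl)
      fix v assume "v \<in> W"
      then interpret abs_val v using W(2) places_abs_val by blast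
      have vq: "v (poly q (of_int x)) > 0" using qx[OF x] by simp
      have "max 1 (v ?y) = m v x / v (poly q (of_int x))"
        using vq by (auto simp: y divide m_def max_def field_simps)
      moreover have "m v x > 0" using vq by (simp add: m_def less_max_iff_disj)
      ultimately show "weight v * ln (max 1 (v ?y)) = weight v * ln (m v x) - weight v * ln (v (poly q (of_int x)))"
        using vq by (simp add: ln_div algebra_simps)
    qed
    also have "\<dots> = (\<Sum>v\<in>W. weight v * ln (m v x))"
      using sum0[of "poly q (of_int x)"] qx[OF x] x by (simp add: sum_subtractf E_def)
    finally show ?thesis .
  qed
  show hpos: "0 \<le> ratfun_height F"
  proof -
    \<comment> \<open>The product formula for a single nonzero coefficient, which the maximum
      dominates at each place.\<close>
    have "0 = (\<Sum>v\<in>W. weight v * ln (v c))" using sum0[of c] c by (simp add: E_def)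
    also have "\<dots> \<le> (\<Sum>v\<in>W. weight v * ln (G v))"
    proof (intro sum_mono mult_left_mono weight_nonneg)
      fix v assume v: "v \<in> W"
      then interpret abs_val v using W(2) places_abs_val by blast
      show "ln (v c) \<le> ln (G v)" using Gge[OF c(1), of v] c(2) Gpos[of v] v W(2) by auto
    qed
    finally show ?thesis by (simp add: hF)
  qed
  define B where "B = real d * (ln (fact (2 * d)) + real d * ln M)
      + real (card T) * (real d * ln (2 * M) + ln (real d + 1))"
  \<comment> \<open>The share of the resultant, common to both kinds of places. Only its sum over
    all of \<open>W\<close> simplifies, as \<open>R\<close> cancels there; hence the two kinds are
    estimated apart and recombined.\<close>
  define base where "base = (\<lambda>v. real d * (real e * ln (G v) - ln (v R)))"
  have loss_arch: "(\<Sum>x\<in>T. ln (G v) - ln (m v x)) \<le> base v + B" if v: "v \<in> arch_places" for v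
  proof -
    have vp: "v \<in> places" using v by (simp add: places_eq)
    note co = Gcoeff[OF vp, of p, simplified] Gcoeff[OF vp, of q, simplified]
    have "(\<Sum>x\<in>T. ln (G v) - ln (m v x)) \<le> real d * (real e * ln (G v) - ln (v R)) + real d * (ln (fact (2 * d)) + real d * ln M)
      + real (card T) * (real d * ln (2 * M) + ln (real d + 1))"
      unfolding m_def
      by (rule arch_loss[OF arch_placesD[OF v] co Gex Gpos[OF vp] degs finT T(4) qx M Re(1,2)
            Ra[OF arch_placesD[OF v] co T(4) M] Ra'[OF arch_placesD[OF v] co]])
    thus ?thesis by (simp add: base_def B_def)
  qed
  have loss_nonarch: "(\<Sum>x\<in>T. ln (G v) - ln (m v x)) \<le> base v - real d * ln (v (of_nat (fact N)))"
    if v: "v \<in> W - arch_places" for v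
  proof -
    have vp: "v \<in> places" using v W(2) by blast
    obtain P where P: "nonarch_place v P" using nonarch_placesD[OF vp] v by blast
    note co = Gcoeff[OF vp, of p, simplified] Gcoeff[OF vp, of q, simplified]
    show ?thesis unfolding base_def m_def
      by (rule nonarch_loss[OF P co Gex Gpos[OF vp] degs T(1,2) qx Re(1,2) Rn[OF P co]])
  qed
  have "real (card T) * ratfun_height F - (\<Sum>x\<in>T. height (ratfun_eval F (of_int x)))
      = (\<Sum>x\<in>T. (\<Sum>v\<in>W. weight v * ln (G v)) - (\<Sum>v\<in>W. weight v * ln (m v x)))"
    by (simp add: sum_subtractf hF hx)
  also have "\<dots> = (\<Sum>x\<in>T. \<Sum>v\<in>W. weight v * (ln (G v) - ln (m v x)))"
    by (simp add: sum_subtractf algebra_simps)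
  also have "\<dots> = (\<Sum>v\<in>W. weight v * (\<Sum>x\<in>T. ln (G v) - ln (m v x)))"
    by (subst sum.swap) (simp add: sum_distrib_left)
  also have "\<dots> = (\<Sum>v\<in>W - arch_places. weight v * (\<Sum>x\<in>T. ln (G v) - ln (m v x)))
      + (\<Sum>v\<in>arch_places. weight v * (\<Sum>x\<in>T. ln (G v) - ln (m v x)))"
    by (rule sum.subset_diff[OF W(3,1)])
  also have "\<dots> \<le> (\<Sum>v\<in>W - arch_places. weight v * (base v - real d * ln (v (of_nat (fact N)))))
      + (\<Sum>v\<in>arch_places. weight v * (base v + B))"
    using loss_arch loss_nonarch by (intro add_mono sum_mono mult_left_mono weight_nonneg) auto
  also have "\<dots> = ((\<Sum>v\<in>W - arch_places. weight v * base v) + (\<Sum>v\<in>arch_places. weight v * base v))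
      - real d * (\<Sum>v\<in>W - arch_places. weight v * ln (v (of_nat (fact N))))
      + (\<Sum>v\<in>(arch_places::('a \<Rightarrow> real) set). weight v) * B"
    by (simp add: algebra_simps sum_subtractf sum.distrib sum_distrib_left)
  also have "(\<Sum>v\<in>W - arch_places. weight v * base v) + (\<Sum>v\<in>arch_places. weight v * base v) = (\<Sum>v\<in>W. weight v * base v)"
    by (rule sum.subset_diff[OF W(3,1), symmetric])
  also have "(\<Sum>v\<in>W. weight v * base v) = real d * (real e * (\<Sum>v\<in>W. weight v * ln (G v)) - (\<Sum>v\<in>W. weight v * ln (v R)))"
    by (simp add: base_def algebra_simps sum_subtractf sum_distrib_left)
  also have "\<dots> = real d * real e * ratfun_height F" using sum0[of R] Re(1) by (simp add: hF E_def)
  also have "(\<Sum>v\<in>W - arch_places. weight v * ln (v (of_nat (fact N)))) = - ln (real (fact N))"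
    by (rule sum_nonarch_weight_ln_nat[OF nf _ W]) (use out in \<open>auto simp: E_def\<close>)
  also have "(\<Sum>v\<in>(arch_places::('a \<Rightarrow> real) set). weight v) = 1" by (rule sum_arch_weight[OF nf])
  finally have main: "real (card T) * ratfun_height F \<le> (\<Sum>x\<in>T. height (ratfun_eval F (of_int x)))
      + real d * real e * ratfun_height F + real d * ln (fact N) + B" by simp
  have "(\<Sum>x\<in>T. height (ratfun_eval F (of_int x))) \<le> real (card T) * H"
    using sum_bounded_above[of T "\<lambda>x. height (ratfun_eval F (of_int x))" H] H by simp
  moreover have "real d * real e * ratfun_height F \<le> real d * (2 * real d) * ratfun_height F"
    using Re(3) hpos by (intro mult_right_mono mult_left_mono) linarith+
  ultimately show "real (card T) * ratfun_height F \<le>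
      real (card T) * (H + real d * ln (2 * M) + ln (real d + 1))
      + real d * (2 * real d * ratfun_height F + ln (fact (2 * d)) + real d * ln M) + real d * ln (fact N)"
    using main unfolding B_def by (simp add: algebra_simps)
qed

section \<open>Conclusion\<close>

text \<open>
  Passing to a short interval on which \<open>S\<close> is still dense replaces \<open>D\<close> by a power of \<open>\<eta> d H\<close>.
\<close>

lemma dense_subinterval:
  fixes S :: "int set" and \<eta> K :: real
  assumes S: "S \<subseteq> {A..B}" "real_of_int (B - A) / \<eta> \<le> real (card S)" and \<eta>: "\<eta> \<ge> 1"
    and K: "K \<ge> 1" "K \<le> real_of_int (B - A)"
  obtains T a N where "T \<subseteq> S" "T \<subseteq> {a..a + int N}" "real N \<le> 4 * K"
    "K / \<eta> \<le> real (card T)" "real N / (2 * \<eta>) \<le> real (card T)"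
proof -
  \<comment> \<open>\<open>n\<close> counts the integers in a block, so the length
    \<open>n - 1\<close> of a block is at most \<open>4 * K\<close>.\<close>
  define n where "n = nat \<lceil>4 * K\<rceil>"
  have n: "real n \<ge> 4 * K" "real n < 4 * K + 1" "n \<ge> 1"
    using K(1) by (auto simp: n_def of_nat_nat) linarith+
  define D where "D = B - A"
  have finS: "finite S" using S(1) finite_subset by blast
  have D0: "real_of_int D \<ge> K" "D \<ge> 0" using K by (auto simp: D_def)
  show ?thesis
  proof (cases "D < int n")
    case True
    \<comment> \<open>The whole interval is already short enough.\<close>
    have N: "real (nat D) = real_of_int D" using D0 by simp
    have "real_of_int D \<le> real n - 1" using True by linarith
    moreover have "real_of_int D / (2 * \<eta>) \<le> real_of_int D / \<eta>"
      using \<eta> D0(2) by (intro divide_left_mono) auto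
    moreover have "K / \<eta> \<le> real_of_int D / \<eta>" using D0(1) \<eta> by (intro divide_right_mono) auto
    ultimately show ?thesis
      using S D0(2) n(2) by (intro that[of S A "nat D"]) (auto simp: D_def)
  next
    case False
    \<comment> \<open>The number of blocks needed to cover the interval; the last one may be
      incomplete.\<close>
    define k where "k = nat (D div int n) + 1"
    define block where "block = (\<lambda>j::nat. {x \<in> S. (x - A) div int n = int j})"
    have "S = (\<Union>j<k. block j)"
    proof (intro equalityI subsetI)
      fix x assume x: "x \<in> S"
      hence "0 \<le> x - A" "x - A \<le> D" using S(1) by (auto simp: D_def)
      hence "0 \<le> (x - A) div int n" "(x - A) div int n \<le> D div int n"
        using n(3) by (auto intro: zdiv_mono1 simp: pos_imp_zdiv_nonneg_iff)
      hence "x \<in> block (nat ((x - A) div int n))" "nat ((x - A) div int n) < k"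
        using x by (auto simp: block_def k_def)
      thus "x \<in> (\<Union>j<k. block j)" by blast
    qed (auto simp: block_def)
    hence "card S \<le> (\<Sum>j<k. card (block j))" by (metis card_UN_le finite_lessThan)
    have "\<exists>j<k. real (card S) / real k \<le> real (card (block j))"
    proof (rule ccontr)
      assume "\<not> (\<exists>j<k. real (card S) / real k \<le> real (card (block j)))"
      hence "(\<Sum>j<k. real (card (block j))) < (\<Sum>j<k. real (card S) / real k)"
        by (intro sum_strict_mono) (auto simp: k_def not_le)
      also have "\<dots> = real (card S)" by (simp add: k_def)
      finally show False using \<open>card S \<le> (\<Sum>j<k. card (block j))\<close> by (simp flip: of_nat_sum)
    qed
    then obtain j where j: "j < k" "real (card S) / real k \<le> real (card (block j))" by blast
    have nD: "real n \<le> real_of_int D" using False by linarith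
    have "real k \<le> real_of_int D / real n + 1"
    proof -
      have "real_of_int (D div int n) \<le> real_of_int D / real_of_int (int n)"
        by (rule real_of_int_div4)
      thus ?thesis using D0(2) n(3) by (simp add: k_def pos_imp_zdiv_nonneg_iff)
    qed
    \<comment> \<open>As \<open>n \<le> D\<close>, the incomplete block at most doubles the count;
      this is the 2 in the density \<open>1 / (2 * \<eta>)\<close>.\<close>
    also have "\<dots> \<le> 2 * real_of_int D / real n" using nD n(3) by (simp add: field_simps)
    finally have k2: "real k \<le> 2 * real_of_int D / real n" .
    have Dpos: "real_of_int D > 0" using D0(1) K(1) by linarith
    have t: "real n / (2 * \<eta>) \<le> real (card (block j))"
    proof -
      have "real n / (2 * \<eta>) = (real_of_int D / \<eta>) / (2 * real_of_int D / real n)"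
        using Dpos n(3) \<eta> by (simp add: field_simps)
      also have "\<dots> \<le> (real_of_int D / \<eta>) / real k"
        using k2 Dpos \<eta> n(3) by (intro divide_left_mono mult_pos_pos divide_pos_pos) (auto simp: k_def)
      also have "\<dots> \<le> real (card S) / real k"
        using S(2) by (intro divide_right_mono) (auto simp: D_def)
      finally show ?thesis using j(2) by simp
    qed
    show ?thesis
    proof (rule that[of "block j" "A + int (n * j)" "n - 1"])
      show "block j \<subseteq> S" by (auto simp: block_def)
      show "block j \<subseteq> {A + int (n * j)..A + int (n * j) + int (n - 1)}"
      proof
        fix x assume "x \<in> block j"
        hence "(x - A) div int n = int j" by (simp add: block_def)
        moreover define r where "r = (x - A) mod int n"
        ultimately have "x - A = int n * int j + r" by (metis div_mult_mod_eq mult.commute)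
        moreover have "0 \<le> r" "r < int n" using n(3) by (auto simp: r_def)
        ultimately show "x \<in> {A + int (n * j)..A + int (n * j) + int (n - 1)}" using n(3) by auto
      qed
      show "real (n - 1) \<le> 4 * K" using n by (simp add: of_nat_diff)
      have "K / \<eta> \<le> real n / (2 * \<eta>)" using n(1) \<eta> K(1) by (simp add: field_simps)
      thus "K / \<eta> \<le> real (card (block j))" using t by linarith
      have "real (n - 1) / (2 * \<eta>) \<le> real n / (2 * \<eta>)" using \<eta> by (intro divide_right_mono) auto
      thus "real (n - 1) / (2 * \<eta>) \<le> real (card (block j))" using t by linarith
    qed
  qed
qed

lemma ln_4_gt_1: "(1::real) < ln 4"
  using exp_le ln_less_cancel_iff[of "exp 1" 4] by (smt (verit) exp_gt_zero ln_exp ln_less_cancel_iff)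

lemma ln_fact_le: "ln (fact n) \<le> real n * ln (real n)"
proof (cases "n = 0")
  case False
  have "fact n \<le> real n ^ n" using fact_le_power[of n, where 'a = real] by simp
  hence "ln (fact n) \<le> ln (real n ^ n)" using False by (subst ln_le_cancel_iff) auto
  thus ?thesis by (simp add: ln_realpow)
qed simp

text \<open>
  The term \<open>2 d\<^sup>2 h / t\<close>, coming from the resultant, is at most \<open>h / 2\<close>; feeding the
  resulting crude bound on \<open>h\<close> back into it costs only a constant.
\<close>

lemma height_bootstrap:
  fixes h H M \<eta> t :: real and d N :: nat
  assumes d: "d \<ge> 1" and \<eta>: "\<eta> \<ge> 1" and H: "H \<ge> 4" "ln (2 * M) \<le> H" and M: "M \<ge> 1" and h: "h \<ge> 0"
    and t: "real d ^ 3 * H \<le> t" "real N / (2 * \<eta>) \<le> t" and N: "real N \<le> 4 * (\<eta> * real d ^ 3 * H)"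
    and main: "t * h \<le> t * (H + real d * ln (2 * M) + ln (real d + 1))
      + real d * (2 * real d * h + ln (fact (2 * d)) + real d * ln M) + real d * ln (fact N)"
  shows "h \<le> H + 960 * \<eta> * real d * ln (\<eta> * real d * H) + real d * ln (2 * M) + ln (real d + 1)"
proof -
  define L where "L = ln (\<eta> * real d * H)"
  define Y where "Y = H + real d * ln (2 * M) + ln (real d + 1)"
  \<comment> \<open>The ratio of \<open>2 d^2\<close> to the lower bound \<open>d^3 H\<close> for
    \<open>t\<close>. Besides \<open>\<epsilon> \<le> 1 / 2\<close>, it matters that
    \<open>\<epsilon>\<close> times the main term \<open>Y\<close> stays bounded.\<close>
  define \<epsilon> where "\<epsilon> = 2 / (real d * H)"
  have d1: "real d \<ge> 1" using d by simp
  have dH: "real d * H \<ge> 4" using mult_mono[OF d1 H(1)] by simp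
  have x4: "4 \<le> \<eta> * real d * H" using mult_mono[OF \<eta> dH] \<eta> by (simp add: mult.assoc)
  hence "ln 4 \<le> L" unfolding L_def by (subst ln_le_cancel_iff) auto
  hence L1: "L > 1" using ln_4_gt_1 by linarith
  have d3: "real d ^ 3 \<ge> 1" using d1 by simp
  have t4: "4 \<le> t" using mult_mono[OF d3 H(1)] t(1) by simp
  have \<epsilon>: "0 < \<epsilon>" "\<epsilon> \<le> 1 / 2" using dH by (auto simp: \<epsilon>_def divide_le_eq)
  have r1: "real d * (2 * real d) \<le> \<epsilon> * t"
  proof -
    have "real d * (2 * real d) = \<epsilon> * (real d ^ 3 * H)"
      using dH d1 H(1) by (simp add: \<epsilon>_def power3_eq_cube field_simps)
    also have "\<dots> \<le> \<epsilon> * t" using t(1) \<epsilon> by (intro mult_left_mono) auto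
    finally show ?thesis .
  qed
  have d3t: "4 * real d ^ 3 \<le> t"
  proof -
    have "4 * real d ^ 3 \<le> H * real d ^ 3" using H(1) d3 by (intro mult_right_mono) auto
    thus ?thesis using t(1) by (simp add: mult.commute)
  qed
  have r2: "real d * ln (fact (2 * d)) \<le> t"
  proof -
    have "ln (fact (2 * d)) \<le> real (2 * d) * ln (real (2 * d))" by (rule ln_fact_le)
    also have "\<dots> \<le> real (2 * d) * real (2 * d)"
      using d1 ln_le_minus_one[of "real (2 * d)"] by (intro mult_left_mono) auto
    finally have "real d * ln (fact (2 * d)) \<le> real d * (real (2 * d) * real (2 * d))"
      using d1 by (intro mult_left_mono) auto
    also have "\<dots> = 4 * real d ^ 3" by (simp add: power3_eq_cube)
    finally show ?thesis using d3t by linarith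
  qed
  have r3: "real d * (real d * ln M) \<le> t"
  proof -
    have "ln M \<le> ln (2 * M)" using M by (subst ln_le_cancel_iff) auto
    hence "ln M \<le> H" using H(2) by linarith
    hence "real d * (real d * ln M) \<le> real d * (real d * H)"
      using d1 by (intro mult_left_mono) auto
    also have "\<dots> \<le> real d * (real d * (real d * H))"
      using d1 H(1) mult_right_mono[of 1 "real d" H] by (intro mult_left_mono) auto
    also have "\<dots> = real d ^ 3 * H" by (simp add: power3_eq_cube)
    finally show ?thesis using t(1) by linarith
  qed
  \<comment> \<open>The 4 comes from \<open>N \<le> 4 * y ^ 3 \<le> y ^ 4\<close>, where
    \<open>y = \<eta> d H\<close> is at least 4.\<close>
  have lnN: "ln (fact N) \<le> real N * (4 * L)"
  proof (cases "N = 0")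
    case False
    define y where "y = \<eta> * real d * H"
    have y: "y \<ge> 4" using x4 by (simp add: y_def)
    have "\<eta> * real d ^ 3 * H \<le> \<eta> ^ 3 * real d ^ 3 * H ^ 3"
      using \<eta> H(1) d3 self_le_power[of \<eta> 3] self_le_power[of H 3] by (intro mult_mono) auto
    hence "real N \<le> 4 * y ^ 3" using N by (simp add: y_def power_mult_distrib)
    also have "\<dots> \<le> y * y ^ 3" using y by (intro mult_right_mono) auto
    finally have "real N \<le> y ^ 4" by (simp add: power_numeral_reduce)
    hence "ln (real N) \<le> ln (y ^ 4)" using False y by (subst ln_le_cancel_iff) auto
    also have "ln (y ^ 4) = 4 * L" using y by (simp add: ln_realpow L_def y_def)
    finally have "real N * ln (real N) \<le> real N * (4 * L)" by (intro mult_left_mono) auto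
    thus ?thesis using ln_fact_le[of N] by linarith
  qed simp
  have r4: "real d * ln (fact N) \<le> t * (8 * \<eta> * real d * L)"
  proof -
    have "real N \<le> 2 * \<eta> * t" using t(2) \<eta> by (simp add: field_simps)
    hence "real N * (4 * L) \<le> 2 * \<eta> * t * (4 * L)" using L1 by (intro mult_right_mono) auto
    hence "ln (fact N) \<le> 2 * \<eta> * t * (4 * L)" using lnN by linarith
    hence "real d * ln (fact N) \<le> real d * (2 * \<eta> * t * (4 * L))" using d1 by (intro mult_left_mono) auto
    thus ?thesis by (simp add: algebra_simps)
  qed
  define Z where "Z = 2 + 8 * \<eta> * real d * L"
  have r1': "real d * (2 * real d * h) \<le> \<epsilon> * t * h" using mult_right_mono[OF r1 h] by (simp add: mult.assoc)
  have "t * h \<le> t * (Y + Z + \<epsilon> * h)"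
  proof -
    have "t * h \<le> t * Y + (\<epsilon> * t * h + t + t) + t * (8 * \<eta> * real d * L)"
      using main r1' r2 r3 r4 unfolding Y_def distrib_left[of "real d"] by linarith
    thus ?thesis by (simp add: Z_def algebra_simps)
  qed
  hence hYZ: "h \<le> Y + Z + \<epsilon> * h" using t4 by simp
  have "\<epsilon> * h \<le> 1 / 2 * h" using \<epsilon> h by (intro mult_right_mono) auto
  \<comment> \<open>The factor 2 would be fatal in front of \<open>H\<close>, so this bound is
    inserted only in the small term \<open>\<epsilon> * h\<close>.\<close>
  with hYZ have h2: "h \<le> 2 * (Y + Z)" by argo
  have "1 * 1 \<le> \<eta> * real d" using \<eta> d1 by (intro mult_mono) auto
  hence edL: "1 \<le> \<eta> * real d * L" using mult_mono[of 1 "\<eta> * real d" 1 L] L1 by simp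
  have Z0: "Z \<ge> 0" using edL by (simp add: Z_def)
  have e1: "\<epsilon> * h \<le> 2 * (\<epsilon> * Y) + 2 * (\<epsilon> * Z)"
    using mult_left_mono[OF h2, of \<epsilon>] \<epsilon> by (simp add: algebra_simps)
  have e2: "\<epsilon> * Z \<le> 1 / 2 * Z" using \<epsilon> Z0 by (intro mult_right_mono) auto
  \<comment> \<open>Each of the three terms of \<open>Y\<close> is at most \<open>d H\<close>, and
    \<open>\<epsilon>\<close> times \<open>d H\<close> is 2.\<close>
  have e3: "\<epsilon> * Y \<le> 6"
  proof -
    have "H \<le> real d * H" using d1 H(1) mult_right_mono[of 1 "real d" H] by simp
    moreover have "real d * ln (2 * M) \<le> real d * H" using H(2) d1 by (intro mult_left_mono) auto
    moreover have "ln (real d + 1) \<le> real d" using ln_add_one_self_le_self[of "real d"] by (simp add: add.commute)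
    moreover have "real d \<le> real d * H" using d1 H(1) mult_left_mono[of 1 H "real d"] by simp
    ultimately have "Y \<le> 3 * (real d * H)" unfolding Y_def by simp
    hence "\<epsilon> * Y \<le> \<epsilon> * (3 * (real d * H))" using \<epsilon> by (intro mult_left_mono) auto
    moreover have "2 / x * x = 2" if "4 \<le> x" for x :: real using that by simp
    from this[OF dH] have "\<epsilon> * (real d * H) = 2" by (simp only: \<epsilon>_def)
    hence "\<epsilon> * (3 * (real d * H)) = 6" by (simp add: algebra_simps)
    ultimately show ?thesis by simp
  qed
  have "\<epsilon> * h \<le> 12 + Z" using e1 e2 e3 by argo
  \<comment> \<open>The feedback adds \<open>12 + Z\<close>, and the two copies of \<open>Z\<close>
    give \<open>4 + 16 \<eta> d L\<close>.\<close>
  hence "h \<le> Y + 16 + 16 * (\<eta> * real d * L)" using hYZ unfolding Z_def by argo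
  \<comment> \<open>Since \<open>\<eta> d L \<ge> 1\<close>, this step would already hold with 32;
    960 is the value demanded over the rationals.\<close>
  also have "\<dots> \<le> Y + 960 * (\<eta> * real d * L)" using edL by argo
  finally show ?thesis by (simp add: Y_def L_def algebra_simps)
qed

theorem theorem1p2:
  assumes "number_field TYPE('a::field_char_0)"
  shows "\<exists>C::real. ((UNIV :: 'a set) = \<rat> \<longrightarrow> C = 960) \<and>
    (\<forall>(A::int) (B::int) (F :: 'a poly fract) (d::nat) (S :: int set) (\<eta>::real) (H::real).
      let D = B - A; M = max \<bar>A\<bar> \<bar>B\<bar> in
      A \<le> B \<longrightarrow>
      1 \<le> d \<longrightarrow>
      ratfun_degree F \<le> d \<longrightarrow>
      S \<subseteq> {A..B} \<longrightarrow>
      (\<forall>x\<in>S. \<not> ratfun_pole F (of_int x)) \<longrightarrow>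
      1 \<le> \<eta> \<longrightarrow>
      H \<ge> max 4 (ln (2 * real_of_int M)) \<longrightarrow>
      (\<forall>x\<in>S. height (ratfun_eval F (of_int x)) \<le> H) \<longrightarrow>
      real (card S) \<ge> real_of_int D / \<eta> \<longrightarrow>
      real_of_int D \<ge> max (\<eta> * real d ^ 3 * H)
        (4 * \<eta> * real d * real (number_field_degree TYPE('a))) \<longrightarrow>
      ratfun_height F \<le> H + C * \<eta> * real d * ln (\<eta> * real d * H)
        + real d * ln (2 * real_of_int M) + ln (real d + 1))"
proof (rule exI[of _ 960], rule conjI, simp, unfold Let_def, intro allI impI)
  fix A B :: int and F :: "'a poly fract" and d :: nat and S :: "int set" and \<eta> H :: real
  define M where "M = real_of_int (max \<bar>A\<bar> \<bar>B\<bar>)"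
  \<comment> \<open>\<open>K / \<eta> = d^3 H\<close> is the number of points that the averaging
    needs, and \<open>K\<close> is below \<open>B - A\<close>, so a subinterval of length at most
    \<open>4 * K\<close> can supply them.\<close>
  define K where "K = \<eta> * real d ^ 3 * H"
  assume "A \<le> B" and d: "1 \<le> d" and deg: "ratfun_degree F \<le> d" and S: "S \<subseteq> {A..B}"
    and pole: "\<forall>x\<in>S. \<not> ratfun_pole F (of_int x)" and \<eta>: "1 \<le> \<eta>"
    and H: "max 4 (ln (2 * real_of_int (max \<bar>A\<bar> \<bar>B\<bar>))) \<le> H"
    and height: "\<forall>x\<in>S. height (ratfun_eval F (of_int x)) \<le> H"
    and card: "real_of_int (B - A) / \<eta> \<le> real (card S)"
    and D: "max (\<eta> * real d ^ 3 * H) (4 * \<eta> * real d * real (number_field_degree TYPE('a)))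
      \<le> real_of_int (B - A)"
  have H4: "H \<ge> 4" "ln (2 * M) \<le> H" using H by (simp_all add: M_def)
  have "1 * 1 \<le> \<eta> * real d ^ 3" using \<eta> d by (intro mult_mono one_le_power) auto
  hence "1 * 4 \<le> K" unfolding K_def using H4 by (intro mult_mono) auto
  hence K: "K \<ge> 1" "K \<le> real_of_int (B - A)" "B - A \<ge> 1" using D by (simp_all add: K_def)
  obtain T a N where T: "T \<subseteq> S" "T \<subseteq> {a..a + int N}" "real N \<le> 4 * K"
    "K / \<eta> \<le> real (card T)" "real N / (2 * \<eta>) \<le> real (card T)"
    by (rule dense_subinterval[OF S card \<eta> K(1,2)])
  have M1: "M \<ge> 1" using K(3) unfolding M_def by linarith
  have TM: "\<bar>real_of_int x\<bar> \<le> M" if "x \<in> T" for x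
  proof -
    have "A \<le> x" "x \<le> B" using that T(1) S by auto
    hence "\<bar>x\<bar> \<le> max \<bar>A\<bar> \<bar>B\<bar>" by linarith
    thus ?thesis unfolding M_def by linarith
  qed
  have "0 < K / \<eta>" using K(1) \<eta> by simp
  hence "T \<noteq> {}" using T(4) by auto
  note ineq = ratfun_height_inequality[OF assms deg d T(2) this _ TM M1]
  have h0: "0 \<le> ratfun_height F"
    by (rule ineq(1)) (use pole height T(1) in blast)+
  have "real (card T) * ratfun_height F \<le>
      real (card T) * (H + real d * ln (2 * M) + ln (real d + 1))
      + real d * (2 * real d * ratfun_height F + ln (fact (2 * d)) + real d * ln M) + real d * ln (fact N)"
    by (rule ineq(2)) (use pole height T(1) in blast)+
  moreover have "real d ^ 3 * H \<le> real (card T)" using T(4) \<eta> by (simp add: K_def)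
  ultimately show "ratfun_height F \<le> H + 960 * \<eta> * real d * ln (\<eta> * real d * H)
        + real d * ln (2 * real_of_int (max \<bar>A\<bar> \<bar>B\<bar>)) + ln (real d + 1)"
    using height_bootstrap[OF d \<eta> H4 M1 h0 _ T(5) T(3)[unfolded K_def]] by (simp only: M_def)
qed

end
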